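(* Let $n,d$ be integers with $3\leq d\leq n-3$, and let $G\in\mathcal{B}(n,d)$ with $G\neq B_{n,d}$ (i.e. $G$ is not isomorphic to $B_{n,d}$). Let $t$ be the number of common vertices of the two cycles $C_a$, $C_b$ of $G$. If $t\geq 1$ (i.e. $G$ does not contain two vertex-disjoint cycles), then for every orientation $\sigma$ of $G$, $$G^{\sigma}\succ B^{-,-,-}_{n,d}.$$
   Context: All graphs are finite and simple. For an undirected graph $G$ on vertex set $\{1,\dots,n\}$, an orientation $\sigma$ assigns a direction to each edge, giving the oriented graph $G^{\sigma}$. Its skew-adjacency matrix $S(G^{\sigma})=[s_{ij}]$ has $s_{ij}=1$, $s_{ji}=-1$ if $(i,j)$ is an arc, and $s_{ij}=s_{ji}=0$ otherwise. Write the skew characteristic polynomial as $\phi(G^{\sigma};x)=\det(xI_n-S(G^{\sigma}))=\sum_{i=0}^{n}a_i(G^{\sigma})x^{n-i}$. (One has $a_{2i}\ge 0$ and $a_{2i+1}=0$.) For oriented graphs $G_1^{\sigma_1},G_2^{\sigma_2}$ of the same order $n$: $G_1^{\sigma_1}\succeq G_2^{\sigma_2}$ means $a_{2i}(G_1^{\sigma_1})\ge a_{2i}(G_2^{\sigma_2})$ for all $0\le i\le\lfloor n/2\rfloor$; $G_1^{\sigma_1}\succ G_2^{\sigma_2}$ means in addition that the inequality is strict for at least one index. A bicyclic graph on $n$ vertices is a connected graph with $n+1$ edges. It contains either exactly two cycles $C_a,C_b$, having $t\le 1$ common vertices, or exactly three cycles, in which case $C_a,C_b$ are two of them having $t\geq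 2$ common vertices. In particular $t=0$ exactly when $G$ contains two vertex-disjoint cycles. $\mathcal{B}(n)$ is the class of bicyclic graphs on $n$ vertices containing no two vertex-disjoint odd cycles of lengths $s$ and $l$ with $s+l\equiv 2\pmod 4$. For $2\le d\le n-3$, $\mathcal{B}(n,d)$ is the class of graphs in $\mathcal{B}(n)$ with diameter $d$ (the greatest distance between two vertices). $B_{n,d}$ is the bicyclic graph obtained from $K_{2,3}$, whose two vertices of degree three are $x,y$, by identifying an end vertex of the path $P_{d-2}$ on $d-2$ vertices with $x$ and attaching $n-d-2$ pendent edges at $y$. An even cycle of an oriented graph is evenly oriented if, when traversed in a chosen direction, an even number of its edges are oriented in that direction. $B^{-,-,-}_{n,d}$ denotes $B_{n,d}$ with an orientation in which all three 4-cycles are evenly oriented (the coefficients $a_i$ do not depend on which such orientation is chosen). *)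

theory Defs
  imports
    "Graph_Theory.Graph_Theory"
    "Jordan_Normal_Form.Char_Poly"
begin

text \<open>
  Undirected simple graphs are the symmetric digraphs \<^locale>\<open>pair_graph\<close>: an edge \<open>uv\<close> is
  represented by the two arcs \<open>(u, v)\<close> and \<open>(v, u)\<close>. The vertex set of a graph of order \<open>n\<close> is
  \<open>{..<n}\<close> rather than \<open>{1..n}\<close>, so that vertices are matrix indices.
\<close>

definition edges :: "'a pair_pre_digraph \<Rightarrow> 'a set set" where
  "edges G = (\<lambda>(u, v). {u, v}) ` parcs G"

text \<open>
  A closed walk \<open>u, v, u\<close> counts as a cycle for \<^const>\<open>pre_digraph.cycle\<close>; the length bound excludes
  it. A list \<open>p\<close> of arcs is a cycle together with a starting vertex and a direction of traversal;
  the cycle as a subgraph is given by \<open>cycle_edges p\<close>.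
\<close>

definition is_cycle :: "'a pair_pre_digraph \<Rightarrow> ('a \<times> 'a) list \<Rightarrow> bool" where
  "is_cycle G p \<longleftrightarrow> pre_digraph.cycle (with_proj G) p \<and> 3 \<le> length p"

definition cycle_verts :: "('a \<times> 'a) list \<Rightarrow> 'a set" where
  "cycle_verts p = fst ` set p"

definition cycle_edges :: "('a \<times> 'a) list \<Rightarrow> 'a set set" where
  "cycle_edges p = (\<lambda>(u, v). {u, v}) ` set p"

definition diameter :: "'a pair_pre_digraph \<Rightarrow> ereal" where
  "diameter G = (SUP u\<in>pverts G. SUP v\<in>pverts G. wf_digraph.\<mu> (with_proj G) (\<lambda>_. 1) u v)"

definition bicyclic :: "nat \<Rightarrow> nat pair_pre_digraph \<Rightarrow> bool" where
  "bicyclic n G \<longleftrightarrow> pair_graph G \<and> pverts G = {..<n} \<and>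
     Digraph_Component.connected (with_proj G) \<and> card (edges G) = n + 1"

definition bicyclic_class :: "nat \<Rightarrow> nat pair_pre_digraph set" where
  "bicyclic_class n = {G. bicyclic n G \<and>
     \<not> (\<exists>p q. is_cycle G p \<and> is_cycle G q \<and> cycle_verts p \<inter> cycle_verts q = {} \<and>
          odd (length p) \<and> odd (length q) \<and> (length p + length q) mod 4 = 2)}"

definition bicyclic_class_diam :: "nat \<Rightarrow> nat \<Rightarrow> nat pair_pre_digraph set" where
  "bicyclic_class_diam n d = {G \<in> bicyclic_class n. diameter G = ereal (real d)}"

text \<open>
  In \<open>B n d\<close> (for \<open>3 \<le> d\<close> and \<open>d + 3 \<le> n\<close>), the vertices \<open>x = 0\<close>, \<open>y = 1\<close> and \<open>2, 3, 4\<close> induce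
  the \<open>K\<^sub>2\<^sub>,\<^sub>3\<close>; the path on \<open>d - 2\<close> vertices is \<open>0, 5, 6, \<dots>, d + 1\<close>; the remaining
  \<open>n - d - 2\<close> vertices \<open>d + 2, \<dots>, n - 1\<close> are pendent at \<open>y\<close>.
\<close>

definition B_path_vertex :: "nat \<Rightarrow> nat" where
  "B_path_vertex k = (if k = 0 then 0 else k + 4)"

definition B :: "nat \<Rightarrow> nat \<Rightarrow> nat pair_pre_digraph" where
  "B n d = \<lparr> pverts = {..<n},
     parcs = symcl ({0, 1} \<times> {2, 3, 4} \<union>
       {(B_path_vertex k, B_path_vertex (Suc k)) | k. k < d - 3} \<union>
       {1} \<times> {d + 2..<n}) \<rparr>"

definition orientation :: "'a pair_pre_digraph \<Rightarrow> 'a pair_pre_digraph \<Rightarrow> bool" where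
  "orientation G H \<longleftrightarrow> mk_symmetric (with_proj H) = G \<and> asym (parcs H)"

definition evenly_oriented :: "'a pair_pre_digraph \<Rightarrow> ('a \<times> 'a) list \<Rightarrow> bool" where
  "evenly_oriented H p \<longleftrightarrow> even (length p) \<and> even (length (filter (\<lambda>e. e \<in> parcs H) p))"

text \<open>
  The orientations \<open>B\<^sup>-\<^sup>,\<^sup>-\<^sup>,\<^sup>-\<close> of \<open>B n d\<close>. All of them have the same skew characteristic polynomial.
\<close>

definition B_even_orientation :: "nat \<Rightarrow> nat \<Rightarrow> nat pair_pre_digraph \<Rightarrow> bool" where
  "B_even_orientation n d H \<longleftrightarrow> orientation (B n d) H \<and>
     (\<forall>p. is_cycle (B n d) p \<and> length p = 4 \<longrightarrow> evenly_oriented H p)"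

definition skew_adjacency :: "nat \<Rightarrow> nat pair_pre_digraph \<Rightarrow> int mat" where
  "skew_adjacency n H = mat n n (\<lambda>(i, j).
     if (i, j) \<in> parcs H then 1 else if (j, i) \<in> parcs H then -1 else 0)"

definition skew_coeff :: "nat \<Rightarrow> nat pair_pre_digraph \<Rightarrow> nat \<Rightarrow> int" where
  "skew_coeff n H i = coeff (char_poly (skew_adjacency n H)) (n - i)"

definition skew_succeq :: "nat \<Rightarrow> nat pair_pre_digraph \<Rightarrow> nat pair_pre_digraph \<Rightarrow> bool" where
  "skew_succeq n H1 H2 \<longleftrightarrow>
     (\<forall>i \<le> n div 2. skew_coeff n H1 (2 * i) \<ge> skew_coeff n H2 (2 * i))"

definition skew_succ :: "nat \<Rightarrow> nat pair_pre_digraph \<Rightarrow> nat pair_pre_digraph \<Rightarrow> bool" where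
  "skew_succ n H1 H2 \<longleftrightarrow> skew_succeq n H1 H2 \<and>
     (\<exists>i \<le> n div 2. skew_coeff n H1 (2 * i) > skew_coeff n H2 (2 * i))"

end

theory Submission
  imports Defs
begin

text \<open>
  The coefficient \<open>a\<^sub>2\<^sub>i\<close> is the sum of the principal minors of order \<open>2 i\<close>. Each of them is nonnegative,
  and it is preserved when a leaf is deleted together with its neighbour, so that it equals \<open>1\<close> on every
  vertex set whose perfect matching is forced leaf by leaf.

  Fix a shortest path \<open>P\<close> of length \<open>d\<close> and sort the vertex sets by their trace \<open>Y\<close> on the
  complement \<open>U\<close> of \<open>P\<close>. A vertex of \<open>U\<close> has at most three neighbours on \<open>P\<close>, at mutual distance at
  most two. Hence the traces which are single vertices, edges, pairs of vertices, or an edge together with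
  a further vertex contribute at least certain matching polynomials of paths. Exactly \<open>|U| + 2\<close> edges do
  not belong to \<open>P\<close>, and a forest of edges leading towards \<open>P\<close> accounts for all but two of them; this bounds
  the loss from cycles and makes the contributions add up to the polynomial of \<open>B\<^sup>-\<^sup>,\<^sup>-\<^sup>,\<^sup>-\<close>. The latter is
  computed by noting that the three vertices of degree two in \<open>K\<^sub>2\<^sub>,\<^sub>3\<close> give proportional rows. Unless the
  graph is \<open>B\<^sub>n\<^sub>,\<^sub>d\<close>, some estimate is strict in \<open>a\<^sub>4\<close> or in \<open>a\<^sub>6\<close>.
\<close>

section \<open>Principal minors of skew-symmetric matrices\<close>

text \<open>The orientation of G is arbitrary, so a minor whose vertex set spans a cycle may fall
  below its number of perfect matchings (an evenly oriented 4-cycle has minor 0). In the bound for G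
  such terms are never evaluated: where no matching is forced, nonnegativity is used and the term is
  dropped. This crude count suffices because \<open>B\<close> is tight for it. With N = |U|, the
  path gives \<open>\<phi> (Suc d)\<close>, each of the N vertices of U gives
  \<open>\<alpha> + \<gamma>\<close>, the vertices u1 and u2 add one \<beta> each, and the 2 (N - 2)
  pairs of a pendent vertex with u1 or u2 give one \<gamma> each; hence the coefficient N + 2 (N -
  2) = 3 N - 4 of \<gamma>. In general the two edges beyond the forest are edges inside U, worth at
  least an \<alpha>, or further edges from a vertex to P, worth a \<beta>. As \<beta> is at most
  \<alpha>, everything hinges on collecting enough \<gamma>. The coefficient of order two counts
  edges and is n + 1 for both graphs, so a surplus can only appear from \<xi> * \<xi> on.\<close>

definition principal_minor :: "('a \<Rightarrow> 'a \<Rightarrow> 'b::comm_ring_1) \<Rightarrow> 'a set \<Rightarrow> 'b" where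
  "principal_minor s X = (\<Sum>p | p permutes X. of_int (sign p) * (\<Prod>i\<in>X. s i (p i)))"

lemma principal_minor_empty [simp]: "principal_minor s {} = 1"
  by (simp add: principal_minor_def)

lemma principal_minor_zero_row:
  assumes "finite X" "u \<in> X" "\<And>j. j \<in> X \<Longrightarrow> s u j = 0"
  shows "principal_minor s X = 0"
  unfolding principal_minor_def
proof (intro sum.neutral ballI, clarify)
  fix p assume "p permutes X"
  hence "s u (p u) = 0"
    using assms permutes_in_image by fastforce
  thus "of_int (sign p) * (\<Prod>i\<in>X. s i (p i)) = 0"
    using assms(1,2) by (metis mult_zero_right prod_zero)
qed

lemma principal_minor_cong:
  assumes "\<And>i j. i \<in> X \<Longrightarrow> j \<in> X \<Longrightarrow> s i j = s' i j"
  shows "principal_minor s X = principal_minor s' X"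
  unfolding principal_minor_def
  by (intro sum.cong refl arg_cong2[where f = "(*)"] prod.cong) (auto simp: assms permutes_in_image)

lemma principal_minor_of_int:
  "principal_minor (\<lambda>i j. of_int (s i j)) X = of_int (principal_minor s X)"
  by (simp add: principal_minor_def)

lemma principal_minor_scale:
  assumes "finite X"
  shows "principal_minor (\<lambda>i j. c * s i j) X = c ^ card X * principal_minor s X"
  using assms
  by (simp add: principal_minor_def prod.distrib sum_distrib_left algebra_simps)

text \<open>In the Leibniz product each row contributes either its \<open>x i\<close> or its entry
  of s. Rows contributing \<open>x i\<close> must be fixed points, so the remaining rows Z carry a
  permutation of Z.\<close>

lemma det_diag_add:
  fixes s :: "nat \<Rightarrow> nat \<Rightarrow> 'a::comm_ring_1"
  shows "det (mat n n (\<lambda>(i, j). (if i = j then x i else 0) + s i j)) =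
    (\<Sum>Z\<in>Pow {..<n}. principal_minor s Z * (\<Prod>i\<in>{..<n} - Z. x i))"
proof -
  let ?M = "mat n n (\<lambda>(i, j). (if i = j then x i else 0) + s i j)"
  have "det ?M = (\<Sum>p | p permutes {..<n}. of_int (sign p) *
      (\<Prod>i\<in>{..<n}. s i (p i) + (if i = p i then x i else 0)))"
    by (subst det_def'[of _ n])
       (auto simp: atLeast0LessThan algebra_simps permutes_in_image intro!: sum.cong prod.cong)
  also have "\<dots> = (\<Sum>p | p permutes {..<n}. \<Sum>Z\<in>Pow {..<n}. of_int (sign p) *
      ((\<Prod>i\<in>Z. s i (p i)) * (\<Prod>i\<in>{..<n} - Z. if i = p i then x i else 0)))"
    by (simp add: prod_add sum_distrib_left)
  also have "\<dots> = (\<Sum>Z\<in>Pow {..<n}. \<Sum>p | p permutes {..<n}. of_int (sign p) *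
      ((\<Prod>i\<in>Z. s i (p i)) * (\<Prod>i\<in>{..<n} - Z. if i = p i then x i else 0)))"
    by (rule sum.swap)
  also have "\<dots> = (\<Sum>Z\<in>Pow {..<n}. principal_minor s Z * (\<Prod>i\<in>{..<n} - Z. x i))"
  proof (rule sum.cong[OF refl])
    fix Z assume Z: "Z \<in> Pow {..<n}"
    have "(\<Sum>p | p permutes {..<n}. of_int (sign p) *
        ((\<Prod>i\<in>Z. s i (p i)) * (\<Prod>i\<in>{..<n} - Z. if i = p i then x i else 0))) =
      (\<Sum>p | p permutes Z. of_int (sign p) * (\<Prod>i\<in>Z. s i (p i)) * (\<Prod>i\<in>{..<n} - Z. x i))"
    proof (rule sum.mono_neutral_cong_right)
      show "finite {p. p permutes {..<n}}" by (simp add: finite_permutations)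
      show "{p. p permutes Z} \<subseteq> {p. p permutes {..<n}}" using Z by (auto intro: permutes_subset)
      show "\<forall>p\<in>{p. p permutes {..<n}} - {p. p permutes Z}. of_int (sign p) *
          ((\<Prod>i\<in>Z. s i (p i)) * (\<Prod>i\<in>{..<n} - Z. if i = p i then x i else 0)) = 0"
      proof
        fix p assume p: "p \<in> {p. p permutes {..<n}} - {p. p permutes Z}"
        then obtain i where "i \<in> {..<n} - Z" "p i \<noteq> i"
          using permutes_superset[of p "{..<n}" Z] by auto
        hence "(\<Prod>i\<in>{..<n} - Z. if i = p i then x i else 0) = 0"
          by (intro prod_zero) (auto intro!: bexI[of _ i])
        thus "of_int (sign p) *
          ((\<Prod>i\<in>Z. s i (p i)) * (\<Prod>i\<in>{..<n} - Z. if i = p i then x i else 0)) = 0" by simp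
      qed
      fix p assume "p \<in> {p. p permutes Z}"
      hence "(\<Prod>i\<in>{..<n} - Z. if i = p i then x i else 0) = (\<Prod>i\<in>{..<n} - Z. x i)"
        by (intro prod.cong) (auto simp: permutes_def)
      thus "of_int (sign p) *
          ((\<Prod>i\<in>Z. s i (p i)) * (\<Prod>i\<in>{..<n} - Z. if i = p i then x i else 0)) =
        of_int (sign p) * (\<Prod>i\<in>Z. s i (p i)) * (\<Prod>i\<in>{..<n} - Z. x i)" by simp
    qed
    thus "(\<Sum>p | p permutes {..<n}. of_int (sign p) *
        ((\<Prod>i\<in>Z. s i (p i)) * (\<Prod>i\<in>{..<n} - Z. if i = p i then x i else 0))) =
      principal_minor s Z * (\<Prod>i\<in>{..<n} - Z. x i)"
      by (simp add: principal_minor_def sum_distrib_right)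
  qed
  finally show ?thesis .
qed

text \<open>The previous expansion over the polynomial ring, with the indeterminate as every
  \<open>x i\<close> and s negated. The sign disappears for the even orders used later.\<close>

lemma coeff_char_poly_principal_minors:
  fixes s :: "nat \<Rightarrow> nat \<Rightarrow> 'a::comm_ring_1"
  assumes "k \<le> n"
  shows "coeff (char_poly (mat n n (\<lambda>(i, j). s i j))) (n - k) =
    (-1) ^ k * (\<Sum>Z | Z \<subseteq> {..<n} \<and> card Z = k. principal_minor s Z)"
proof -
  have "char_poly (mat n n (\<lambda>(i, j). s i j)) =
      det (mat n n (\<lambda>(i, j). (if i = j then [:0, 1:] else 0) + [:-1:] * [:s i j:]))"
    unfolding char_poly_defs by (rule arg_cong[where f = det]) auto
  also have "\<dots> = (\<Sum>Z\<in>Pow {..<n}. principal_minor (\<lambda>i j. [:-1:] * [:s i j:]) Z *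
      (\<Prod>i\<in>{..<n} - Z. [:0, 1:]))"
    by (rule det_diag_add)
  also have "\<dots> = (\<Sum>Z\<in>Pow {..<n}. monom ((-1) ^ card Z * principal_minor s Z) (n - card Z))"
  proof (rule sum.cong[OF refl])
    fix Z assume Z: "Z \<in> Pow {..<n}"
    hence fin: "finite Z" using finite_subset by auto
    have c: "card ({..<n} - Z) = n - card Z"
      using Z fin by (simp add: card_Diff_subset)
    have "principal_minor (\<lambda>i j. [:s i j:]) Z = [:principal_minor s Z:]"
    proof -
      have "of_int (sign p) * (\<Prod>i\<in>Z. [:s i (p i):]) =
          [:of_int (sign p) * (\<Prod>i\<in>Z. s i (p i)):]" for p :: "nat \<Rightarrow> nat"
      proof -
        have "(\<Prod>i\<in>Z. [:s i (p i):]) = [:\<Prod>i\<in>Z. s i (p i):]"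
          using fin by (induction Z rule: finite_induct) (auto simp: one_pCons mult.commute)
        thus ?thesis by (simp add: of_int_poly)
      qed
      hence "principal_minor (\<lambda>i j. [:s i j:]) Z =
          (\<Sum>p | p permutes Z. [:of_int (sign p) * (\<Prod>i\<in>Z. s i (p i)):])"
        by (simp add: principal_minor_def)
      also have "\<dots> = [:principal_minor s Z:]"
        unfolding principal_minor_def
        by (induction "{p. p permutes Z}" rule: infinite_finite_induct)
           (auto intro!: poly_eqI simp: coeff_sum coeff_pCons split: nat.splits)
      finally show ?thesis .
    qed
    moreover have "[:-1:] ^ k = [:(-1) ^ k :: 'a:]" for k
      by (induction k) (auto simp: one_pCons)
    moreover have "[:0, 1:] ^ k = monom (1::'a) k" for k
      by (simp add: monom_altdef)
    ultimately show "principal_minor (\<lambda>i j. [:-1:] * [:s i j:]) Z * (\<Prod>i\<in>{..<n} - Z. [:0, 1:]) =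
        monom ((-1) ^ card Z * principal_minor s Z) (n - card Z)"
      unfolding principal_minor_scale[OF fin] prod_constant c by (simp add: smult_monom)
  qed
  finally have "coeff (char_poly (mat n n (\<lambda>(i, j). s i j))) (n - k) =
      (\<Sum>Z\<in>Pow {..<n}. if n - card Z = n - k then (-1) ^ card Z * principal_minor s Z else 0)"
    by (simp add: coeff_sum)
  also have "\<dots> = (\<Sum>Z | Z \<subseteq> {..<n} \<and> card Z = k. (-1) ^ k * principal_minor s Z)"
  proof (rule sum.mono_neutral_cong_right)
    show "\<forall>Z\<in>Pow {..<n} - {Z. Z \<subseteq> {..<n} \<and> card Z = k}.
        (if n - card Z = n - k then (-1) ^ card Z * principal_minor s Z else 0) = 0"
    proof
      fix Z assume Z: "Z \<in> Pow {..<n} - {Z. Z \<subseteq> {..<n} \<and> card Z = k}"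
      hence "card Z \<le> n" using card_mono[of "{..<n}" Z] by auto
      with Z assms show "(if n - card Z = n - k then (-1) ^ card Z * principal_minor s Z else 0) = 0"
        by auto
    qed
  qed auto
  finally show ?thesis by (simp add: sum_distrib_left)
qed

text \<open>Scaling the skew part by \<open>\<tau> \<in> [0, 1]\<close> keeps the determinant nonzero, hence positive.\<close>

lemma det_diag_add_skew_pos:
  fixes s :: "nat \<Rightarrow> nat \<Rightarrow> real"
  assumes skew: "\<And>i j. s i j = - s j i" and pos: "\<And>i. i < n \<Longrightarrow> x i > 0"
  shows "det (mat n n (\<lambda>(i, j). (if i = j then x i else 0) + s i j)) > 0"
proof -
  define g where "g \<tau> = det (mat n n (\<lambda>(i, j). (if i = j then x i else 0) + \<tau> * s i j))" for \<tau>
  have g: "g \<tau> = (\<Sum>Z\<in>Pow {..<n}. \<tau> ^ card Z * principal_minor s Z * (\<Prod>i\<in>{..<n} - Z. x i))" for \<tau>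
    unfolding g_def det_diag_add
    by (intro sum.cong refl) (auto simp: principal_minor_scale finite_subset[of _ "{..<n}"])
  \<comment> \<open>For a kernel vector w, pairing with w leaves only the diagonal part, because the
    quadratic form \<open>Q\<close> of a skew matrix is zero. Positive diagonal entries then force w
    = 0.\<close>
  have nz: "g \<tau> \<noteq> 0" for \<tau>
  proof
    let ?M = "mat n n (\<lambda>(i, j). (if i = j then x i else 0) + \<tau> * s i j)"
    assume "g \<tau> = 0"
    then obtain w where w: "w \<in> carrier_vec n" "w \<noteq> 0\<^sub>v n" "?M *\<^sub>v w = 0\<^sub>v n"
      unfolding g_def using det_0_iff_vec_prod_zero_field[of ?M n] by auto
    have row: "(\<Sum>j<n. ((if i = j then x i else 0) + \<tau> * s i j) * w $ j) = 0" if "i < n" for i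
    proof -
      have "(?M *\<^sub>v w) $ i = 0" using w(3) that by simp
      thus ?thesis using that w(1)
        by (auto simp: scalar_prod_def atLeast0LessThan)
    qed
    define Q where "Q = (\<Sum>i<n. \<Sum>j<n. w $ i * s i j * w $ j)"
    have "Q = (\<Sum>i<n. \<Sum>j<n. w $ j * s j i * w $ i)"
      unfolding Q_def by (rule sum.swap)
    also have "\<dots> = (\<Sum>i<n. \<Sum>j<n. - (w $ i * s i j * w $ j))"
      by (intro sum.cong refl) (subst skew, simp)
    also have "\<dots> = - Q" by (simp add: Q_def sum_negf)
    finally have Q: "Q = 0" by simp
    have "0 = (\<Sum>i<n. w $ i * (\<Sum>j<n. ((if i = j then x i else 0) + \<tau> * s i j) * w $ j))"
      using row by simp
    also have "\<dots> = (\<Sum>i<n. (\<Sum>j<n. (if i = j then x i * (w $ i)\<^sup>2 else 0)) +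
        \<tau> * (\<Sum>j<n. w $ i * s i j * w $ j))"
    proof (rule sum.cong[OF refl])
      fix i assume "i \<in> {..<n}"
      have "w $ i * (\<Sum>j<n. ((if i = j then x i else 0) + \<tau> * s i j) * w $ j) =
          (\<Sum>j<n. (if i = j then x i * (w $ i)\<^sup>2 else 0) + \<tau> * (w $ i * s i j * w $ j))"
        unfolding sum_distrib_left
        by (rule sum.cong[OF refl]) (simp add: power2_eq_square algebra_simps)
      thus "w $ i * (\<Sum>j<n. ((if i = j then x i else 0) + \<tau> * s i j) * w $ j) =
          (\<Sum>j<n. (if i = j then x i * (w $ i)\<^sup>2 else 0)) +
          \<tau> * (\<Sum>j<n. w $ i * s i j * w $ j)"
        by (simp only: sum.distrib sum_distrib_left)
    qed
    also have "\<dots> = (\<Sum>i<n. x i * (w $ i)\<^sup>2) + \<tau> * Q"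
      by (simp add: sum.distrib Q_def sum_distrib_left)
    finally have "(\<Sum>i<n. x i * (w $ i)\<^sup>2) = 0" using Q by simp
    moreover have "\<And>i. i \<in> {..<n} \<Longrightarrow> x i * (w $ i)\<^sup>2 \<ge> 0"
      using pos by (simp add: less_imp_le)
    ultimately have "x i * (w $ i)\<^sup>2 = 0" if "i < n" for i
      using that sum_nonneg_eq_0_iff[of "{..<n}" "\<lambda>i. x i * (w $ i)\<^sup>2"] by simp
    hence "w $ i = 0" if "i < n" for i
      using that pos[OF that] by (metis mult_eq_0_iff less_irrefl power_eq_0_iff)
    hence "w = 0\<^sub>v n" using w(1) by (intro eq_vecI) auto
    with w(2) show False by simp
  qed
  have "g 0 = (\<Sum>Z\<in>Pow {..<n}. if Z = {} then (\<Prod>i<n. x i) else 0)"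
    unfolding g by (intro sum.cong refl) (auto simp: finite_subset[of _ "{..<n}"] power_0_left)
  hence "g 0 = (\<Prod>i<n. x i)" by simp
  hence g0: "g 0 > 0" using pos by (auto intro: prod_pos)
  have "continuous_on {0..1} g"
    unfolding g by (intro continuous_intros)
  have "g 1 > 0"
  proof (rule ccontr)
    assume "\<not> g 1 > 0"
    hence "\<exists>\<tau>\<ge>0. \<tau> \<le> 1 \<and> g \<tau> = 0"
      using g0 \<open>continuous_on {0..1} g\<close> by (intro IVT2') auto
    with nz show False by blast
  qed
  thus ?thesis by (simp add: g_def)
qed

text \<open>With the skew part cut down to X, diagonal x on X and 1 elsewhere, the determinant is
  positive for x > 0 and tends to the minor on X as x decreases to 0. This limit argument replaces
  the square of the Pfaffian.\<close>

lemma principal_minor_skew_nonneg: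
  fixes s :: "nat \<Rightarrow> nat \<Rightarrow> int"
  assumes skew: "\<And>i j. s i j = - s j i" and "finite X"
  shows "principal_minor s X \<ge> 0"
proof -
  obtain n where n: "X \<subseteq> {..<n}" using assms(2) finite_nat_iff_bounded by blast
  define s' where "s' = (\<lambda>i j. if i \<in> X \<and> j \<in> X then real_of_int (s i j) else 0)"
  define f where "f x = (\<Sum>Z\<in>Pow {..<n}. principal_minor s' Z *
      (\<Prod>i\<in>{..<n} - Z. if i \<in> X then x else 1))" for x :: real
  have pos: "f x > 0" if "x > 0" for x
    unfolding f_def det_diag_add[symmetric]
  proof (rule det_diag_add_skew_pos)
    show "s' i j = - s' j i" for i j
      using skew[of i j] by (simp add: s'_def)
  qed (use that in auto)
  have zero: "principal_minor s' Z = 0" if "Z \<subseteq> {..<n}" "\<not> Z \<subseteq> X" for Z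
    using that finite_subset[of Z "{..<n}"] by (auto intro!: principal_minor_zero_row simp: s'_def)
  have "f 0 = (\<Sum>Z\<in>Pow {..<n}. if Z = X then principal_minor s' X else 0)"
    unfolding f_def
  proof (rule sum.cong[OF refl])
    fix Z assume Z: "Z \<in> Pow {..<n}"
    show "principal_minor s' Z * (\<Prod>i\<in>{..<n} - Z. if i \<in> X then 0 else 1) =
        (if Z = X then principal_minor s' X else 0)"
    proof (cases "X \<subseteq> Z")
      case True
      then show ?thesis using zero[of Z] Z by (auto intro!: prod.neutral)
    next
      case False
      then obtain i where "i \<in> X" "i \<notin> Z" by auto
      hence "(\<Prod>i\<in>{..<n} - Z. if i \<in> X then 0 else 1 :: real) = 0"
        using n by (intro prod_zero) auto
      then show ?thesis using False by auto
    qed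
  qed
  also have "\<dots> = principal_minor s' X" using n by simp
  also have "\<dots> = principal_minor (\<lambda>i j. real_of_int (s i j)) X"
    by (rule principal_minor_cong) (simp add: s'_def)
  also have "\<dots> = real_of_int (principal_minor s X)" by (rule principal_minor_of_int)
  finally have f0: "f 0 = real_of_int (principal_minor s X)" .
  have "continuous_on UNIV (\<lambda>x. if i \<in> X then x else (1::real))" for i
    by (cases "i \<in> X") simp_all
  hence "continuous_on UNIV f" unfolding f_def
    by (intro continuous_on_sum continuous_on_mult continuous_on_const continuous_on_prod)
  hence "isCont f 0" by (simp add: continuous_on_eq_continuous_at)
  hence lim: "(f \<longlongrightarrow> f 0) (at_right 0)"
    by (simp add: isCont_def filterlim_at_split)
  have "eventually (\<lambda>x. f x \<ge> 0) (at_right 0)"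
    using pos by (auto simp: eventually_at_filter less_imp_le)
  hence "f 0 \<ge> 0"
    using lim by (intro tendsto_lowerbound) auto
  thus ?thesis using f0 by simp
qed

text \<open>A permutation with nonzero product must send u to v, and whatever it sends to u can only
  be v. It therefore contains the transposition of u and v, whose sign cancels against
  \<open>s u v * s v u = -1\<close>.\<close>

lemma principal_minor_leaf:
  fixes s :: "'a \<Rightarrow> 'a \<Rightarrow> 'b::comm_ring_1"
  assumes fin: "finite X" and uv: "u \<in> X" "v \<in> X" "u \<noteq> v"
    and zero: "\<And>w. w \<in> X \<Longrightarrow> w \<noteq> v \<Longrightarrow> s u w = 0 \<and> s w u = 0"
    and uv1: "s u v * s v u = -1"
  shows "principal_minor s X = principal_minor s (X - {u, v})"
proof -
  let ?Y = "X - {u, v}" and ?t = "Transposition.transpose u v"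
  have "principal_minor s X =
    (\<Sum>p\<in>(\<lambda>q. ?t \<circ> q) ` {q. q permutes ?Y}. of_int (sign p) * (\<Prod>i\<in>X. s i (p i)))"
    unfolding principal_minor_def
  proof (rule sum.mono_neutral_right)
    show "finite {p. p permutes X}" using fin by (rule finite_permutations)
    show "(\<lambda>q. ?t \<circ> q) ` {q. q permutes ?Y} \<subseteq> {p. p permutes X}"
    proof clarify
      fix q assume "q permutes ?Y"
      hence "q permutes X" by (rule permutes_subset) auto
      thus "(?t \<circ> q) permutes X"
        by (intro permutes_compose permutes_swap_id uv)
    qed
    show "\<forall>p\<in>{p. p permutes X} - (\<lambda>q. ?t \<circ> q) ` {q. q permutes ?Y}.
        of_int (sign p) * (\<Prod>i\<in>X. s i (p i)) = 0"
    proof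
      fix p assume p: "p \<in> {p. p permutes X} - (\<lambda>q. ?t \<circ> q) ` {q. q permutes ?Y}"
      hence pX: "p permutes X" by simp
      have "\<not> (p u = v \<and> p v = u)"
      proof
        assume sw: "p u = v \<and> p v = u"
        have "(?t \<circ> p) permutes X" by (intro permutes_compose permutes_swap_id uv pX)
        hence "(?t \<circ> p) permutes ?Y"
          by (rule permutes_superset) (use sw in auto)
        moreover have "?t \<circ> (?t \<circ> p) = p" by (auto simp: fun_eq_iff)
        ultimately show False using p by (metis DiffD2 imageI mem_Collect_eq)
      qed
      moreover have "s u (p u) = 0" if "p u \<noteq> v"
        using that zero pX uv(1) by (simp add: permutes_in_image)
      moreover have "\<exists>w\<in>X. s w (p w) = 0" if "p v \<noteq> u"
      proof -
        obtain w where w: "w \<in> X" "p w = u"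
          using pX uv(1) by (metis permutes_image imageE)
        hence "w \<noteq> v" using that by auto
        thus ?thesis using w zero by auto
      qed
      ultimately have "\<exists>w\<in>X. s w (p w) = 0" using uv(1) by blast
      thus "of_int (sign p) * (\<Prod>i\<in>X. s i (p i)) = 0" using fin by (simp add: prod_zero)
    qed
  qed
  also have "\<dots> = (\<Sum>q | q permutes ?Y. of_int (sign (?t \<circ> q)) * (\<Prod>i\<in>X. s i ((?t \<circ> q) i)))"
  proof (rule sum.reindex_cong[of "\<lambda>q. ?t \<circ> q"])
    show "inj_on (\<lambda>q. ?t \<circ> q) {q. q permutes ?Y}"
      by (rule inj_onI) (metis comp_assoc id_comp transpose_comp_involutory)
  qed auto
  also have "\<dots> = principal_minor s ?Y"
    unfolding principal_minor_def
  proof (rule sum.cong[OF refl])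
    fix q assume "q \<in> {q. q permutes ?Y}"
    hence q: "q permutes ?Y" by simp
    have fix_uv: "q u = u" "q v = v" using q by (auto simp: permutes_def)
    have perm: "permutation q" "permutation ?t"
      using q fin by (auto intro: permutation_swap_id simp: permutation_permutes[of q])
    have "sign (?t \<circ> q) = - sign q"
      using perm uv(3) by (simp add: sign_compose sign_swap_id)
    moreover have "(\<Prod>i\<in>X. s i ((?t \<circ> q) i)) = - (\<Prod>i\<in>?Y. s i (q i))"
    proof -
      have X: "X = insert u (insert v ?Y)" using uv by auto
      have "(\<Prod>i\<in>X. s i ((?t \<circ> q) i)) = s u v * s v u * (\<Prod>i\<in>?Y. s i ((?t \<circ> q) i))"
        by (subst X) (use fin uv(3) fix_uv in \<open>simp add: mult.assoc\<close>)
      also have "(\<Prod>i\<in>?Y. s i ((?t \<circ> q) i)) = (\<Prod>i\<in>?Y. s i (q i))"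
      proof (rule prod.cong[OF refl])
        fix i assume "i \<in> ?Y"
        hence "q i \<in> ?Y" using permutes_in_image[OF q] by blast
        thus "s i ((?t \<circ> q) i) = s i (q i)" by auto
      qed
      finally show ?thesis using uv1 by simp
    qed
    ultimately show "of_int (sign (?t \<circ> q)) * (\<Prod>i\<in>X. s i ((?t \<circ> q) i)) =
        of_int (sign q) * (\<Prod>i\<in>?Y. s i (q i))" by simp
  qed
  finally show ?thesis .
qed

text \<open>Composition with the transposition of a and b changes the sign of a permutation but not
  its product, since both products of the two rows equal c * s b (p a) * s b (p b). So the minor is
  its own negative.\<close>

lemma principal_minor_proportional_rows:
  fixes s :: "'a \<Rightarrow> 'a \<Rightarrow> int"
  assumes fin: "finite X" and ab: "a \<in> X" "b \<in> X" "a \<noteq> b"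
    and prp: "\<And>j. j \<in> X \<Longrightarrow> s a j = c * s b j"
  shows "principal_minor s X = 0"
proof -
  let ?t = "Transposition.transpose a b"
  let ?f = "\<lambda>p. of_int (sign p) * (\<Prod>i\<in>X. s i (p i))"
  have "principal_minor s X = (\<Sum>p | p permutes X. ?f (p \<circ> ?t))"
    unfolding principal_minor_def
    by (rule sum_permutations_compose_right) (rule permutes_swap_id[OF ab(1,2)])
  also have "\<dots> = (\<Sum>p | p permutes X. - ?f p)"
  proof (rule sum.cong[OF refl])
    fix p assume "p \<in> {p. p permutes X}"
    hence p: "p permutes X" by simp
    have perm: "permutation p" "permutation ?t"
      using p fin by (auto intro: permutation_swap_id simp: permutation_permutes[of p])
    have sgn: "sign (p \<circ> ?t) = - sign p"
      using perm ab(3) by (simp add: sign_compose sign_swap_id)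
    have X: "X = insert a (insert b (X - {a, b}))" using ab by auto
    have rest: "(\<Prod>i\<in>X - {a, b}. s i ((p \<circ> ?t) i)) = (\<Prod>i\<in>X - {a, b}. s i (p i))"
      by (intro prod.cong) auto
    have "(\<Prod>i\<in>X. s i ((p \<circ> ?t) i)) =
        s a (p b) * s b (p a) * (\<Prod>i\<in>X - {a, b}. s i ((p \<circ> ?t) i))"
      by (subst X) (use fin ab(3) in \<open>simp add: mult.assoc\<close>)
    also have "s a (p b) * s b (p a) = s a (p a) * s b (p b)"
      using prp[of "p a"] prp[of "p b"] p ab by (simp add: permutes_in_image)
    also have "s a (p a) * s b (p b) * (\<Prod>i\<in>X - {a, b}. s i ((p \<circ> ?t) i)) =
        (\<Prod>i\<in>X. s i (p i))"
      unfolding rest by (subst (2) X) (use fin ab(3) in \<open>simp add: mult.assoc\<close>)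
    finally show "?f (p \<circ> ?t) = - ?f p" using sgn by simp
  qed
  also have "\<dots> = - principal_minor s X"
    by (simp add: principal_minor_def sum_negf)
  finally show ?thesis by simp
qed

section \<open>Coefficientwise order and matching polynomials of paths\<close>

text \<open>The comparison of the theorem carried over to generating polynomials, where estimates
  can be added and multiplied by nonnegative factors.\<close>

definition coeff_le :: "int poly \<Rightarrow> int poly \<Rightarrow> bool" (infix "\<preceq>" 50) where
  "p \<preceq> q \<longleftrightarrow> (\<forall>k. coeff p k \<le> coeff q k)"

lemma coeff_le_refl [simp, intro]: "p \<preceq> p"
  by (simp add: coeff_le_def)

lemma coeff_le_trans [trans]: "p \<preceq> q \<Longrightarrow> q \<preceq> r \<Longrightarrow> p \<preceq> r"
  unfolding coeff_le_def by (meson order_trans)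

lemma coeff_le_add: "p \<preceq> q \<Longrightarrow> p' \<preceq> q' \<Longrightarrow> p + p' \<preceq> q + q'"
  by (simp add: coeff_le_def add_mono)

lemma coeff_le_diff_iff: "p \<preceq> q \<longleftrightarrow> 0 \<preceq> q - p"
  by (simp add: coeff_le_def)

lemma coeff_le_add_right: "0 \<preceq> q \<Longrightarrow> p \<preceq> p + q"
  by (simp add: coeff_le_def)

lemma coeff_le_add_left: "0 \<preceq> q \<Longrightarrow> p \<preceq> q + p"
  by (simp add: coeff_le_def)

lemma coeff_le_drop_left: "0 \<preceq> p \<Longrightarrow> p + q \<preceq> r \<Longrightarrow> q \<preceq> r"
proof (unfold coeff_le_def, intro allI)
  fix k assume "\<forall>k. coeff 0 k \<le> coeff p k" "\<forall>k. coeff (p + q) k \<le> coeff r k"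
  hence "0 \<le> coeff p k" "coeff p k + coeff q k \<le> coeff r k" by (metis coeff_0, metis coeff_add)
  thus "coeff q k \<le> coeff r k" by linarith
qed

lemma coeff_le_mult_nonneg: "0 \<preceq> p \<Longrightarrow> 0 \<preceq> q \<Longrightarrow> 0 \<preceq> p * q"
  by (auto simp: coeff_le_def coeff_mult intro!: sum_nonneg mult_nonneg_nonneg)

lemma coeff_le_add_nonneg: "0 \<preceq> p \<Longrightarrow> 0 \<preceq> q \<Longrightarrow> 0 \<preceq> p + q"
  by (simp add: coeff_le_def)

lemma coeff_le_mult_left: "0 \<preceq> r \<Longrightarrow> p \<preceq> q \<Longrightarrow> r * p \<preceq> r * q"
  using coeff_le_mult_nonneg[of r "q - p"] coeff_le_diff_iff[of p q]
    coeff_le_diff_iff[of "r * p" "r * q"] by (simp add: algebra_simps)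

lemma coeff_le_mult:
  assumes "0 \<preceq> p" "p \<preceq> q" "0 \<preceq> p'" "p' \<preceq> q'"
  shows "p * p' \<preceq> q * q'"
proof -
  have "p * p' \<preceq> p * q'" by (rule coeff_le_mult_left) fact+
  also have "0 \<preceq> q'" by (rule coeff_le_trans) fact+
  hence "p * q' \<preceq> q * q'"
    using coeff_le_mult_left[of q' p q] assms by (simp add: mult.commute)
  finally show ?thesis .
qed

lemma coeff_le_sum: "(\<And>i. i \<in> A \<Longrightarrow> f i \<preceq> g i) \<Longrightarrow> sum f A \<preceq> sum g A"
  by (auto simp: coeff_le_def coeff_sum intro: sum_mono)

lemma coeff_le_sum_nonneg: "(\<And>i. i \<in> A \<Longrightarrow> 0 \<preceq> f i) \<Longrightarrow> 0 \<preceq> sum f A"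
  by (auto simp: coeff_le_def coeff_sum intro: sum_nonneg)

lemma coeff_le_sum_subset:
  assumes "finite C" "A \<subseteq> C" "\<And>i. i \<in> C \<Longrightarrow> 0 \<preceq> f i"
  shows "sum f A \<preceq> sum f C"
  using assms by (auto simp: coeff_le_def coeff_sum intro!: sum_mono2)

lemma coeff_le_monom [simp]: "0 \<preceq> monom c k \<longleftrightarrow> 0 \<le> c"
  by (auto simp: coeff_le_def)

lemma coeff_le_one [simp]: "0 \<preceq> 1"
  by (simp add: coeff_le_def coeff_pCons one_pCons split: nat.split)

text \<open>
  \<open>\<xi>\<close> marks an edge of a matching, \<open>\<phi> m\<close> is the matching polynomial of the path on \<open>m\<close> vertices,
  and \<open>\<psi> m\<close> that of the path with an end vertex removed, which is \<open>0\<close> for the empty path.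
\<close>

abbreviation \<xi> :: "int poly" where "\<xi> \<equiv> monom 1 2"

fun \<phi> :: "nat \<Rightarrow> int poly" where
  "\<phi> 0 = 1"
| "\<phi> (Suc 0) = 1"
| "\<phi> (Suc (Suc m)) = \<phi> (Suc m) + \<xi> * \<phi> m"

primrec \<psi> :: "nat \<Rightarrow> int poly" where
  "\<psi> 0 = 0"
| "\<psi> (Suc m) = \<phi> m"

text \<open>The convention \<open>\<psi> 0 = 0\<close> makes this hold for the first vertex too,
  which spares case distinctions on empty segments.\<close>

lemma \<phi>_Suc: "\<phi> (Suc m) = \<phi> m + \<xi> * \<psi> m"
  by (cases m) auto

lemma \<psi>_Suc_Suc: "\<psi> (Suc (Suc m)) = \<psi> (Suc m) + \<xi> * \<psi> m"
  by (simp add: \<phi>_Suc)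

lemma \<phi>_nonneg [simp]: "0 \<preceq> \<phi> m"
  by (induction m rule: \<phi>.induct) (auto intro!: coeff_le_add_nonneg coeff_le_mult_nonneg)

lemma \<psi>_nonneg [simp]: "0 \<preceq> \<psi> m"
  by (cases m) auto

lemma \<phi>_mono_Suc: "\<phi> m \<preceq> \<phi> (Suc m)"
  unfolding \<phi>_Suc by (intro coeff_le_add_right coeff_le_mult_nonneg) auto

lemma \<phi>_mono: "m \<le> m' \<Longrightarrow> \<phi> m \<preceq> \<phi> m'"
  by (induction m' rule: dec_induct) (auto intro: coeff_le_trans \<phi>_mono_Suc)

lemma \<phi>_ge_1: "1 \<preceq> \<phi> m"
  using \<phi>_mono[of 0 m] by simp

lemma \<psi>_le_\<phi>: "\<psi> m \<preceq> \<phi> m"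
  by (cases m) (auto intro: \<phi>_mono_Suc)

text \<open>A matching of the joined path either avoids the joining edge or uses it, and then both
  parts lose an end vertex.\<close>

lemma \<phi>_add: "\<phi> (a + b) = \<phi> a * \<phi> b + \<xi> * \<psi> a * \<psi> b"
proof (induction b rule: \<phi>.induct)
  case (3 m)
  have "\<phi> (a + Suc (Suc m)) = \<phi> (a + Suc m) + \<xi> * \<phi> (a + m)" by simp
  also have "\<dots> = \<phi> a * (\<phi> (Suc m) + \<xi> * \<phi> m) + \<xi> * \<psi> a * (\<psi> (Suc m) + \<xi> * \<psi> m)"
    unfolding 3 by (simp add: algebra_simps)
  also have "\<dots> = \<phi> a * \<phi> (Suc (Suc m)) + \<xi> * \<psi> a * \<psi> (Suc (Suc m))"
    by (simp only: \<psi>_Suc_Suc \<phi>.simps)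
  finally show ?case .
qed (auto simp: \<phi>_Suc)

text \<open>Splitting one vertex of the longer path into two copies, one for each side, keeps all
  edges and every matching. Truncated subtraction does no harm when a part is empty.\<close>

lemma \<phi>_mult_ge: "\<phi> (a + b - 1) \<preceq> \<phi> a * \<phi> b"
proof (cases b)
  case 0
  then show ?thesis by (simp add: \<phi>_mono)
next
  case (Suc b')
  have "\<phi> (a + b') = \<phi> a * \<phi> b' + \<xi> * \<psi> a * \<psi> b'" by (rule \<phi>_add)
  also have "\<dots> \<preceq> \<phi> a * \<phi> b' + \<xi> * \<phi> a * \<psi> b'"
    by (intro coeff_le_add coeff_le_refl coeff_le_mult coeff_le_mult_nonneg \<psi>_le_\<phi>) auto
  also have "\<dots> = \<phi> a * \<phi> b" by (simp add: Suc \<phi>_Suc algebra_simps)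
  finally show ?thesis by (simp add: Suc)
qed

text \<open>The left side arises when a vertex is matched to one of two path vertices and the other
  one stays with its own segment. The right side exposes the length that becomes
  \<open>\<phi> (d - 1)\<close>.\<close>

lemma \<phi>_insert: "\<phi> l * \<phi> (Suc r) + \<phi> (Suc l) * \<phi> r = \<phi> (l + r + 1) + \<phi> l * \<phi> r"
  using \<phi>_add[of "Suc l" r] by (simp add: \<phi>_Suc[of r] algebra_simps)

text \<open>The exact gap in \<open>\<phi>_mult_ge\<close> when both factors have at least two
  vertices. It is the source of the surplus \<xi> * (\<xi> * \<xi>) for vertices attached far from
  both ends.\<close>

lemma \<phi>_mult_inner: "\<phi> (Suc (Suc a)) * \<phi> (Suc (Suc b)) = \<phi> (a + b + 3) + \<xi> * \<xi> * (\<phi> a * \<phi> b)"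
proof -
  have "\<phi> (a + b + 3) = \<phi> (Suc (Suc a) + Suc b)" by (simp add: numeral_3_eq_3 add.commute)
  also have "\<dots> = \<phi> (Suc (Suc a)) * \<phi> (Suc b) + \<xi> * \<phi> (Suc a) * \<phi> b"
    by (subst \<phi>_add) simp
  finally show ?thesis by (simp add: algebra_simps)
qed

lemma one_le_\<phi>_mult: "1 \<preceq> \<phi> a * \<phi> b"
  using coeff_le_mult[OF _ \<phi>_ge_1 _ \<phi>_ge_1, of a b] by simp

section \<open>Generating polynomials of principal minors\<close>

text \<open>Z holds the vertices already committed to the minor and W the free ones, so that
  deciding on a vertex moves it from W to Z or deletes it. Exponents count vertices, which is why a
  matched edge weighs \<xi>, of degree 2.\<close>

definition minor_poly :: "(nat \<Rightarrow> nat \<Rightarrow> int) \<Rightarrow> nat set \<Rightarrow> nat set \<Rightarrow> int poly" where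
  "minor_poly s Z W = (\<Sum>X\<in>Pow W. monom (principal_minor s (Z \<union> X)) (card (Z \<union> X)))"

locale skew_sign_matrix =
  fixes s :: "nat \<Rightarrow> nat \<Rightarrow> int"
  assumes skew: "s i j = - s j i"
    and sign_entries: "s i j \<in> {-1, 0, 1}"
begin

definition adj :: "nat \<Rightarrow> nat \<Rightarrow> bool" where "adj i j \<longleftrightarrow> s i j \<noteq> 0"
abbreviation F :: "nat set \<Rightarrow> nat set \<Rightarrow> int poly" where "F \<equiv> minor_poly s"

lemma adj_sym: "adj i j \<longleftrightarrow> adj j i"
  using skew[of i j] by (simp add: adj_def)

lemma adj_irrefl [simp]: "\<not> adj i i"
  using skew[of i i] by (simp add: adj_def)

lemma adj_mult: "adj i j \<Longrightarrow> s i j * s j i = -1"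
  using skew[of j i] sign_entries[of i j] by (auto simp: adj_def)

lemma minor_nonneg: "finite X \<Longrightarrow> 0 \<le> principal_minor s X"
  using skew by (rule principal_minor_skew_nonneg)

lemma F_term_nonneg: "finite Z \<Longrightarrow> finite W \<Longrightarrow> X \<in> Pow W \<Longrightarrow>
    0 \<preceq> monom (principal_minor s (Z \<union> X)) k"
  by (auto intro!: minor_nonneg intro: finite_subset)

lemma F_nonneg [simp]: "finite Z \<Longrightarrow> finite W \<Longrightarrow> 0 \<preceq> F Z W"
  unfolding minor_poly_def by (rule coeff_le_sum_nonneg, rule F_term_nonneg)

lemma F_mono: "finite Z \<Longrightarrow> finite W \<Longrightarrow> W' \<subseteq> W \<Longrightarrow> F Z W' \<preceq> F Z W"
  unfolding minor_poly_def by (rule coeff_le_sum_subset) (auto intro!: minor_nonneg intro: finite_subset)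

lemma F_empty: "F Z {} = monom (principal_minor s Z) (card Z)"
  by (simp add: minor_poly_def)

lemma F_empty_empty [simp]: "F {} {} = 1"
  by (simp add: F_empty monom_eq_1)

lemma F_insert:
  assumes "finite W" "w \<notin> W"
  shows "F Z (insert w W) = F Z W + F (insert w Z) W"
proof -
  have disj: "Pow W \<inter> insert w ` Pow W = {}" using assms by auto
  have inj: "inj_on (insert w) (Pow W)"
    using assms by (auto simp: inj_on_def)
  show ?thesis
    unfolding minor_poly_def Pow_insert
    by (subst sum.union_disjoint) (simp_all add: assms(1) disj sum.reindex[OF inj])
qed

lemma F_partition:
  assumes "finite U" "finite W" "U \<inter> W = {}"
  shows "F Z (U \<union> W) = (\<Sum>Y\<in>Pow U. F (Z \<union> Y) W)"
  using assms
proof (induction U arbitrary: Z rule: finite_induct)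
  case (insert u U)
  have inj: "inj_on (insert u) (Pow U)" using insert(2) by (auto simp: inj_on_def)
  have disj: "Pow U \<inter> insert u ` Pow U = {}" using insert(2) by auto
  have "F Z (insert u (U \<union> W)) = F Z (U \<union> W) + F (insert u Z) (U \<union> W)"
    by (rule F_insert) (use insert in auto)
  also have "\<dots> = (\<Sum>Y\<in>Pow U. F (Z \<union> Y) W) + (\<Sum>Y\<in>Pow U. F (insert u Z \<union> Y) W)"
    using insert by simp
  also have "(\<Sum>Y\<in>Pow U. F (insert u Z \<union> Y) W) = (\<Sum>Y\<in>insert u ` Pow U. F (Z \<union> Y) W)"
    by (simp add: sum.reindex[OF inj])
  also have "(\<Sum>Y\<in>Pow U. F (Z \<union> Y) W) + \<dots> = (\<Sum>Y\<in>Pow (insert u U). F (Z \<union> Y) W)"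
    unfolding Pow_insert using insert(1) disj by (subst sum.union_disjoint) auto
  finally show ?case by simp
qed simp

lemma F_zero:
  assumes "finite Z" "finite W" "u \<in> Z" "\<And>x. x \<in> Z \<union> W \<Longrightarrow> \<not> adj u x"
  shows "F Z W = 0"
  unfolding minor_poly_def
proof (intro sum.neutral ballI)
  fix X assume "X \<in> Pow W"
  hence "principal_minor s (Z \<union> X) = 0"
    using assms by (intro principal_minor_zero_row[of _ u]) (auto simp: adj_def intro: finite_subset)
  thus "monom (principal_minor s (Z \<union> X)) (card (Z \<union> X)) = 0" by simp
qed

lemma minor_leaf:
  assumes "finite X" "u \<in> X" "v \<in> X" "adj u v" "\<And>x. x \<in> X \<Longrightarrow> x \<noteq> v \<Longrightarrow> \<not> adj u x"
  shows "principal_minor s X = principal_minor s (X - {u, v})"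
proof (rule principal_minor_leaf)
  show "s u w = 0 \<and> s w u = 0" if "w \<in> X" "w \<noteq> v" for w
    using assms(5)[of w] that adj_sym[of u w] by (auto simp: adj_def)
  show "u \<noteq> v" using assms(4) by auto
qed (use assms adj_mult in auto)

lemma F_leaf:
  assumes "finite Z" "finite W" "Z \<inter> W = {}" "u \<in> Z" "v \<in> Z" "adj u v"
    and "\<And>x. x \<in> Z \<union> W \<Longrightarrow> x \<noteq> v \<Longrightarrow> \<not> adj u x"
  shows "F Z W = \<xi> * F (Z - {u, v}) W"
  unfolding minor_poly_def sum_distrib_left
proof (rule sum.cong[OF refl])
  fix X assume X: "X \<in> Pow W"
  hence fin: "finite (Z \<union> X)" using assms by (auto intro: finite_subset)
  have uv: "u \<noteq> v" using assms by auto
  have eq: "Z - {u, v} \<union> X = (Z \<union> X) - {u, v}" using assms X by auto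
  have "card (Z \<union> X) = card ((Z \<union> X) - {u, v}) + card {u, v}"
    using card_Diff_subset[of "{u, v}" "Z \<union> X"] card_mono[OF fin, of "{u, v}"] assms(4,5) by simp
  hence "card (Z \<union> X) = 2 + card ((Z \<union> X) - {u, v})" using uv by simp
  moreover have "principal_minor s (Z \<union> X) = principal_minor s ((Z \<union> X) - {u, v})"
    by (rule minor_leaf) (use assms X fin in auto)
  ultimately show "monom (principal_minor s (Z \<union> X)) (card (Z \<union> X)) =
      \<xi> * monom (principal_minor s (Z - {u, v} \<union> X)) (card (Z - {u, v} \<union> X))"
    by (simp add: eq mult_monom)
qed

lemma F_isolated:
  assumes "finite Z" "finite W" "w \<notin> W" "\<And>x. x \<in> Z \<union> W \<Longrightarrow> \<not> adj w x"
  shows "F Z (insert w W) = F Z W"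
proof -
  have "F (insert w Z) W = 0"
    by (rule F_zero[of _ _ w]) (use assms in auto)
  thus ?thesis using assms by (simp add: F_insert)
qed

lemma F_leaf_inner:
  assumes "finite Z" "finite W" "w \<notin> Z \<union> W" "w' \<notin> Z \<union> W" "Z \<inter> W = {}" "adj w w'"
    and "\<And>x. x \<in> Z \<union> W \<Longrightarrow> \<not> adj w x"
  shows "F Z (insert w (insert w' W)) = F Z (insert w' W) + \<xi> * F Z W"
proof -
  have ne: "w \<noteq> w'" using assms by auto
  have "F (insert w Z) (insert w' W) = F (insert w Z) W + F (insert w' (insert w Z)) W"
    by (rule F_insert) (use assms in auto)
  also have "F (insert w Z) W = 0"
    by (rule F_zero[of _ _ w]) (use assms in auto)
  also have "F (insert w' (insert w Z)) W = \<xi> * F (insert w' (insert w Z) - {w, w'}) W"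
    by (rule F_leaf) (use assms in auto)
  also have "insert w' (insert w Z) - {w, w'} = Z" using assms by auto
  finally show ?thesis using assms ne by (subst F_insert) auto
qed

lemma F_leaf_outer:
  assumes "finite Z" "finite W" "w \<notin> Z \<union> W" "z \<in> Z" "Z \<inter> W = {}" "adj w z"
    and "\<And>x. x \<in> Z \<union> W \<Longrightarrow> x \<noteq> z \<Longrightarrow> \<not> adj w x"
  shows "F Z (insert w W) = F Z W + \<xi> * F (Z - {z}) W"
proof -
  have "F (insert w Z) W = \<xi> * F (insert w Z - {w, z}) W"
    by (rule F_leaf) (use assms in auto)
  also have "insert w Z - {w, z} = Z - {z}" using assms by auto
  finally show ?thesis using assms by (subst F_insert) auto
qed

text \<open>The second equation is the other half of a joint induction: once a leaf is matched to c,
  the remaining leaves are isolated.\<close>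

lemma F_star:
  assumes "finite W" "finite Z" "Z \<inter> W = {}" "c \<notin> Z \<union> W" "finite L" "L \<inter> (insert c (Z \<union> W)) = {}"
    and "\<And>w x. w \<in> L \<Longrightarrow> x \<in> Z \<union> W \<union> L \<Longrightarrow> \<not> adj w x" "\<And>w. w \<in> L \<Longrightarrow> adj w c"
  shows "F Z (insert c W \<union> L) = F Z (insert c W) + of_nat (card L) * (\<xi> * F Z W)"
    and "F Z (W \<union> L) = F Z W"
  using assms(5-)
proof (induction L rule: finite_induct)
  case (insert w L)
  {
    case 1
    have "F Z (insert w (insert c (W \<union> L))) = F Z (insert c (W \<union> L)) + \<xi> * F Z (W \<union> L)"
      by (rule F_leaf_inner) (use insert(1,2) 1 assms(1-4) in auto)
    also have "F Z (insert c (W \<union> L)) = F Z (insert c W) + of_nat (card L) * (\<xi> * F Z W)"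
      using insert(3) 1 by auto
    also have "F Z (W \<union> L) = F Z W"
      using insert(4) 1 by auto
    finally show ?case using insert(1,2) by (simp add: algebra_simps)
  next
    case 2
    have "F Z (insert w (W \<union> L)) = F Z (W \<union> L)"
      by (rule F_isolated) (use insert(1,2) 2 assms(1-4) in auto)
    also have "\<dots> = F Z W" using insert(4) 2 by auto
    finally show ?case by simp
  }
qed simp_all

text \<open>Two members of T in one vertex set are proportional rows, so only traces on T with at
  most one element survive. The factor may depend on the pair.\<close>

lemma F_twins:
  assumes "finite W" "finite T" "T \<inter> W = {}"
    and "\<And>a b. a \<in> T \<Longrightarrow> b \<in> T \<Longrightarrow> a \<noteq> b \<Longrightarrow> \<exists>c. \<forall>j\<in>T \<union> W. s a j = c * s b j"
  shows "F {} (T \<union> W) = F {} W + (\<Sum>a\<in>T. F {a} W)"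
proof -
  have zero: "F Y W = 0" if Y: "Y \<subseteq> T" "Y \<noteq> {}" "Y \<notin> (\<lambda>a. {a}) ` T" for Y
  proof -
    obtain a where a: "a \<in> Y" using Y by auto
    then obtain b where b: "b \<in> Y" "b \<noteq> a" using Y by force
    obtain c where c: "\<forall>j\<in>T \<union> W. s a j = c * s b j" using assms(4)[of a b] a b Y by auto
    show ?thesis unfolding minor_poly_def
    proof (intro sum.neutral ballI)
      fix X assume X: "X \<in> Pow W"
      have "principal_minor s (Y \<union> X) = 0"
        by (rule principal_minor_proportional_rows[of _ a b _ c])
           (use X Y a b c assms(1,2) in \<open>auto intro: finite_subset\<close>)
      thus "monom (principal_minor s (Y \<union> X)) (card (Y \<union> X)) = 0" by simp
    qed
  qed
  have "F {} (T \<union> W) = (\<Sum>Y\<in>Pow T. F Y W)"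
    using F_partition[OF assms(2,1,3), of "{}"] by simp
  also have "\<dots> = (\<Sum>Y\<in>insert {} ((\<lambda>a. {a}) ` T). F Y W)"
    by (rule sum.mono_neutral_right) (use zero assms(2) in auto)
  also have "\<dots> = F {} W + (\<Sum>a\<in>T. F {a} W)"
    using assms(2) by (subst sum.insert) (auto simp: sum.reindex inj_on_def)
  finally show ?thesis .
qed

section \<open>Induced paths, isolated or hanging from one vertex\<close>

definition path_on :: "(nat \<Rightarrow> nat) \<Rightarrow> nat \<Rightarrow> bool" where
  "path_on f m \<longleftrightarrow> (\<forall>i<m. \<forall>j<m. (f i = f j \<longleftrightarrow> i = j) \<and> (adj (f i) (f j) \<longleftrightarrow> i = Suc j \<or> j = Suc i))"

lemma path_on_eq: "path_on f m \<Longrightarrow> i < m \<Longrightarrow> j < m \<Longrightarrow> f i = f j \<longleftrightarrow> i = j"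
  by (simp add: path_on_def)

lemma path_on_adj: "path_on f m \<Longrightarrow> i < m \<Longrightarrow> j < m \<Longrightarrow> adj (f i) (f j) \<longleftrightarrow> i = Suc j \<or> j = Suc i"
  by (simp add: path_on_def)

lemma path_on_mono: "path_on f m \<Longrightarrow> m' \<le> m \<Longrightarrow> path_on f m'"
  by (simp add: path_on_def)

lemma F_path_end:
  assumes "finite Z" "finite W" "Z \<inter> W = {}" "path_on f (Suc (Suc m))"
    and "\<And>i. i < Suc (Suc m) \<Longrightarrow> f i \<notin> Z \<union> W"
    and "\<And>x. x \<in> Z \<union> W \<Longrightarrow> \<not> adj (f (Suc m)) x"
  shows "F Z (W \<union> f ` {..<Suc (Suc m)}) =
    F Z (W \<union> f ` {..<Suc m}) + \<xi> * F Z (W \<union> f ` {..<m})"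
proof -
  have eqs: "W \<union> f ` {..<Suc (Suc m)} = insert (f (Suc m)) (insert (f m) (W \<union> f ` {..<m}))"
    "W \<union> f ` {..<Suc m} = insert (f m) (W \<union> f ` {..<m})"
    by (auto simp: lessThan_Suc)
  show ?thesis
    unfolding eqs
  proof (rule F_leaf_inner)
    show "f (Suc m) \<notin> Z \<union> (W \<union> f ` {..<m})" "f m \<notin> Z \<union> (W \<union> f ` {..<m})"
      using assms(5)[of m] assms(5)[of "Suc m"] path_on_eq[OF assms(4)] by force+
    show "Z \<inter> (W \<union> f ` {..<m}) = {}" using assms(3,5) by fastforce
    show "adj (f (Suc m)) (f m)" using path_on_adj[OF assms(4)] by simp
    show "\<not> adj (f (Suc m)) x" if "x \<in> Z \<union> (W \<union> f ` {..<m})" for x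
      using that assms(6) path_on_adj[OF assms(4), of "Suc m"] by fastforce
  qed (use assms in auto)
qed

lemma F_isolated_path:
  assumes "finite Z" "finite W" "Z \<inter> W = {}" "path_on f m" "\<And>i. i < m \<Longrightarrow> f i \<notin> Z \<union> W"
    and "\<And>i x. i < m \<Longrightarrow> x \<in> Z \<union> W \<Longrightarrow> \<not> adj (f i) x"
  shows "F Z (W \<union> f ` {..<m}) = \<phi> m * F Z W"
  using assms(4-)
proof (induction m rule: \<phi>.induct)
  case 2
  have "F Z (insert (f 0) W) = F Z W"
    by (rule F_isolated) (use 2(2,3) assms(1-3) in auto)
  then show ?case by (simp add: lessThan_Suc)
next
  case (3 m)
  have "F Z (W \<union> f ` {..<Suc m}) = \<phi> (Suc m) * F Z W"
    by (rule "3.IH"(1)[OF path_on_mono[OF 3(3)]]) (simp, rule 3(4), simp, rule 3(5), simp_all)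
  moreover have "F Z (W \<union> f ` {..<m}) = \<phi> m * F Z W"
    by (rule "3.IH"(2)[OF path_on_mono[OF 3(3)]]) (simp, rule 3(4), simp, rule 3(5), simp_all)
  moreover have "F Z (W \<union> f ` {..<Suc (Suc m)}) =
      F Z (W \<union> f ` {..<Suc m}) + \<xi> * F Z (W \<union> f ` {..<m})"
    by (rule F_path_end) (use assms(1-3) 3(3-5) in auto)
  ultimately show ?case by (simp add: distrib_right mult.assoc)
qed simp

text \<open>Peeling off the free end yields the common recursion of \<phi> and \<psi>. The two terms
  correspond to leaving z to the rest and to matching z with \<open>f 0\<close>, which shortens the
  path at its attached end.\<close>

lemma F_attached_path:
  assumes "finite Z" "finite W" "Z \<inter> W = {}" "path_on f m" "\<And>i. i < m \<Longrightarrow> f i \<notin> Z \<union> W" "z \<in> Z"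
    and "\<And>i x. i < m \<Longrightarrow> x \<in> Z \<union> W \<Longrightarrow> adj (f i) x \<longleftrightarrow> i = 0 \<and> x = z"
  shows "F Z (W \<union> f ` {..<m}) = \<phi> m * F Z W + \<xi> * \<psi> m * F (Z - {z}) W"
  using assms(4,5,7)
proof (induction m rule: \<phi>.induct)
  case 2
  have "F Z (insert (f 0) W) = F Z W + \<xi> * F (Z - {z}) W"
    by (rule F_leaf_outer) (use 2(2,3) assms(1-3,6) in auto)
  then show ?case by (simp add: lessThan_Suc)
next
  case (3 m)
  have IH1: "F Z (W \<union> f ` {..<Suc m}) = \<phi> (Suc m) * F Z W + \<xi> * \<psi> (Suc m) * F (Z - {z}) W"
    by (rule "3.IH"(1)[OF path_on_mono[OF 3(3)]]) (simp, rule 3(4), simp, rule 3(5), simp_all)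
  have IH0: "F Z (W \<union> f ` {..<m}) = \<phi> m * F Z W + \<xi> * \<psi> m * F (Z - {z}) W"
    by (rule "3.IH"(2)[OF path_on_mono[OF 3(3)]]) (simp, rule 3(4), simp, rule 3(5), simp_all)
  have "F Z (W \<union> f ` {..<Suc (Suc m)}) =
      F Z (W \<union> f ` {..<Suc m}) + \<xi> * F Z (W \<union> f ` {..<m})"
    by (rule F_path_end) (use assms(1-3) 3(3-5) in auto)
  also have "\<dots> = (\<phi> (Suc m) + \<xi> * \<phi> m) * F Z W + \<xi> * (\<psi> (Suc m) + \<xi> * \<psi> m) * F (Z - {z}) W"
    unfolding IH1 IH0 by (simp only: distrib_left distrib_right mult.assoc add.assoc add.left_commute mult.left_commute)
  also have "\<dots> = \<phi> (Suc (Suc m)) * F Z W + \<xi> * \<psi> (Suc (Suc m)) * F (Z - {z}) W"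
    by (simp only: \<psi>_Suc_Suc \<phi>.simps)
  finally show ?case .
qed simp

end

section \<open>Vertices and edges attached to an induced path\<close>

locale induced_path = skew_sign_matrix +
  fixes v :: "nat \<Rightarrow> nat" and d :: nat
  assumes path: "path_on v (Suc d)"
begin

definition P :: "nat set" where "P = v ` {..d}"

definition nb :: "nat \<Rightarrow> nat set" where "nb u = {i. i \<le> d \<and> adj u (v i)}"

lemma finite_P [simp]: "finite P"
  by (simp add: P_def)

lemma v_in_P [simp]: "i \<le> d \<Longrightarrow> v i \<in> P"
  by (simp add: P_def)

lemma v_eq_iff: "i \<le> d \<Longrightarrow> j \<le> d \<Longrightarrow> v i = v j \<longleftrightarrow> i = j"
  using path_on_eq[OF path] by simp

lemma v_adj_iff: "i \<le> d \<Longrightarrow> j \<le> d \<Longrightarrow> adj (v i) (v j) \<longleftrightarrow> i = Suc j \<or> j = Suc i"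
  using path_on_adj[OF path] by simp

lemma nb_le: "i \<in> nb u \<Longrightarrow> i \<le> d"
  by (simp add: nb_def)

lemma adj_v_nb: "i \<le> d \<Longrightarrow> adj (v i) u \<longleftrightarrow> i \<in> nb u"
  using adj_sym[of "v i" u] by (simp add: nb_def)

lemma path_on_up: "a + m \<le> Suc d \<Longrightarrow> path_on (\<lambda>i. v (a + i)) m"
  unfolding path_on_def by (auto simp: v_eq_iff v_adj_iff)

lemma path_on_down: "a + m \<le> Suc d \<Longrightarrow> path_on (\<lambda>i. v (a + m - Suc i)) m"
  unfolding path_on_def by (auto simp: v_eq_iff v_adj_iff)

lemma image_up: "(\<lambda>i. v (a + i)) ` {..<m} = v ` {a..<a + m}"
proof -
  have "(\<lambda>i. v (a + i)) ` {..<m} = v ` ((+) a ` {0..<m})" by (simp add: image_image atLeast0LessThan)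
  thus ?thesis by (simp add: add.commute)
qed

lemma image_down: "(\<lambda>i. v (a + m - Suc i)) ` {..<m} = v ` {a..<a + m}"
proof -
  have "x \<in> (\<lambda>i. a + m - Suc i) ` {..<m}" if "a \<le> x" "x < a + m" for x
    using that by (intro image_eqI[of _ _ "a + m - Suc x"]) auto
  hence "(\<lambda>i. a + m - Suc i) ` {..<m} = {a..<a + m}" by auto
  thus ?thesis by (metis image_image)
qed

lemma F_segment_isolated:
  assumes "finite Z" "finite W" "Z \<inter> W = {}" "a + m \<le> Suc d"
    and "\<And>i. a \<le> i \<Longrightarrow> i < a + m \<Longrightarrow> v i \<notin> Z \<union> W"
    and "\<And>i x. a \<le> i \<Longrightarrow> i < a + m \<Longrightarrow> x \<in> Z \<union> W \<Longrightarrow> \<not> adj (v i) x"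
  shows "F Z (W \<union> v ` {a..<a + m}) = \<phi> m * F Z W"
  unfolding image_up[symmetric]
  by (rule F_isolated_path[OF assms(1-3) path_on_up[OF assms(4)]]) (use assms(5,6) in auto)

lemma F_segment_up:
  assumes "finite Z" "finite W" "Z \<inter> W = {}" "a + m \<le> Suc d" "z \<in> Z"
    and "\<And>i. a \<le> i \<Longrightarrow> i < a + m \<Longrightarrow> v i \<notin> Z \<union> W"
    and "\<And>i x. a \<le> i \<Longrightarrow> i < a + m \<Longrightarrow> x \<in> Z \<union> W \<Longrightarrow> adj (v i) x \<longleftrightarrow> i = a \<and> x = z"
  shows "F Z (W \<union> v ` {a..<a + m}) = \<phi> m * F Z W + \<xi> * \<psi> m * F (Z - {z}) W"
  unfolding image_up[symmetric]
  by (rule F_attached_path[OF assms(1-3) path_on_up[OF assms(4)] _ assms(5)])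
     (use assms(6,7) in auto)

text \<open>The segment is enumerated backwards, because \<open>F_attached_path\<close> wants the
  vertex next to z first.\<close>

lemma F_segment_down:
  assumes "finite Z" "finite W" "Z \<inter> W = {}" "a + m \<le> Suc d" "z \<in> Z"
    and "\<And>i. a \<le> i \<Longrightarrow> i < a + m \<Longrightarrow> v i \<notin> Z \<union> W"
    and "\<And>i x. a \<le> i \<Longrightarrow> i < a + m \<Longrightarrow> x \<in> Z \<union> W \<Longrightarrow> adj (v i) x \<longleftrightarrow> Suc i = a + m \<and> x = z"
  shows "F Z (W \<union> v ` {a..<a + m}) = \<phi> m * F Z W + \<xi> * \<psi> m * F (Z - {z}) W"
  unfolding image_down[symmetric]
proof (rule F_attached_path[OF assms(1-3) path_on_down[OF assms(4)] _ assms(5)])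
  show "v (a + m - Suc i) \<notin> Z \<union> W" if "i < m" for i
    by (rule assms(6)) (use that in auto)
  show "adj (v (a + m - Suc i)) x \<longleftrightarrow> i = 0 \<and> x = z" if "i < m" "x \<in> Z \<union> W" for i x
    using that by (subst assms(7)) auto
qed

lemma F_two_segments:
  assumes "a + l \<le> b" "Suc (a + l) \<le> b \<or> l = 0 \<or> r = 0" "b + r \<le> Suc d"
  shows "F {} (v ` {a..<a + l} \<union> v ` {b..<b + r}) = \<phi> l * \<phi> r"
proof -
  have "F {} ({} \<union> v ` {a..<a + l}) = \<phi> l * F {} {}"
    by (rule F_segment_isolated) (use assms in auto)
  moreover have "F {} (v ` {a..<a + l} \<union> v ` {b..<b + r}) = \<phi> r * F {} (v ` {a..<a + l})"
  proof (rule F_segment_isolated)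
    show "v i \<notin> {} \<union> v ` {a..<a + l}" if "b \<le> i" "i < b + r" for i
      using that assms by (auto simp: v_eq_iff)
    show "\<not> adj (v i) x" if "b \<le> i" "i < b + r" "x \<in> {} \<union> v ` {a..<a + l}" for i x
      using that assms by (auto simp: v_adj_iff)
  qed (use assms in auto)
  ultimately show ?thesis by (simp add: mult.commute)
qed

lemma F_path: "F {} P = \<phi> (Suc d)"
  using F_two_segments[of 0 0 0 "Suc d"] by (simp add: P_def atLeast0LessThan lessThan_Suc_atMost)

lemma P_minus:
  assumes "j \<le> d"
  shows "P - {v j} = v ` {0..<0 + j} \<union> v ` {Suc j..<Suc j + (d - j)}"
proof -
  have "{..d} - {j} = {0..<0 + j} \<union> {Suc j..<Suc j + (d - j)}"
    using assms by auto
  moreover have "P - {v j} = v ` ({..d} - {j})"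
    unfolding P_def using assms by (auto simp: v_eq_iff)
  ultimately show ?thesis by (simp only: image_Un)
qed

lemma F_path_minus:
  assumes "j \<le> d"
  shows "F {} (P - {v j}) = \<phi> j * \<phi> (d - j)"
  unfolding P_minus[OF assms] by (rule F_two_segments) (use assms in auto)

lemma F_path_minus_ge: "j \<le> d \<Longrightarrow> \<phi> (d - 1) \<preceq> F {} (P - {v j})"
  using \<phi>_mult_ge[of j "d - j"] by (simp add: F_path_minus)

lemma F_path_minus2:
  assumes "j < k" "k \<le> d"
  shows "F {} (P - {v j, v k}) = \<phi> j * \<phi> (k - j - 1) * \<phi> (d - k)"
proof -
  have eq: "P - {v j, v k} = (v ` {0..<0 + j} \<union> v ` {Suc j..<Suc j + (k - j - 1)}) \<union>
      v ` {Suc k..<Suc k + (d - k)}"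
  proof -
    have "i < j \<or> (Suc j \<le> i \<and> i < k) \<or> (Suc k \<le> i \<and> i < Suc d)" if "i \<le> d" "i \<noteq> j" "i \<noteq> k" for i
      using that by auto
    hence "{..d} - {j, k} = ({0..<0 + j} \<union> {Suc j..<Suc j + (k - j - 1)}) \<union> {Suc k..<Suc k + (d - k)}"
      using assms by auto
    moreover have "P - {v j, v k} = v ` ({..d} - {j, k})"
      unfolding P_def using assms by (auto simp: v_eq_iff)
    ultimately show ?thesis by (simp only: image_Un)
  qed
  have "F {} (v ` {0..<0 + j} \<union> v ` {Suc j..<Suc j + (k - j - 1)}) = \<phi> j * \<phi> (k - j - 1)"
    by (rule F_two_segments) (use assms in auto)
  moreover have "F {} ((v ` {0..<0 + j} \<union> v ` {Suc j..<Suc j + (k - j - 1)}) \<union>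
      v ` {Suc k..<Suc k + (d - k)}) = \<phi> (d - k) *
      F {} (v ` {0..<0 + j} \<union> v ` {Suc j..<Suc j + (k - j - 1)})"
    by (rule F_segment_isolated) (use assms in \<open>auto simp: v_eq_iff v_adj_iff\<close>)
  ultimately show ?thesis unfolding eq by (simp add: mult.commute)
qed

text \<open>The three remaining pieces have d - 1 vertices together, and each of the two mergings by
  \<open>\<phi>_mult_ge\<close> costs one more. Coinciding j and k are allowed, since two vertices
  off the path may share their neighbour.\<close>

lemma F_path_minus2_ge:
  assumes "j \<le> d" "k \<le> d"
  shows "\<phi> (d - 3) \<preceq> F {} (P - {v j, v k})"
proof -
  have *: "\<phi> (d - 3) \<preceq> F {} (P - {v j, v k})" if "j < k" "k \<le> d" for j k
  proof -
    have "\<phi> (d - 3) \<preceq> \<phi> (j + (k - j - 1) - 1 + (d - k) - 1)"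
      using that by (intro \<phi>_mono) auto
    also have "\<dots> \<preceq> \<phi> (j + (k - j - 1) - 1) * \<phi> (d - k)" by (rule \<phi>_mult_ge)
    also have "\<dots> \<preceq> (\<phi> j * \<phi> (k - j - 1)) * \<phi> (d - k)"
      by (intro coeff_le_mult \<phi>_mult_ge) auto
    finally show ?thesis using that by (simp add: F_path_minus2)
  qed
  consider "j < k" | "k < j" | "j = k" by linarith
  thus ?thesis
  proof cases
    case 3
    have "\<phi> (d - 3) \<preceq> \<phi> (d - 1)" by (intro \<phi>_mono) auto
    also note F_path_minus_ge[OF assms(1)]
    finally show ?thesis using 3 by simp
  qed (use *[of j k] *[of k j] assms in \<open>auto simp: insert_commute\<close>)
qed

text \<open>
  The two segments end at two neighbours of \<open>u\<close>. The sum splits according to which of these two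
  neighbours belong to the principal minor; if both do, the perfect matching is forced by parity.
\<close>

lemma F_two_neighbours:
  assumes u: "u \<notin> P" and ik: "i < k" "i \<in> nb u" "k \<in> nb u"
    and l: "a + l = i" and r: "k + r \<le> d"
    and far: "\<And>m. a \<le> m \<Longrightarrow> m < i \<Longrightarrow> m \<notin> nb u" "\<And>m. k < m \<Longrightarrow> m \<le> k + r \<Longrightarrow> m \<notin> nb u"
  shows "\<xi> * (\<phi> (l + r + 1) + \<phi> l * \<phi> r) \<preceq> F {u} (v ` {a..i} \<union> v ` {k..k + r})"
proof -
  define L where "L = v ` {a..<a + l}"
  define R where "R = v ` {Suc k..<Suc k + r}"
  note kd = nb_le[OF ik(3)]
  have fin: "finite L" "finite R" by (auto simp: L_def R_def)
  have u_ne: "v m \<noteq> u" if "m \<le> d" for m using u that by auto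
  have adj_u: "adj u (v i)" "adj u (v k)" using ik by (auto simp: nb_def)
  have adj_u': "adj (v i) u" "adj (v k) u" using adj_u adj_sym by auto
  have id: "i \<le> d" using ik kd by simp
  have u_LR: "\<not> adj u x" if "x \<in> L \<union> R" for x
    using that far l r id by (auto simp: L_def R_def nb_def)
  have LR_u: "\<not> adj x u" if "x \<in> L \<union> R" for x
    using u_LR[OF that] adj_sym by blast
  have mem: "v i \<notin> L \<union> R" "v k \<notin> L \<union> R" "u \<notin> L \<union> R" "v i \<noteq> v k" "v i \<noteq> u" "v k \<noteq> u" "L \<inter> R = {}"
  proof -
    have "L \<union> R \<subseteq> P" using id l r by (auto simp: L_def R_def)
    thus "u \<notin> L \<union> R" using u by blast
    show "v i \<noteq> u" "v k \<noteq> u" using u_ne id kd by auto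
    show "v i \<notin> L \<union> R" "v k \<notin> L \<union> R" "v i \<noteq> v k" "L \<inter> R = {}"
      using ik(1) id kd l r by (auto simp: L_def R_def v_eq_iff)
  qed
  have LR: "F {} (L \<union> R) = \<phi> l * \<phi> r"
    unfolding L_def R_def by (rule F_two_segments) (use ik l r in auto)
  have L: "F {} L = \<phi> l"
    using F_two_segments[of a l "a + l" 0] l r ik by (simp add: L_def)
  have split: "v ` {a..i} \<union> v ` {k..k + r} = insert (v i) (insert (v k) (L \<union> R))"
  proof -
    have "{a..i} = insert i {a..<a + l}" "{k..k + r} = insert k {Suc k..<Suc k + r}"
      using l by auto
    thus ?thesis by (auto simp: L_def R_def)
  qed
  have "F {u} (v ` {a..i} \<union> v ` {k..k + r}) =
      F {u} (L \<union> R) + F {v k, u} (L \<union> R) + (F {v i, u} (L \<union> R) + F {v k, v i, u} (L \<union> R))"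
    unfolding split using fin mem by (simp add: F_insert)
  moreover have "F {v k, u} (L \<union> R) = \<xi> * (\<phi> l * \<phi> r)"
  proof -
    have "F {v k, u} (L \<union> R) = \<xi> * F ({v k, u} - {u, v k}) (L \<union> R)"
      by (rule F_leaf) (use fin mem adj_u u_LR in auto)
    thus ?thesis by (simp add: LR insert_commute)
  qed
  moreover have i: "F {v i, u} W = \<xi> * F {} W" if "W \<subseteq> L \<union> R" for W
  proof -
    have "F {v i, u} W = \<xi> * F ({v i, u} - {u, v i}) W"
      by (rule F_leaf) (use that fin mem adj_u u_LR in \<open>auto intro: finite_subset\<close>)
    thus ?thesis by (simp add: insert_commute)
  qed
  \<comment> \<open>With both neighbours present, u takes one of them and the other is matched into
    its own segment. The minor on the three vertices alone, which has odd order, is discarded as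
    nonnegative.\<close>
  moreover have "\<phi> r * (\<xi> * \<psi> l * \<xi>) + \<xi> * \<psi> r * (\<xi> * \<phi> l) \<preceq> F {v k, v i, u} (L \<union> R)"
  proof -
    have "F {v k, v i, u} (L \<union> v ` {Suc k..<Suc k + r}) =
        \<phi> r * F {v k, v i, u} L + \<xi> * \<psi> r * F ({v k, v i, u} - {v k}) L"
    proof (rule F_segment_up)
      show "v m \<notin> {v k, v i, u} \<union> L" if "Suc k \<le> m" "m < Suc k + r" for m
        using that r kd ik l u_ne by (auto simp: L_def v_eq_iff)
      show "adj (v m) x \<longleftrightarrow> m = Suc k \<and> x = v k"
        if "Suc k \<le> m" "m < Suc k + r" "x \<in> {v k, v i, u} \<union> L" for m x
      proof -
        have "\<not> adj (v m) u" using that LR_u by (auto simp: R_def)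
        thus ?thesis using that r kd ik l u_ne by (auto simp: L_def v_eq_iff v_adj_iff)
      qed
    qed (use fin mem r in auto)
    also have "{v k, v i, u} - {v k} = {v i, u}" using mem by auto
    also have "F {v i, u} L = \<xi> * \<phi> l" using i[of L] L by simp
    finally have "F {v k, v i, u} (L \<union> R) = \<phi> r * F {v k, v i, u} L + \<xi> * \<psi> r * (\<xi> * \<phi> l)"
      by (simp add: R_def)
    moreover have "F {v k, v i, u} ({} \<union> v ` {a..<a + l}) =
        \<phi> l * F {v k, v i, u} {} + \<xi> * \<psi> l * F ({v k, v i, u} - {v i}) {}"
    proof (rule F_segment_down)
      show "v m \<notin> {v k, v i, u} \<union> {}" if "a \<le> m" "m < a + l" for m
        using that r kd ik l u_ne by (auto simp: v_eq_iff)
      show "adj (v m) x \<longleftrightarrow> Suc m = a + l \<and> x = v i"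
        if "a \<le> m" "m < a + l" "x \<in> {v k, v i, u} \<union> {}" for m x
      proof -
        have "\<not> adj (v m) u" using that LR_u by (auto simp: L_def)
        thus ?thesis using that r kd ik l u_ne by (auto simp: v_eq_iff v_adj_iff)
      qed
    qed (use fin mem r ik l in auto)
    moreover have "F ({v k, v i, u} - {v i}) {} = \<xi>"
    proof -
      have "{v k, v i, u} - {v i} = {v k, u}" using mem by auto
      moreover have "F {v k, u} {} = \<xi> * F ({v k, u} - {u, v k}) {}"
        by (rule F_leaf) (use mem adj_u in auto)
      ultimately show ?thesis by (simp add: insert_commute)
    qed
    ultimately have eq: "F {v k, v i, u} L = \<xi> * \<psi> l * \<xi> + \<phi> l * F {v k, v i, u} {}"
      by (simp add: L_def)
    have "\<xi> * \<psi> l * \<xi> \<preceq> F {v k, v i, u} L"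
      unfolding eq by (intro coeff_le_add_right coeff_le_mult_nonneg) auto
    thus ?thesis
      unfolding \<open>F {v k, v i, u} (L \<union> R) = _\<close>
      by (intro coeff_le_add coeff_le_mult_left coeff_le_refl) auto
  qed
  ultimately have "F {u} (L \<union> R) + \<xi> * (\<phi> l * \<phi> r) + (\<xi> * (\<phi> l * \<phi> r) +
      (\<phi> r * (\<xi> * \<psi> l * \<xi>) + \<xi> * \<psi> r * (\<xi> * \<phi> l))) \<preceq> F {u} (v ` {a..i} \<union> v ` {k..k + r})"
    using i[of "L \<union> R"] LR by (auto intro!: coeff_le_add)
  moreover have "\<xi> * (\<phi> l * \<phi> r) + (\<xi> * (\<phi> l * \<phi> r) +
      (\<phi> r * (\<xi> * \<psi> l * \<xi>) + \<xi> * \<psi> r * (\<xi> * \<phi> l))) = \<xi> * (\<phi> l * \<phi> (Suc r) + \<phi> (Suc l) * \<phi> r)"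
    by (simp add: \<phi>_Suc algebra_simps)
  ultimately have "F {u} (L \<union> R) + \<xi> * (\<phi> (l + r + 1) + \<phi> l * \<phi> r) \<preceq>
      F {u} (v ` {a..i} \<union> v ` {k..k + r})"
    by (simp only: \<phi>_insert add.assoc)
  moreover have "0 \<preceq> F {u} (L \<union> R)" using fin by simp
  ultimately show ?thesis
    by (rule coeff_le_drop_left[rotated])
qed

text \<open>Split on the middle neighbour c. Without it the bound for two neighbours applies. With
  it, u is matched to c, and the outer neighbours supply a second \<open>\<phi> (l + r + 1)\<close>:
  a path with a distinguished vertex that is unmatched, matched to the left, or matched to the
  right.\<close>

lemma F_three_neighbours:
  assumes u: "u \<notin> P" and nb: "i \<in> nb u" "Suc i \<in> nb u" "Suc (Suc i) \<in> nb u"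
    and l: "a + l = i" and r: "Suc (Suc i) + r \<le> d"
    and far: "\<And>m. a \<le> m \<Longrightarrow> m < i \<Longrightarrow> m \<notin> nb u"
      "\<And>m. Suc (Suc i) < m \<Longrightarrow> m \<le> Suc (Suc i) + r \<Longrightarrow> m \<notin> nb u"
  shows "\<xi> * (2 * \<phi> (l + r + 1) + \<phi> l * \<phi> r) \<preceq> F {u} (v ` {a..Suc (Suc i) + r})"
proof -
  define k where "k = Suc (Suc i)"
  define L where "L = v ` {a..<a + l}"
  define R where "R = v ` {Suc k..<Suc k + r}"
  define c where "c = v (Suc i)"
  note kd = nb_le[OF nb(3), folded k_def]
  have id: "i \<le> d" "Suc i \<le> d" using kd by (auto simp: k_def)
  have fin: "finite L" "finite R" by (auto simp: L_def R_def)
  have "L \<union> R \<subseteq> P" using id l r by (auto simp: L_def R_def k_def)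
  hence mem: "u \<notin> L \<union> R" using u by blast
  have u_ne: "v m \<noteq> u" if "m \<le> d" for m using u that by auto
  have adj_u: "adj u c" using nb by (auto simp: nb_def c_def)
  have LR_u: "\<not> adj x u" if "x \<in> L \<union> R" for x
    using that far l r id by (auto simp: L_def R_def adj_v_nb k_def)
  have u_LR: "\<not> adj u x" if "x \<in> L \<union> R" for x
    using LR_u[OF that] adj_sym by blast
  have mem': "v i \<notin> L \<union> R" "v k \<notin> L \<union> R" "c \<notin> L \<union> R" "L \<inter> R = {}"
    "v i \<noteq> v k" "v i \<noteq> c" "v k \<noteq> c" "v i \<noteq> u" "v k \<noteq> u" "c \<noteq> u"
    using id kd l r u_ne by (auto simp: L_def R_def c_def v_eq_iff k_def)
  have cu: "F {c, u} W = \<xi> * F {} W" if "W \<subseteq> L \<union> R" for W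
  proof -
    have "F {c, u} W = \<xi> * F ({c, u} - {u, c}) W"
      by (rule F_leaf) (use that fin mem mem' adj_u u_LR in \<open>auto intro: finite_subset\<close>)
    thus ?thesis by (simp add: insert_commute)
  qed
  have LR: "F {} (L \<union> R) = \<phi> l * \<phi> r"
    unfolding L_def R_def by (rule F_two_segments) (use l r in \<open>auto simp: k_def\<close>)
  have L: "F {} L = \<phi> l"
    using F_two_segments[of a l "a + l" 0] l r by (simp add: L_def)
  have R: "F {} R = \<phi> r"
    using F_two_segments[of 0 0 "Suc k" r] l r by (simp add: R_def k_def)
  have "F {v k, c, u} (L \<union> v ` {Suc k..<Suc k + r}) =
      \<phi> r * F {v k, c, u} L + \<xi> * \<psi> r * F ({v k, c, u} - {v k}) L"
  proof (rule F_segment_up)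
    show "v m \<notin> {v k, c, u} \<union> L" if "Suc k \<le> m" "m < Suc k + r" for m
      using that r kd l u_ne id by (auto simp: L_def v_eq_iff c_def k_def)
    show "adj (v m) x \<longleftrightarrow> m = Suc k \<and> x = v k"
      if "Suc k \<le> m" "m < Suc k + r" "x \<in> {v k, c, u} \<union> L" for m x
    proof -
      have "\<not> adj (v m) u" using that LR_u by (auto simp: R_def)
      thus ?thesis using that r kd id l u_ne by (auto simp: L_def c_def k_def v_eq_iff v_adj_iff)
    qed
  qed (use fin mem mem' r in \<open>auto simp: k_def\<close>)
  moreover have "{v k, c, u} - {v k} = {c, u}" using mem' by auto
  ultimately have "F {v k, c, u} (L \<union> R) = \<xi> * \<psi> r * (\<xi> * \<phi> l) + \<phi> r * F {v k, c, u} L"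
    using cu[of L] L by (simp add: R_def)
  hence k: "\<xi> * \<psi> r * (\<xi> * \<phi> l) \<preceq> F {v k, c, u} (L \<union> R)"
    using fin by (auto intro!: coeff_le_add_right coeff_le_mult_nonneg)
  have "F {v i, c, u} (R \<union> v ` {a..<a + l}) =
      \<phi> l * F {v i, c, u} R + \<xi> * \<psi> l * F ({v i, c, u} - {v i}) R"
  proof (rule F_segment_down)
    show "v m \<notin> {v i, c, u} \<union> R" if "a \<le> m" "m < a + l" for m
      using that r kd l u_ne id by (auto simp: R_def v_eq_iff c_def k_def)
    show "adj (v m) x \<longleftrightarrow> Suc m = a + l \<and> x = v i"
      if "a \<le> m" "m < a + l" "x \<in> {v i, c, u} \<union> R" for m x
    proof -
      have "\<not> adj (v m) u" using that LR_u by (auto simp: L_def)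
      thus ?thesis using that r kd id l u_ne by (auto simp: R_def c_def k_def v_eq_iff v_adj_iff)
    qed
  qed (use fin mem mem' l id in auto)
  moreover have "{v i, c, u} - {v i} = {c, u}" using mem' by auto
  ultimately have "F {v i, c, u} (L \<union> R) = \<xi> * \<psi> l * (\<xi> * \<phi> r) + \<phi> l * F {v i, c, u} R"
    using cu[of R] R by (simp add: L_def Un_commute)
  hence i: "\<xi> * \<psi> l * (\<xi> * \<phi> r) \<preceq> F {v i, c, u} (L \<union> R)"
    using fin by (auto intro!: coeff_le_add_right coeff_le_mult_nonneg)
  have "F {c, u} (insert (v i) (insert (v k) (L \<union> R))) =
      F {c, u} (L \<union> R) + F {v k, c, u} (L \<union> R) + (F {v i, c, u} (L \<union> R) + F {v k, v i, c, u} (L \<union> R))"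
    using fin mem' by (simp add: F_insert)
  \<comment> \<open>The 0 stands for the sets with all three neighbours of u: they contain the
    4-cycle through u and these neighbours, whose orientation is unknown.\<close>
  moreover have "\<xi> * (\<phi> l * \<phi> r) + \<xi> * \<psi> r * (\<xi> * \<phi> l) + (\<xi> * \<psi> l * (\<xi> * \<phi> r) + 0) \<preceq>
      F {c, u} (L \<union> R) + F {v k, c, u} (L \<union> R) + (F {v i, c, u} (L \<union> R) + F {v k, v i, c, u} (L \<union> R))"
    by (intro coeff_le_add i k) (use fin in \<open>auto simp: cu LR\<close>)
  ultimately have c: "\<xi> * (\<phi> l * \<phi> r) + \<xi> * \<psi> r * (\<xi> * \<phi> l) + (\<xi> * \<psi> l * (\<xi> * \<phi> r) + 0)
      \<preceq> F {c, u} (insert (v i) (insert (v k) (L \<union> R)))"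
    by simp
  have segs: "v ` {a..i} \<union> v ` {k..k + r} = insert (v i) (insert (v k) (L \<union> R))"
  proof -
    have "{a..i} = insert i {a..<a + l}" "{k..k + r} = insert k {Suc k..<Suc k + r}"
      using l by auto
    thus ?thesis by (auto simp: L_def R_def)
  qed
  have "v ` {a..k + r} = insert c (insert (v i) (insert (v k) (L \<union> R)))"
  proof -
    have "{a..k + r} = insert (Suc i) ({a..i} \<union> {k..k + r})"
      using l by (auto simp: k_def)
    thus ?thesis unfolding segs[symmetric] c_def by (simp add: image_Un)
  qed
  hence "F {u} (v ` {a..k + r}) = F {u} (v ` {a..i} \<union> v ` {k..k + r}) +
      F {c, u} (insert (v i) (insert (v k) (L \<union> R)))"
    using mem' fin by (simp add: F_insert segs)
  moreover have "\<xi> * (\<phi> (l + r + 1) + \<phi> l * \<phi> r) \<preceq> F {u} (v ` {a..i} \<union> v ` {k..k + r})"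
    by (rule F_two_neighbours) (use assms in \<open>auto simp: k_def\<close>)
  ultimately have "\<xi> * (\<phi> (l + r + 1) + \<phi> l * \<phi> r) +
      (\<xi> * (\<phi> l * \<phi> r) + \<xi> * \<psi> r * (\<xi> * \<phi> l) + (\<xi> * \<psi> l * (\<xi> * \<phi> r) + 0))
      \<preceq> F {u} (v ` {a..k + r})"
    using c coeff_le_add by simp
  moreover have "\<phi> (l + r + 1) = \<phi> l * \<phi> r + \<psi> r * (\<xi> * \<phi> l) + \<psi> l * (\<xi> * \<phi> r)"
    using \<phi>_add[of "Suc l" r] by (simp add: \<phi>_Suc[of l] algebra_simps)
  hence "\<xi> * \<phi> (l + r + 1) =
      \<xi> * (\<phi> l * \<phi> r) + \<xi> * \<psi> r * (\<xi> * \<phi> l) + (\<xi> * \<psi> l * (\<xi> * \<phi> r) + 0)"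
    by (simp only: distrib_left mult.assoc)
  ultimately show ?thesis
    by (simp only: k_def distrib_left mult_2 add.assoc add.commute add.left_commute)
qed

text \<open>Since W avoids all other neighbours of w, adding \<open>v j\<close> makes w a leaf there
  and forces that edge. Every other choice is discarded as nonnegative.\<close>

lemma F_two_leaves:
  assumes "finite W" "w \<notin> P" "j \<in> nb w" "finite Z" "Z \<inter> P = {}" "w \<notin> Z" "\<And>x. x \<in> Z \<Longrightarrow> \<not> adj w x"
    and W: "W \<subseteq> P - {v j}" "\<And>i. i \<in> nb w \<Longrightarrow> i = j \<or> v i \<notin> W"
  shows "\<xi> * F Z W \<preceq> F (insert w Z) P"
proof -
  have j: "j \<le> d" using assms(3) by (rule nb_le)
  have eq: "\<xi> * F Z W = F (insert (v j) (insert w Z)) W"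
  proof -
    have "F (insert (v j) (insert w Z)) W = \<xi> * F (insert (v j) (insert w Z) - {w, v j}) W"
    proof (rule F_leaf)
      show "\<not> adj w x" if "x \<in> insert (v j) (insert w Z) \<union> W" "x \<noteq> v j" for x
        using that assms(7) W by (auto simp: P_def nb_def)
    qed (use assms j in \<open>auto simp: nb_def\<close>)
    moreover have "insert (v j) (insert w Z) - {w, v j} = Z"
      using assms(2,5,6) j by auto
    ultimately show ?thesis by simp
  qed
  have "\<xi> * F Z W \<preceq> F (insert w Z) W + F (insert (v j) (insert w Z)) W"
    unfolding eq
    using assms by (intro coeff_le_add_left F_nonneg) auto
  also have "\<dots> = F (insert w Z) (insert (v j) W)"
    by (rule F_insert[symmetric]) (use assms in auto)
  also have "\<dots> \<preceq> F (insert w Z) P"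
    by (rule F_mono) (use assms j in auto)
  finally show ?thesis .
qed

lemma F_pendant:
  assumes "w \<notin> P" "nb w = {j}" "finite Z" "Z \<inter> P = {}" "w \<notin> Z" "\<And>x. x \<in> Z \<Longrightarrow> \<not> adj w x"
  shows "\<xi> * F Z (P - {v j}) \<preceq> F (insert w Z) P"
  by (rule F_two_leaves) (use assms in auto)

lemma F_edge:
  assumes "x \<notin> P" "y \<notin> P" "adj x y" "W \<subseteq> P" "\<And>i. i \<in> nb x \<Longrightarrow> v i \<notin> W"
  shows "F {x, y} W = \<xi> * F {} W"
proof -
  have "F {x, y} W = \<xi> * F ({x, y} - {x, y}) W"
  proof (rule F_leaf)
    show "\<not> adj x z" if "z \<in> {x, y} \<union> W" "z \<noteq> y" for z
      using that assms(4,5) by (auto simp: P_def nb_def)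
    show "finite W" using assms(4) by (rule finite_subset) simp
  qed (use assms in auto)
  thus ?thesis by simp
qed

end

section \<open>Lower bounds for the traces in terms of \<open>\<alpha>\<close>,
  \<open>\<beta>\<close>, \<open>\<gamma>\<close>\<close>

locale long_induced_path = induced_path +
  assumes d3: "3 \<le> d"
begin

text \<open>The three units of account: a vertex attached next to an end of the path is worth
  \<open>\<xi> * \<phi> (d - 1)\<close>, that is \<alpha> + \<gamma>; a further path neighbour adds
  at least \<beta>; two forced edges that use up two path vertices are worth at least
  \<gamma>.\<close>

definition \<alpha> :: "int poly" where "\<alpha> = \<xi> * \<phi> (d - 2)"
definition \<beta> :: "int poly" where "\<beta> = \<xi> * \<phi> (d - 3)"
definition \<gamma> :: "int poly" where "\<gamma> = \<xi> * (\<xi> * \<phi> (d - 3))"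

lemma \<phi>_d: "\<phi> (d - 1) = \<phi> (d - 2) + \<xi> * \<phi> (d - 3)" "\<phi> d = \<phi> (d - 1) + \<xi> * \<phi> (d - 2)"
  "\<phi> (Suc d) = \<phi> d + \<xi> * \<phi> (d - 1)"
proof -
  have "d = Suc (Suc (Suc (d - 3)))" using d3 by simp
  then obtain e where "d = Suc (Suc (Suc e))" by blast
  thus "\<phi> (d - 1) = \<phi> (d - 2) + \<xi> * \<phi> (d - 3)" "\<phi> d = \<phi> (d - 1) + \<xi> * \<phi> (d - 2)"
    "\<phi> (Suc d) = \<phi> d + \<xi> * \<phi> (d - 1)" by simp_all
qed

lemma \<xi>_\<phi>_d: "\<xi> * \<phi> (d - 1) = \<alpha> + \<gamma>"
  by (simp only: \<alpha>_def \<gamma>_def \<phi>_d(1) distrib_left)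

lemma nonneg_\<alpha>\<beta>\<gamma> [simp]: "0 \<preceq> \<alpha>" "0 \<preceq> \<beta>" "0 \<preceq> \<gamma>" "0 \<preceq> \<xi> * \<xi>"
  by (simp_all add: \<alpha>_def \<beta>_def \<gamma>_def coeff_le_mult_nonneg)

lemma \<beta>_le_\<alpha>: "\<beta> \<preceq> \<alpha>"
  unfolding \<alpha>_def \<beta>_def by (intro coeff_le_mult_left \<phi>_mono) auto

lemma \<xi>_mult_mono: "p \<preceq> q \<Longrightarrow> \<xi> * p \<preceq> \<xi> * q"
  by (rule coeff_le_mult_left) simp

lemma \<xi>\<xi>_le: "1 \<preceq> p \<Longrightarrow> \<xi> * \<xi> \<preceq> \<xi> * (\<xi> * p)"
  using \<xi>_mult_mono[OF \<xi>_mult_mono, of 1 p] by simp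

lemma \<xi>\<xi>_le_\<gamma>: "\<xi> * \<xi> \<preceq> \<gamma>"
  unfolding \<gamma>_def by (intro \<xi>\<xi>_le \<phi>_ge_1)

lemma F_one_neighbour:
  assumes "u \<notin> P" "nb u = {j}"
  shows "\<xi> * (\<phi> j * \<phi> (d - j)) \<preceq> F {u} P"
  using F_pendant[OF assms, of "{}"] F_path_minus[of j] assms nb_le[of j u] by simp

lemma F_one_neighbour_ge:
  assumes "u \<notin> P" "nb u = {j}"
  shows "\<alpha> + \<gamma> \<preceq> F {u} P"
proof -
  have "j \<le> d" using assms nb_le by blast
  hence "\<xi> * \<phi> (d - 1) \<preceq> \<xi> * (\<phi> j * \<phi> (d - j))"
    using \<phi>_mult_ge[of j "d - j"] by (intro \<xi>_mult_mono) simp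
  also note F_one_neighbour[OF assms]
  finally show ?thesis by (simp only: \<xi>_\<phi>_d)
qed

text \<open>The product \<open>\<phi> j * \<phi> (d - j)\<close> is minimal at j = 1 and j = d - 1.
  This lemma and the next give the surplus at all other positions, which later pins down where
  pendent vertices sit.\<close>

lemma F_one_neighbour_end:
  assumes "u \<notin> P" "nb u = {j}" "j = 0 \<or> j = d"
  shows "\<alpha> + \<gamma> + \<xi> * \<xi> \<preceq> F {u} P"
proof -
  have "\<alpha> + \<gamma> + \<xi> * \<xi> \<preceq> \<alpha> + \<gamma> + \<xi> * (\<xi> * \<phi> (d - 2))"
    by (intro coeff_le_add \<xi>\<xi>_le \<phi>_ge_1 coeff_le_refl)
  also have "\<dots> = \<xi> * \<phi> d" by (simp only: \<phi>_d(2) \<xi>_\<phi>_d distrib_left)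
  also have "\<dots> = \<xi> * (\<phi> j * \<phi> (d - j))" using assms(3) by (elim disjE) simp_all
  also note F_one_neighbour[OF assms(1,2)]
  finally show ?thesis .
qed

lemma F_one_neighbour_inner:
  assumes "u \<notin> P" "nb u = {j}" "2 \<le> j" "j + 2 \<le> d"
  shows "\<alpha> + \<gamma> + \<xi> * (\<xi> * \<xi>) \<preceq> F {u} P"
proof -
  define a b where "a = j - 2" and "b = d - j - 2"
  have ab: "j = Suc (Suc a)" "d - j = Suc (Suc b)" "d - 1 = a + b + 3"
    using assms by (auto simp: a_def b_def)
  have "\<alpha> + \<gamma> + \<xi> * (\<xi> * \<xi>) \<preceq> \<xi> * \<phi> (d - 1) + \<xi> * (\<xi> * (\<xi> * (\<phi> a * \<phi> b)))"
    unfolding \<xi>_\<phi>_d by (intro coeff_le_add \<xi>_mult_mono \<xi>\<xi>_le one_le_\<phi>_mult coeff_le_refl)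
  also have "\<dots> = \<xi> * (\<phi> j * \<phi> (d - j))"
    unfolding ab(2,3) unfolding ab(1) \<phi>_mult_inner by (simp only: distrib_left mult.assoc)
  also note F_one_neighbour[OF assms(1,2)]
  finally show ?thesis .
qed

lemma F_nb_pair:
  assumes "u \<notin> P" "nb u = {i, k}" "i < k"
  shows "\<xi> * (\<phi> (i + (d - k) + 1) + \<phi> i * \<phi> (d - k)) \<preceq> F {u} P"
proof -
  have k: "k \<le> d" using assms nb_le by blast
  have "\<xi> * (\<phi> (i + (d - k) + 1) + \<phi> i * \<phi> (d - k)) \<preceq> F {u} (v ` {0..i} \<union> v ` {k..k + (d - k)})"
    by (rule F_two_neighbours) (use assms k in auto)
  also have "\<dots> \<preceq> F {u} P"
    by (rule F_mono) (use assms k in \<open>auto simp: P_def\<close>)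
  finally show ?thesis .
qed

lemma F_nb_pair_adjacent:
  assumes "u \<notin> P" "nb u = {i, Suc i}"
  shows "\<alpha> + \<gamma> + \<beta> + \<xi> * \<xi> \<preceq> F {u} P"
proof -
  have i: "Suc i \<le> d" using assms nb_le by blast
  have "\<alpha> + \<gamma> + \<xi> * \<xi> \<preceq> \<alpha> + \<gamma> + \<xi> * (\<xi> * \<phi> (d - 2))"
    by (intro coeff_le_add \<xi>\<xi>_le \<phi>_ge_1 coeff_le_refl)
  also have "\<dots> = \<xi> * \<phi> d" by (simp only: \<phi>_d(2) \<xi>_\<phi>_d distrib_left)
  also have "\<dots> = \<xi> * \<phi> (i + (d - Suc i) + 1)" using i by simp
  finally have 1: "\<alpha> + \<gamma> + \<xi> * \<xi> \<preceq> \<xi> * \<phi> (i + (d - Suc i) + 1)" .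
  have "\<phi> (d - 3) \<preceq> \<phi> (i + (d - Suc i) - 1)" using i by (intro \<phi>_mono) auto
  also note \<phi>_mult_ge
  finally have "\<beta> \<preceq> \<xi> * (\<phi> i * \<phi> (d - Suc i))" unfolding \<beta>_def by (rule \<xi>_mult_mono)
  with 1 have "\<alpha> + \<gamma> + \<xi> * \<xi> + \<beta> \<preceq> \<xi> * \<phi> (i + (d - Suc i) + 1) + \<xi> * (\<phi> i * \<phi> (d - Suc i))"
    by (rule coeff_le_add)
  also have "\<dots> = \<xi> * (\<phi> (i + (d - Suc i) + 1) + \<phi> i * \<phi> (d - Suc i))" by (simp only: distrib_left)
  also note F_nb_pair[OF assms]
  finally show ?thesis by (simp add: add_ac)
qed

lemma F_nb_pair_apart:
  assumes "u \<notin> P" "nb u = {i, i + 2}"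
  shows "\<alpha> + \<gamma> + \<xi> * (\<phi> i * \<phi> (d - (i + 2))) \<preceq> F {u} P"
proof -
  have i: "i + 2 \<le> d" using assms nb_le by blast
  hence "i + (d - (i + 2)) + 1 = d - 1" by simp
  hence "\<alpha> + \<gamma> + \<xi> * (\<phi> i * \<phi> (d - (i + 2))) =
      \<xi> * (\<phi> (i + (d - (i + 2)) + 1) + \<phi> i * \<phi> (d - (i + 2)))"
    by (simp only: distrib_left \<xi>_\<phi>_d)
  also have "\<dots> \<preceq> F {u} P" by (rule F_nb_pair) (use assms in auto)
  finally show ?thesis .
qed

lemma F_nb_pair_ge:
  assumes "u \<notin> P" "nb u = {i, k}" "i < k" "k \<le> i + 2"
  shows "\<alpha> + \<gamma> + \<beta> \<preceq> F {u} P"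
proof -
  consider "k = Suc i" | "k = i + 2" using assms by linarith
  thus ?thesis
  proof cases
    case 1
    have "\<alpha> + \<gamma> + \<beta> \<preceq> \<alpha> + \<gamma> + \<beta> + \<xi> * \<xi>" by (rule coeff_le_add_right) simp
    also have "\<dots> \<preceq> F {u} P" by (rule F_nb_pair_adjacent) (use 1 assms in auto)
    finally show ?thesis .
  next
    case 2
    have "k \<le> d" using assms nb_le by blast
    hence "\<phi> (d - 3) \<preceq> \<phi> (i + (d - (i + 2)) - 1)" using 2 by (intro \<phi>_mono) auto
    also note \<phi>_mult_ge
    finally have "\<alpha> + \<gamma> + \<beta> \<preceq> \<alpha> + \<gamma> + \<xi> * (\<phi> i * \<phi> (d - (i + 2)))"
      unfolding \<beta>_def by (intro coeff_le_add \<xi>_mult_mono coeff_le_refl)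
    also have "\<dots> \<preceq> F {u} P" by (rule F_nb_pair_apart) (use 2 assms in auto)
    finally show ?thesis .
  qed
qed

text \<open>For d = 3 the only positions i = 0 and i = 1 are both extremal and no surplus exists,
  hence \<open>4 \<le> d\<close>.\<close>

lemma F_nb_pair_apart_end:
  assumes "u \<notin> P" "nb u = {i, i + 2}" "4 \<le> d" "i = 0 \<or> i + 2 = d"
  shows "\<alpha> + \<gamma> + \<beta> + \<xi> * \<xi> \<preceq> F {u} P"
proof -
  have "d = Suc (Suc (Suc (Suc (d - 4))))" using assms(3) by simp
  then obtain e where e: "d = Suc (Suc (Suc (Suc e)))" by blast
  have "\<alpha> + \<gamma> + (\<beta> + \<xi> * \<xi>) \<preceq> \<alpha> + \<gamma> + (\<beta> + \<xi> * (\<xi> * \<phi> e))"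
    by (intro coeff_le_add \<xi>\<xi>_le \<phi>_ge_1 coeff_le_refl)
  also have "\<dots> = \<alpha> + \<gamma> + \<xi> * (\<phi> i * \<phi> (d - (i + 2)))"
    unfolding \<beta>_def using assms(4) by (auto simp: e distrib_left)
  also have "\<dots> \<preceq> F {u} P" by (rule F_nb_pair_apart) (use assms in auto)
  finally show ?thesis by (simp only: add.assoc)
qed

lemma F_nb_pair_apart_inner:
  assumes "u \<notin> P" "nb u = {i, i + 2}" "2 \<le> i" "i + 4 \<le> d"
  shows "\<alpha> + \<gamma> + \<beta> + \<xi> * (\<xi> * \<xi>) \<preceq> F {u} P"
proof -
  define a b where "a = i - 2" and "b = d - i - 4"
  have ab: "i = Suc (Suc a)" "d - (i + 2) = Suc (Suc b)" "d - 3 = a + b + 3"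
    using assms by (auto simp: a_def b_def)
  have "\<alpha> + \<gamma> + (\<beta> + \<xi> * (\<xi> * \<xi>)) \<preceq> \<alpha> + \<gamma> + (\<beta> + \<xi> * (\<xi> * (\<xi> * (\<phi> a * \<phi> b))))"
    by (intro coeff_le_add \<xi>_mult_mono \<xi>\<xi>_le one_le_\<phi>_mult coeff_le_refl)
  also have "\<dots> = \<alpha> + \<gamma> + \<xi> * (\<phi> i * \<phi> (d - (i + 2)))"
    unfolding \<beta>_def ab(2,3) unfolding ab(1) \<phi>_mult_inner by (simp only: distrib_left mult.assoc)
  also have "\<dots> \<preceq> F {u} P" by (rule F_nb_pair_apart) (use assms in auto)
  finally show ?thesis by (simp only: add.assoc)
qed

lemma F_nb_triple_ge:
  assumes "u \<notin> P" "nb u = {i, Suc i, Suc (Suc i)}"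
  shows "\<alpha> + \<gamma> + 2 * \<beta> \<preceq> F {u} P"
proof -
  define r where "r = d - Suc (Suc i)"
  have k: "Suc (Suc i) \<le> d" using assms nb_le by blast
  have ir: "i + r + 1 = d - 1" using k by (simp add: r_def)
  have "\<phi> (d - 3) \<preceq> \<phi> (i + r - 1)" using ir by (intro \<phi>_mono) auto
  also note \<phi>_mult_ge
  finally have 1: "\<phi> (d - 3) \<preceq> \<phi> i * \<phi> r" .
  have 2: "\<phi> (d - 3) \<preceq> \<phi> (d - 1)" by (intro \<phi>_mono) auto
  have "\<alpha> + \<gamma> + 2 * \<beta> = \<xi> * (\<phi> (d - 1) + \<phi> (d - 3) + \<phi> (d - 3))"
    by (simp only: distrib_left \<xi>_\<phi>_d \<beta>_def mult_2 add.assoc)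
  also have "\<dots> \<preceq> \<xi> * (\<phi> (d - 1) + \<phi> (d - 1) + \<phi> i * \<phi> r)"
    by (intro \<xi>_mult_mono coeff_le_add 1 2 coeff_le_refl)
  also have "\<dots> = \<xi> * (2 * \<phi> (i + r + 1) + \<phi> i * \<phi> r)"
    by (simp only: ir mult_2)
  also have "\<dots> \<preceq> F {u} (v ` {0..Suc (Suc i) + r})"
    by (rule F_three_neighbours) (use assms k in \<open>auto simp: r_def\<close>)
  also have "\<dots> \<preceq> F {u} P"
    by (rule F_mono) (use k in \<open>auto simp: P_def r_def\<close>)
  finally show ?thesis .
qed

text \<open>The end x is a leaf at y whatever subset of P is added, so the whole
  \<open>\<phi> (Suc d)\<close> is available. It expands into \<open>\<phi> (d - 1)\<close> and two
  terms that are worth at least one \<gamma> each after multiplication by \<xi>.\<close>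

lemma F_edge_free_end:
  assumes "x \<notin> P" "y \<notin> P" "adj x y" "nb x = {}"
  shows "\<alpha> + 3 * \<gamma> \<preceq> F {x, y} P"
proof -
  have "\<phi> (d - 3) \<preceq> \<phi> (d - 2)" "\<phi> (d - 3) \<preceq> \<phi> (d - 1)" by (intro \<phi>_mono, simp)+
  hence "\<gamma> \<preceq> \<xi> * (\<xi> * \<phi> (d - 2))" "\<gamma> \<preceq> \<xi> * (\<xi> * \<phi> (d - 1))"
    by (simp_all add: \<gamma>_def \<xi>_mult_mono)
  hence "\<alpha> + \<gamma> + (\<gamma> + \<gamma>) \<preceq> \<xi> * \<phi> (d - 1) + (\<xi> * (\<xi> * \<phi> (d - 2)) + \<xi> * (\<xi> * \<phi> (d - 1)))"
    unfolding \<xi>_\<phi>_d by (intro coeff_le_add coeff_le_refl)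
  also have "\<dots> = \<xi> * \<phi> (Suc d)" by (simp only: \<phi>_d(2,3) distrib_left add.assoc)
  also have "\<dots> = F {x, y} P" using F_edge[OF assms(1-3), of P] assms(4) F_path by simp
  finally show ?thesis by (simp add: algebra_simps)
qed

lemma F_edge_ge:
  assumes "x \<notin> P" "y \<notin> P" "adj x y" "nb x = {i}"
  shows "\<alpha> + \<gamma> \<preceq> F {x, y} (P - {v i})"
proof -
  have i: "i \<le> d" using assms nb_le by blast
  have "\<xi> * \<phi> (d - 1) \<preceq> \<xi> * F {} (P - {v i})"
    by (intro \<xi>_mult_mono F_path_minus_ge i)
  also have "\<dots> = F {x, y} (P - {v i})"
    by (rule F_edge[symmetric]) (use assms in auto)
  finally show ?thesis by (simp only: \<xi>_\<phi>_d)
qed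

lemma F_edge_attached:
  assumes "x \<notin> P" "y \<notin> P" "adj x y" "nb x = {i}"
  shows "\<alpha> + \<gamma> \<preceq> F {x, y} P"
  using F_edge_ge[OF assms] by (rule coeff_le_trans) (auto intro: F_mono)

text \<open>The basic bound uses only sets without \<open>v i\<close>. One more set helps: x, y,
  \<open>v i\<close> and a path neighbour \<open>v m\<close> of \<open>v i\<close> that is not
  adjacent to y. There \<open>v m\<close> is a leaf, so the matching is forced.\<close>

lemma F_edge_attached_both:
  assumes "x \<notin> P" "y \<notin> P" "adj x y" "nb x = {i}" "nb y = {j}"
  shows "\<alpha> + \<gamma> + \<xi> * \<xi> \<preceq> F {x, y} P"
proof -
  have *: "\<alpha> + \<gamma> + \<xi> * \<xi> \<preceq> F {x, y} P"
    if "x \<notin> P" "y \<notin> P" "adj x y" "nb x = {i}" "nb y = {j}" "m \<le> d" "m \<noteq> j" "m = Suc i \<or> i = Suc m"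
    for x y i j m
  proof -
    have i: "i \<le> d" using that nb_le by blast
    have mm: "m \<notin> nb (v m)" by (simp add: nb_def)
    have mi: "v m \<noteq> v i" using that i by (auto simp: v_eq_iff)
    have ne: "v m \<noteq> x" "v m \<noteq> y" "v i \<noteq> x" "v i \<noteq> y" using that i by auto
    have "F {v m, v i, x, y} {} = \<xi> * F ({v m, v i, x, y} - {v m, v i}) {}"
    proof (rule F_leaf)
      show "\<not> adj (v m) z" if "z \<in> {v m, v i, x, y} \<union> {}" "z \<noteq> v i" for z
        using that mm \<open>nb x = {i}\<close> \<open>nb y = {j}\<close> \<open>m \<le> d\<close> \<open>m \<noteq> j\<close> \<open>m = Suc i \<or> i = Suc m\<close> mi ne
        by (auto simp: adj_v_nb)
      show "adj (v m) (v i)" using that i by (auto simp: v_adj_iff)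
    qed auto
    also have "{v m, v i, x, y} - {v m, v i} = {x, y}" using ne by auto
    also have "F {x, y} {} = \<xi>" using F_edge[OF that(1-3), of "{}"] by simp
    finally have eq: "F {v m, v i, x, y} {} = \<xi> * \<xi>" .
    have "\<xi> * \<xi> \<preceq> F {v i, x, y} {} + F {v m, v i, x, y} {}"
      unfolding eq by (intro coeff_le_add_left F_nonneg) auto
    also have "\<dots> = F {v i, x, y} {v m}" by (simp add: F_insert[of "{}"])
    also have "\<dots> \<preceq> F {v i, x, y} (P - {v i})"
      by (rule F_mono) (use that mi in auto)
    finally have "\<xi> * \<xi> \<preceq> F {v i, x, y} (P - {v i})" .
    with F_edge_ge[OF that(1-4)]
    have "\<alpha> + \<gamma> + \<xi> * \<xi> \<preceq> F {x, y} (P - {v i}) + F {v i, x, y} (P - {v i})"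
      by (rule coeff_le_add)
    also have "\<dots> = F {x, y} (insert (v i) (P - {v i}))" by (rule F_insert[symmetric]) auto
    also have "insert (v i) (P - {v i}) = P" using i by auto
    finally show ?thesis .
  qed
  have i: "i \<le> d" "j \<le> d" using assms nb_le by blast+
  show ?thesis
  proof (cases "Suc i \<le> d \<and> Suc i \<noteq> j")
    case True
    thus ?thesis using *[OF assms, of "Suc i"] by auto
  next
    case False
    show ?thesis
    proof (cases "0 < i \<and> i - 1 \<noteq> j")
      case True
      thus ?thesis using *[OF assms, of "i - 1"] i by auto
    next
      case False
      \<comment> \<open>No suitable m next to i exists only if \<open>v i\<close> is an end of the
        path and \<open>v j\<close> its sole path neighbour. Then x and y change roles, and the
        vertex at distance two from that end is used.\<close>
      have yx: "adj y x" using assms(3) adj_sym by blast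
      note ** = *[OF assms(2,1) yx assms(5,4)]
      from \<open>\<not> (Suc i \<le> d \<and> Suc i \<noteq> j)\<close> False
      consider "i = 0" "j = 1" | "i = d" "j = d - 1" using i d3 by force
      thus ?thesis
      proof cases
        case 1
        thus ?thesis using **[of 2] d3 by (simp add: insert_commute)
      next
        case 2
        thus ?thesis using **[of "d - 2"] d3 by (simp add: insert_commute)
      qed
    qed
  qed
qed

section \<open>One vertex off the path, with one path vertex deleted\<close>

lemma F_isolated_segment_up:
  assumes "u \<notin> P" "j \<le> d" "W \<subseteq> v ` {Suc j..d}" "\<And>m. m < j \<Longrightarrow> m \<notin> nb u"
  shows "F {u} (W \<union> v ` {0..<0 + j}) = \<phi> j * F {u} W"
proof (rule F_segment_isolated)
  have W: "W \<subseteq> P" using assms(3) by (auto simp: P_def)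
  show "finite W" using assms(3) finite_subset by blast
  show "{u} \<inter> W = {}" using W assms(1) by auto
  show "v i \<notin> {u} \<union> W" if "i < 0 + j" for i
    using that assms v_in_P[of i] by (auto simp: v_eq_iff)
  show "\<not> adj (v i) x" if "i < 0 + j" "x \<in> {u} \<union> W" for i x
  proof (cases "x = u")
    case True
    thus ?thesis using that assms by (simp add: adj_v_nb)
  next
    case False
    thus ?thesis using that assms by (auto simp: v_adj_iff)
  qed
qed (use assms in auto)

lemma F_isolated_segment_down:
  assumes "u \<notin> P" "j \<le> d" "W \<subseteq> v ` {..<j}" "\<And>m. j < m \<Longrightarrow> m \<notin> nb u"
  shows "F {u} (W \<union> v ` {Suc j..<Suc j + (d - j)}) = \<phi> (d - j) * F {u} W"
proof (rule F_segment_isolated)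
  have W: "W \<subseteq> P" using assms(2,3) by (auto simp: P_def)
  show "finite W" using assms(3) finite_subset by blast
  show "{u} \<inter> W = {}" using W assms(1) by auto
  show "v i \<notin> {u} \<union> W" if "Suc j \<le> i" "i < Suc j + (d - j)" for i
    using that assms v_in_P[of i] by (auto simp: v_eq_iff)
  show "\<not> adj (v i) x" if "Suc j \<le> i" "i < Suc j + (d - j)" "x \<in> {u} \<union> W" for i x
  proof (cases "x = u")
    case True
    thus ?thesis using that assms by (simp add: adj_v_nb)
  next
    case False
    thus ?thesis using that assms by (auto simp: v_adj_iff)
  qed
qed (use assms in auto)

text \<open>Deleting \<open>v j\<close> below all neighbours of u severs the first j path vertices,
  which then contribute the factor \<open>\<phi> j\<close> independently of u.\<close>

lemma F_minus_left:
  assumes "u \<notin> P" "j < i" "i \<le> d" "\<And>m. m < i \<Longrightarrow> m \<notin> nb u"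
    "p \<preceq> F {u} W" "W \<subseteq> v ` {Suc j..d}"
  shows "\<phi> j * p \<preceq> F {u} (P - {v j})"
proof -
  have "\<phi> j * p \<preceq> \<phi> j * F {u} W" using assms by (intro coeff_le_mult_left) auto
  also have "\<dots> = F {u} (W \<union> v ` {0..<0 + j})"
    by (rule F_isolated_segment_up[symmetric]) (use assms in auto)
  also have "\<dots> \<preceq> F {u} (P - {v j})"
    by (rule F_mono) (use assms in \<open>auto simp: P_def v_eq_iff\<close>)
  finally show ?thesis .
qed

lemma F_minus_right:
  assumes "u \<notin> P" "k < j" "j \<le> d" "\<And>m. k < m \<Longrightarrow> m \<notin> nb u"
    "p \<preceq> F {u} W" "W \<subseteq> v ` {..<j}"
  shows "\<phi> (d - j) * p \<preceq> F {u} (P - {v j})"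
proof -
  have "\<phi> (d - j) * p \<preceq> \<phi> (d - j) * F {u} W" using assms by (intro coeff_le_mult_left) auto
  also have "\<dots> = F {u} (W \<union> v ` {Suc j..<Suc j + (d - j)})"
    by (rule F_isolated_segment_down[symmetric]) (use assms in auto)
  also have "\<dots> \<preceq> F {u} (P - {v j})"
    by (rule F_mono) (use assms in \<open>auto simp: P_def v_eq_iff\<close>)
  finally show ?thesis .
qed

text \<open>Once one of its two path neighbours is gone, u is a leaf at the other one.\<close>

lemma F_nb_pair_minus_shared:
  assumes "u \<notin> P" "nb u = {i, k}" "i \<noteq> k"
  shows "\<beta> \<preceq> F {u} (P - {v i})"
proof -
  have ik: "i \<le> d" "k \<le> d" using assms nb_le by blast+
  have ne: "v k \<noteq> v i" using ik assms(3) by (simp add: v_eq_iff)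
  have "\<beta> \<preceq> \<xi> * F {} (P - {v i, v k})"
    unfolding \<beta>_def by (intro \<xi>_mult_mono F_path_minus2_ge ik)
  also have "\<dots> = F {v k, u} (P - {v i, v k})"
  proof -
    have "F {v k, u} (P - {v i, v k}) = \<xi> * F ({v k, u} - {u, v k}) (P - {v i, v k})"
    proof (rule F_leaf)
      show "\<not> adj u x" if "x \<in> {v k, u} \<union> (P - {v i, v k})" "x \<noteq> v k" for x
        using that assms(2) by (auto simp: P_def nb_def)
      show "{v k, u} \<inter> (P - {v i, v k}) = {}" using assms(1) by auto
      show "adj u (v k)" using assms(2) by (auto simp: nb_def)
    qed auto
    moreover have "{v k, u} - {u, v k} = {}" by auto
    ultimately show ?thesis by simp
  qed
  also have "\<dots> \<preceq> F {u} (P - {v i, v k}) + F {v k, u} (P - {v i, v k})"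
    by (intro coeff_le_add_left F_nonneg) auto
  also have "\<dots> = F {u} (insert (v k) (P - {v i, v k}))" by (rule F_insert[symmetric]) auto
  also have "insert (v k) (P - {v i, v k}) = P - {v i}" using ik ne by auto
  finally show ?thesis .
qed

lemma \<beta>_plus_\<xi>_le:
  assumes "1 \<preceq> q" "\<phi> (d - 3) \<preceq> p"
  shows "\<beta> + \<xi> \<preceq> \<xi> * (p + q)"
proof -
  have "\<beta> + \<xi> * 1 \<preceq> \<xi> * p + \<xi> * q"
    unfolding \<beta>_def using assms by (intro coeff_le_add \<xi>_mult_mono)
  thus ?thesis by (simp add: distrib_left)
qed

lemma \<phi>_mult3_ge:
  assumes "d - 3 \<le> j + (m - 1)" "1 \<le> m"
  shows "\<phi> (d - 3) \<preceq> \<phi> j * \<phi> m"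
proof -
  have "\<phi> (d - 3) \<preceq> \<phi> (j + m - 1)" using assms by (intro \<phi>_mono) auto
  also note \<phi>_mult_ge
  finally show ?thesis .
qed

lemma one_le_\<phi>_mult3: "1 \<preceq> \<phi> j * (\<phi> a * \<phi> b)"
  using coeff_le_mult[OF _ \<phi>_ge_1 _ one_le_\<phi>_mult, of j a b] by simp

text \<open>Both path neighbours of u survive, and the product term of
  \<open>F_two_neighbours\<close> provides the extra \<xi>. This gives the surplus when a pendent
  vertex does not share its neighbour with u.\<close>

lemma F_nb_pair_minus_other:
  assumes u: "u \<notin> P" "nb u = {i, k}" "i < k" "k \<le> i + 2" and j: "j \<le> d" "j \<notin> {i, k}"
  shows "\<beta> + \<xi> \<preceq> F {u} (P - {v j})"
proof -
  have k: "k \<le> d" using assms nb_le by blast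
  consider "j < i" | "i < j" "j < k" | "k < j" using j by force
  thus ?thesis
  proof cases
    case 1
    define l r where "l = i - Suc j" and "r = d - k"
    have "\<beta> + \<xi> \<preceq> \<xi> * (\<phi> j * \<phi> (l + r + 1) + \<phi> j * (\<phi> l * \<phi> r))"
      by (intro \<beta>_plus_\<xi>_le \<phi>_mult3_ge one_le_\<phi>_mult3) (use 1 u k in \<open>auto simp: l_def r_def\<close>)
    also have "\<dots> = \<phi> j * (\<xi> * (\<phi> (l + r + 1) + \<phi> l * \<phi> r))" by (simp add: algebra_simps)
    also have "\<dots> \<preceq> F {u} (P - {v j})"
    proof (rule F_minus_left[where i = i and W = "v ` {Suc j..i} \<union> v ` {k..k + r}"])
      show "\<xi> * (\<phi> (l + r + 1) + \<phi> l * \<phi> r) \<preceq> F {u} (v ` {Suc j..i} \<union> v ` {k..k + r})"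
        by (rule F_two_neighbours) (use 1 u k in \<open>auto simp: l_def r_def\<close>)
      show "v ` {Suc j..i} \<union> v ` {k..k + r} \<subseteq> v ` {Suc j..d}"
        using 1 u k by (auto simp: r_def)
    qed (use 1 u k in auto)
    finally show ?thesis .
  next
    case 2
    have "\<beta> + \<xi> \<preceq> \<xi> * (\<phi> (i + (d - k) + 1) + \<phi> i * \<phi> (d - k))"
      by (intro \<beta>_plus_\<xi>_le \<phi>_mono one_le_\<phi>_mult) (use 2 u k in auto)
    also have "\<dots> \<preceq> F {u} (v ` {0..i} \<union> v ` {k..k + (d - k)})"
      by (rule F_two_neighbours) (use u k in auto)
    also have "\<dots> \<preceq> F {u} (P - {v j})"
      by (rule F_mono) (use 2 u k in \<open>auto simp: P_def v_eq_iff\<close>)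
    finally show ?thesis .
  next
    case 3
    define r where "r = j - Suc k"
    have "\<beta> + \<xi> \<preceq> \<xi> * (\<phi> (d - j) * \<phi> (i + r + 1) + \<phi> (d - j) * (\<phi> i * \<phi> r))"
      by (intro \<beta>_plus_\<xi>_le \<phi>_mult3_ge one_le_\<phi>_mult3) (use 3 u k j in \<open>auto simp: r_def\<close>)
    also have "\<dots> = \<phi> (d - j) * (\<xi> * (\<phi> (i + r + 1) + \<phi> i * \<phi> r))" by (simp add: algebra_simps)
    also have "\<dots> \<preceq> F {u} (P - {v j})"
    proof (rule F_minus_right[where W = "v ` {0..i} \<union> v ` {k..k + r}"])
      show "\<xi> * (\<phi> (i + r + 1) + \<phi> i * \<phi> r) \<preceq> F {u} (v ` {0..i} \<union> v ` {k..k + r})"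
        by (rule F_two_neighbours) (use 3 u k j in \<open>auto simp: r_def\<close>)
      show "v ` {0..i} \<union> v ` {k..k + r} \<subseteq> v ` {..<j}"
        using 3 u k by (auto simp: r_def)
    qed (use 3 u k j in auto)
    finally show ?thesis .
  qed
qed

text \<open>At least two of the three neighbours survive the deletion, and each is worth one
  \<beta>.\<close>

lemma F_nb_triple_minus:
  assumes u: "u \<notin> P" "nb u = {i, Suc i, Suc (Suc i)}" and j: "j \<le> d"
  shows "2 * \<beta> \<preceq> F {u} (P - {v j})"
proof -
  have k: "Suc (Suc i) \<le> d" using assms nb_le by blast
  define r where "r = d - Suc (Suc i)"
  have two: "2 * \<beta> \<preceq> \<xi> * (p + q)" if "\<phi> (d - 3) \<preceq> p" "\<phi> (d - 3) \<preceq> q" for p q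
    using \<xi>_mult_mono[OF coeff_le_add[OF that]] by (simp add: \<beta>_def algebra_simps)
  consider "j < i" | "j = i" | "j = Suc i" | "j = Suc (Suc i)" | "Suc (Suc i) < j" by linarith
  thus ?thesis
  proof cases
    case 1
    define l where "l = i - Suc j"
    have "2 * \<beta> \<preceq> \<xi> * (\<phi> j * \<phi> (l + r + 1) + (\<phi> j * \<phi> (l + r + 1) + \<phi> j * (\<phi> l * \<phi> r)))"
      by (intro two \<phi>_mult3_ge coeff_le_trans[OF \<phi>_mult3_ge coeff_le_add_right])
         (use 1 k in \<open>auto simp: l_def r_def intro!: coeff_le_mult_nonneg\<close>)
    also have "\<dots> = \<phi> j * (\<xi> * (2 * \<phi> (l + r + 1) + \<phi> l * \<phi> r))" by (simp add: algebra_simps)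
    also have "\<dots> \<preceq> F {u} (P - {v j})"
    proof (rule F_minus_left[where i = i and W = "v ` {Suc j..Suc (Suc i) + r}"])
      show "\<xi> * (2 * \<phi> (l + r + 1) + \<phi> l * \<phi> r) \<preceq> F {u} (v ` {Suc j..Suc (Suc i) + r})"
        by (rule F_three_neighbours) (use 1 u k in \<open>auto simp: l_def r_def\<close>)
      show "v ` {Suc j..Suc (Suc i) + r} \<subseteq> v ` {Suc j..d}" using k by (auto simp: r_def)
    qed (use 1 u k in auto)
    finally show ?thesis .
  next
    case 2
    have "2 * \<beta> \<preceq> \<xi> * (\<phi> i * \<phi> (r + 1) + \<phi> i * \<phi> r)"
    proof (rule two)
      show "\<phi> (d - 3) \<preceq> \<phi> i * \<phi> (r + 1)" by (rule \<phi>_mult3_ge) (use k in \<open>auto simp: r_def\<close>)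
      have "\<phi> (d - 3) \<preceq> \<phi> (i + r - 1)" using k by (intro \<phi>_mono) (auto simp: r_def)
      also note \<phi>_mult_ge
      finally show "\<phi> (d - 3) \<preceq> \<phi> i * \<phi> r" .
    qed
    also have "\<dots> = \<phi> i * (\<xi> * (\<phi> (0 + r + 1) + \<phi> 0 * \<phi> r))" by (simp add: algebra_simps)
    also have "\<dots> \<preceq> \<phi> i * F {u} (v ` {Suc i..Suc i} \<union> v ` {Suc (Suc i)..Suc (Suc i) + r})"
      by (intro coeff_le_mult_left F_two_neighbours) (use u k in \<open>auto simp: r_def\<close>)
    also have "\<dots> = F {u} (v ` {Suc i..Suc i} \<union> v ` {Suc (Suc i)..Suc (Suc i) + r} \<union> v ` {0..<0 + i})"
      by (rule F_isolated_segment_up[symmetric]) (use u k in \<open>auto simp: r_def\<close>)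
    also have "\<dots> \<preceq> F {u} (P - {v j})"
      by (rule F_mono) (use 2 k in \<open>auto simp: P_def v_eq_iff r_def\<close>)
    finally show ?thesis .
  next
    case 3
    have "2 * \<beta> \<preceq> \<xi> * (\<phi> (i + r + 1) + \<phi> i * \<phi> r)"
    proof (rule two)
      show "\<phi> (d - 3) \<preceq> \<phi> (i + r + 1)" using k by (intro \<phi>_mono) (auto simp: r_def)
      have "\<phi> (d - 3) \<preceq> \<phi> (i + r - 1)" using k by (intro \<phi>_mono) (auto simp: r_def)
      also note \<phi>_mult_ge
      finally show "\<phi> (d - 3) \<preceq> \<phi> i * \<phi> r" .
    qed
    also have "\<dots> \<preceq> F {u} (v ` {0..i} \<union> v ` {Suc (Suc i)..Suc (Suc i) + r})"
      by (rule F_two_neighbours) (use u k in \<open>auto simp: r_def\<close>)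
    also have "\<dots> \<preceq> F {u} (P - {v j})"
      by (rule F_mono) (use 3 k in \<open>auto simp: P_def v_eq_iff r_def\<close>)
    finally show ?thesis .
  next
    case 4
    have "2 * \<beta> \<preceq> \<xi> * (\<phi> r * \<phi> (i + 1) + \<phi> i * \<phi> r)"
    proof (rule two)
      show "\<phi> (d - 3) \<preceq> \<phi> r * \<phi> (i + 1)" by (rule \<phi>_mult3_ge) (use k in \<open>auto simp: r_def\<close>)
      have "\<phi> (d - 3) \<preceq> \<phi> (i + r - 1)" using k by (intro \<phi>_mono) (auto simp: r_def)
      also note \<phi>_mult_ge
      finally show "\<phi> (d - 3) \<preceq> \<phi> i * \<phi> r" .
    qed
    also have "\<dots> = \<phi> r * (\<xi> * (\<phi> (i + 0 + 1) + \<phi> i * \<phi> 0))" by (simp add: algebra_simps)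
    also have "\<dots> \<preceq> \<phi> r * F {u} (v ` {0..i} \<union> v ` {Suc i..Suc i + 0})"
      by (intro coeff_le_mult_left F_two_neighbours) (use u k in auto)
    also have "\<dots> = F {u} (v ` {0..i} \<union> v ` {Suc i..Suc i + 0} \<union>
        v ` {Suc (Suc (Suc i))..<Suc (Suc (Suc i)) + (d - Suc (Suc i))})"
      unfolding r_def by (rule F_isolated_segment_down[symmetric]) (use u k in auto)
    also have "\<dots> \<preceq> F {u} (P - {v j})"
      by (rule F_mono) (use 4 k in \<open>auto simp: P_def v_eq_iff\<close>)
    finally show ?thesis .
  next
    case 5
    define r' where "r' = j - Suc (Suc (Suc i))"
    have "2 * \<beta> \<preceq> \<xi> * (\<phi> (d - j) * \<phi> (i + r' + 1) + (\<phi> (d - j) * \<phi> (i + r' + 1) + \<phi> (d - j) * (\<phi> i * \<phi> r')))"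
      by (intro two \<phi>_mult3_ge coeff_le_trans[OF \<phi>_mult3_ge coeff_le_add_right])
         (use 5 k j in \<open>auto simp: r'_def intro!: coeff_le_mult_nonneg\<close>)
    also have "\<dots> = \<phi> (d - j) * (\<xi> * (2 * \<phi> (i + r' + 1) + \<phi> i * \<phi> r'))" by (simp add: algebra_simps)
    also have "\<dots> \<preceq> F {u} (P - {v j})"
    proof (rule F_minus_right[where W = "v ` {0..Suc (Suc i) + r'}"])
      show "\<xi> * (2 * \<phi> (i + r' + 1) + \<phi> i * \<phi> r') \<preceq> F {u} (v ` {0..Suc (Suc i) + r'})"
        by (rule F_three_neighbours) (use 5 u k j in \<open>auto simp: r'_def\<close>)
      show "v ` {0..Suc (Suc i) + r'} \<subseteq> v ` {..<j}" using 5 by (auto simp: r'_def)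
    qed (use 5 u k j in auto)
    finally show ?thesis .
  qed
qed

section \<open>Traces with two or three vertices\<close>

lemma F_pair_leaf:
  assumes "u \<notin> P" "w \<notin> P" "nb w = {j}" "w \<noteq> u" "\<not> adj w u"
  shows "\<xi> * F {u} (P - {v j}) \<preceq> F {w, u} P"
  by (rule F_pendant) (use assms in auto)

lemma F_pair_ge:
  assumes "u \<notin> P" "w \<notin> P" "nb w = {j}" "w \<noteq> u" "\<not> adj w u" "nb u = {i, k}" "i < k" "k \<le> i + 2"
  shows "\<gamma> \<preceq> F {w, u} P"
proof -
  have "\<beta> \<preceq> F {u} (P - {v j})"
  proof (cases "j \<in> {i, k}")
    case True
    thus ?thesis
      using F_nb_pair_minus_shared[of u i k] F_nb_pair_minus_shared[of u k i] assms
      by (auto simp: insert_commute)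
  next
    case False
    have "\<beta> \<preceq> \<beta> + \<xi>" by (rule coeff_le_add_right) simp
    also have "\<dots> \<preceq> F {u} (P - {v j})"
      by (rule F_nb_pair_minus_other) (use False assms nb_le in auto)
    finally show ?thesis .
  qed
  hence "\<gamma> \<preceq> \<xi> * F {u} (P - {v j})"
    unfolding \<gamma>_def \<beta>_def by (rule \<xi>_mult_mono)
  also note F_pair_leaf[OF assms(1-5)]
  finally show ?thesis .
qed

lemma F_pair_other:
  assumes "u \<notin> P" "w \<notin> P" "nb w = {j}" "w \<noteq> u" "\<not> adj w u" "nb u = {i, k}" "i < k" "k \<le> i + 2"
    "j \<notin> {i, k}"
  shows "\<gamma> + \<xi> * \<xi> \<preceq> F {w, u} P"
proof -
  have "\<gamma> + \<xi> * \<xi> = \<xi> * (\<beta> + \<xi>)" by (simp add: \<gamma>_def \<beta>_def distrib_left)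
  also have "\<dots> \<preceq> \<xi> * F {u} (P - {v j})"
    by (intro \<xi>_mult_mono F_nb_pair_minus_other) (use assms nb_le in auto)
  also note F_pair_leaf[OF assms(1-5)]
  finally show ?thesis .
qed

lemma F_pair_triple:
  assumes "u \<notin> P" "w \<notin> P" "nb w = {j}" "w \<noteq> u" "\<not> adj w u" "nb u = {i, Suc i, Suc (Suc i)}"
  shows "2 * \<gamma> \<preceq> F {w, u} P"
proof -
  have "2 * \<gamma> = \<xi> * (2 * \<beta>)" by (simp add: \<gamma>_def \<beta>_def algebra_simps)
  also have "\<dots> \<preceq> \<xi> * F {u} (P - {v j})"
    by (intro \<xi>_mult_mono F_nb_triple_minus) (use assms nb_le in auto)
  also note F_pair_leaf[OF assms(1-5)]
  finally show ?thesis .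
qed

text \<open>Three forced choices: w takes \<open>v j\<close>, x is a leaf at y once
  \<open>v i\<close> is excluded, and the path loses at most the two vertices \<open>v i\<close> and
  \<open>v j\<close>.\<close>

lemma F_edge_far:
  assumes "x \<notin> P" "y \<notin> P" "adj x y" "nb x \<subseteq> {i}" "i \<le> d" "w \<notin> P" "nb w = {j}" "w \<notin> {x, y}"
    "\<not> adj w x" "\<not> adj w y"
  shows "\<gamma> \<preceq> F {w, x, y} P"
proof -
  have j: "j \<le> d" using assms nb_le by blast
  have "\<gamma> \<preceq> \<xi> * (\<xi> * F {} (P - {v i, v j}))"
    unfolding \<gamma>_def by (intro \<xi>_mult_mono F_path_minus2_ge assms j)
  also have "\<xi> * F {} (P - {v i, v j}) = F {x, y} (P - {v i, v j})"
    by (rule F_edge[symmetric]) (use assms in auto)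
  also have "\<xi> * F {x, y} (P - {v i, v j}) \<preceq> \<xi> * F {x, y} (P - {v j})"
    by (intro \<xi>_mult_mono F_mono) auto
  also have "\<dots> \<preceq> F {w, x, y} P"
    by (rule F_pendant) (use assms in auto)
  finally show ?thesis .
qed

lemma F_edge_far_pos:
  assumes "x \<notin> P" "y \<notin> P" "adj x y" "w \<notin> P" "j \<in> nb w" "w \<notin> {x, y}" "\<not> adj w x" "\<not> adj w y"
  shows "\<xi> * \<xi> \<preceq> F {w, x, y} P"
proof -
  have "F {x, y} {} = \<xi>" using F_edge[OF assms(1-3), of "{}"] by simp
  moreover have "\<xi> * F {x, y} {} \<preceq> F {w, x, y} P"
    by (rule F_two_leaves) (use assms in auto)
  ultimately show ?thesis by simp
qed

text \<open>The single set consisting of w, \<open>v j\<close>, u and \<open>v i\<close> suffices: w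
  is a leaf at \<open>v j\<close> because \<open>v i\<close> is not its neighbour, and then u is
  left with \<open>v i\<close>.\<close>

lemma F_pair_pos:
  assumes "u \<notin> P" "w \<notin> P" "w \<noteq> u" "\<not> adj w u" "j \<in> nb w" "i \<in> nb u" "i \<notin> nb w"
  shows "\<xi> * \<xi> \<preceq> F {w, u} P"
proof -
  have ij: "i \<le> d" "j \<le> d" "i \<noteq> j" using assms nb_le by auto
  have "F {v i, u} {} = \<xi> * F ({v i, u} - {u, v i}) {}"
    by (rule F_leaf) (use assms in \<open>auto simp: nb_def\<close>)
  hence "F {v i, u} {} = \<xi>" by (simp add: insert_commute)
  hence "\<xi> \<preceq> F {u} {} + F {v i, u} {}" by (simp add: coeff_le_add_left)
  also have "\<dots> = F {u} {v i}" by (simp add: F_insert[of "{}"])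
  finally have "\<xi> * \<xi> \<preceq> \<xi> * F {u} {v i}" by (rule \<xi>_mult_mono)
  also have "\<dots> \<preceq> F {w, u} P"
  proof (rule F_two_leaves)
    show "m = j \<or> v m \<notin> {v i}" if "m \<in> nb w" for m
      using that assms(7) ij nb_le[of m w] by (auto simp: v_eq_iff)
  qed (use assms ij in \<open>auto simp: v_eq_iff\<close>)
  finally show ?thesis .
qed

end

section \<open>Counting the edges outside a path\<close>

lemma nat_sum_eq_2_cases:
  fixes f :: "'a \<Rightarrow> nat"
  assumes "finite A" "sum f A = 2"
  obtains x where "x \<in> A" "f x = 2" "\<And>y. y \<in> A \<Longrightarrow> y \<noteq> x \<Longrightarrow> f y = 0"
  | x y where "x \<in> A" "y \<in> A" "x \<noteq> y" "f x = 1" "f y = 1"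
      "\<And>z. z \<in> A \<Longrightarrow> z \<noteq> x \<Longrightarrow> z \<noteq> y \<Longrightarrow> f z = 0"
proof -
  from assms obtain x where x: "x \<in> A" "f x \<noteq> 0"
    by (metis sum.neutral zero_neq_numeral)
  have split: "f x + sum f (A - {x}) = 2" using assms x by (simp add: sum.remove)
  show ?thesis
  proof (cases "f x = 2")
    case True
    hence "sum f (A - {x}) = 0" using split by simp
    hence "\<And>y. y \<in> A \<Longrightarrow> y \<noteq> x \<Longrightarrow> f y = 0" using assms(1) by simp
    thus ?thesis using that(1) x True by blast
  next
    case False
    hence fx: "f x = 1" "sum f (A - {x}) = 1" using split x by auto
    then obtain y where y: "y \<in> A - {x}" "f y = 1" "\<forall>z\<in>A - {x}. y \<noteq> z \<longrightarrow> f z = 0"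
      using assms(1) sum_eq_1_iff[of "A - {x}" f] by auto
    show ?thesis by (rule that(2)[of x y]) (use x fx y in auto)
  qed
qed

text \<open>The function \<rho> stands for the distance to P; only its decrease along some edge is
  required. In \<open>edge_count\<close>, the n + 1 edges of the graph are diminished by the d edges
  of P, and n = card (V - P) + d + 1.\<close>

locale bicyclic_with_path = long_induced_path +
  fixes V :: "nat set" and \<rho> :: "nat \<Rightarrow> nat"
  assumes finite_V: "finite V" and P_V: "P \<subseteq> V"
    and nb_spread: "u \<in> V - P \<Longrightarrow> i \<in> nb u \<Longrightarrow> k \<in> nb u \<Longrightarrow> k \<le> i + 2"
    and parent_ex: "u \<in> V - P \<Longrightarrow> nb u = {} \<Longrightarrow> \<exists>w\<in>V - P. adj u w \<and> \<rho> w < \<rho> u"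
    and edge_count: "card {{x, y} | x y. x \<in> V - P \<and> y \<in> V - P \<and> adj x y} + (\<Sum>u\<in>V - P. card (nb u)) =
      card (V - P) + 2"
begin

definition U :: "nat set" where "U = V - P"
definition A :: "nat set" where "A = {u \<in> U. nb u \<noteq> {}}"
definition E\<^sub>U :: "nat set set" where "E\<^sub>U = {{x, y} | x y. x \<in> U \<and> y \<in> U \<and> adj x y}"
text \<open>Both ends of such an edge touch P, so neither end is a leaf against all of P and two
  \<gamma> are lost in the bound. These edges are scarce, because a parent edge always starts
  outside A.\<close>

definition Bad :: "nat set set" where "Bad = {e \<in> E\<^sub>U. e \<subseteq> A}"
text \<open>Together with the non-parent edges inside U this accounts for the cyclomatic number 2,
  see \<open>card_extra_edges\<close>.\<close>

definition excess :: nat where "excess = (\<Sum>u\<in>A. card (nb u) - 1)"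
definition parent :: "nat \<Rightarrow> nat" where
  "parent u = (SOME w. w \<in> U \<and> adj u w \<and> \<rho> w < \<rho> u)"
definition parent_edges :: "nat set set" where "parent_edges = (\<lambda>u. {u, parent u}) ` (U - A)"

lemma finite_U [simp]: "finite U" using finite_V by (simp add: U_def)
lemma finite_A [simp]: "finite A" by (simp add: A_def)
lemma A_U: "A \<subseteq> U" by (auto simp: A_def)
lemma U_P: "u \<in> U \<Longrightarrow> u \<notin> P" by (simp add: U_def)
lemma finite_nb [simp]: "finite (nb u)" by (simp add: nb_def)

lemma E\<^sub>U_Pow: "E\<^sub>U \<subseteq> Pow U" by (auto simp: E\<^sub>U_def)
lemma finite_E\<^sub>U [simp]: "finite E\<^sub>U" using E\<^sub>U_Pow finite_U by (metis finite_Pow_iff finite_subset)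
lemma finite_Bad [simp]: "finite Bad" by (simp add: Bad_def)

lemma E\<^sub>U_E:
  assumes "e \<in> E\<^sub>U"
  obtains x y where "e = {x, y}" "x \<in> U" "y \<in> U" "adj x y" "adj y x" "x \<noteq> y"
  using assms adj_sym unfolding E\<^sub>U_def by (auto, metis adj_irrefl)

lemma E\<^sub>U_I: "x \<in> U \<Longrightarrow> y \<in> U \<Longrightarrow> adj x y \<Longrightarrow> {x, y} \<in> E\<^sub>U"
  by (auto simp: E\<^sub>U_def)

lemma card_E\<^sub>U_elem: "e \<in> E\<^sub>U \<Longrightarrow> card e = 2"
  by (erule E\<^sub>U_E) simp

lemma parent: "u \<in> U - A \<Longrightarrow> parent u \<in> U \<and> adj u (parent u) \<and> \<rho> (parent u) < \<rho> u"
  unfolding parent_def by (rule someI_ex) (use parent_ex[of u] in \<open>auto simp: U_def A_def\<close>)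

text \<open>An edge determines its child, because \<rho> strictly decreases towards the
  parent.\<close>

lemma card_parent_edges: "card parent_edges = card U - card A"
proof -
  have "inj_on (\<lambda>u. {u, parent u}) (U - A)"
  proof (rule inj_onI)
    fix u w assume *: "u \<in> U - A" "w \<in> U - A" "{u, parent u} = {w, parent w}"
    show "u = w" using parent[OF *(1)] parent[OF *(2)] *(3)
      by (metis doubleton_eq_iff less_asym)
  qed
  thus ?thesis by (simp add: parent_edges_def card_image card_Diff_subset A_U)
qed

lemma parent_edges_E\<^sub>U: "parent_edges \<subseteq> E\<^sub>U"
  using parent by (auto simp: parent_edges_def E\<^sub>U_def)

lemma finite_parent_edges [simp]: "finite parent_edges"
  by (simp add: parent_edges_def)

lemma card_A_le: "card A \<le> card U"
  using A_U by (simp add: card_mono)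

lemma card_E\<^sub>U: "card E\<^sub>U + card A + excess = card U + 2"
proof -
  have "(\<Sum>u\<in>V - P. card (nb u)) = (\<Sum>u\<in>A. card (nb u))"
    by (rule sum.mono_neutral_right) (auto simp: A_def U_def finite_V)
  also have "\<dots> = (\<Sum>u\<in>A. 1 + (card (nb u) - 1))"
    by (rule sum.cong) (auto simp: A_def card_gt_0_iff Suc_le_eq)
  also have "\<dots> = card A + excess" by (simp only: sum.distrib excess_def) simp
  finally show ?thesis using edge_count by (simp add: E\<^sub>U_def U_def)
qed

lemma card_extra_edges: "card (E\<^sub>U - parent_edges) + excess = 2"
  using card_Diff_subset[OF _ parent_edges_E\<^sub>U] card_parent_edges card_E\<^sub>U card_A_le
    card_mono[OF _ parent_edges_E\<^sub>U] by simp

lemma Bad_extra: "Bad \<subseteq> E\<^sub>U - parent_edges"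
  by (auto simp: Bad_def parent_edges_def)

lemma card_Bad: "card Bad + excess \<le> 2"
  using card_extra_edges card_mono[OF _ Bad_extra] by simp

text \<open>Far vertices extend e to a trace without edges between w and e, so that w can be matched
  into P independently of e.\<close>

definition far :: "nat set \<Rightarrow> nat \<Rightarrow> bool" where
  "far e w \<longleftrightarrow> w \<in> A \<and> w \<notin> e \<and> (\<forall>x\<in>e. \<not> adj w x)"

text \<open>
  Among \<open>e\<close> and the edges from \<open>e\<close> to \<open>A\<close>, at most \<open>card (e - A)\<close> are parent edges; the others
  are among the \<open>2 - excess\<close> remaining edges of \<open>E\<^sub>U\<close>.
\<close>

lemma card_not_far:
  assumes "e \<in> E\<^sub>U"
  shows "card {w \<in> A. \<not> far e w} + excess \<le> 3"
proof -
  obtain x y where e: "e = {x, y}" "x \<in> U" "y \<in> U" "adj x y" "x \<noteq> y"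
    using assms by (rule E\<^sub>U_E)
  define Z where "Z = insert e {{z, w} | z w. z \<in> e \<and> w \<in> A \<and> adj z w}"
  have Z: "Z \<subseteq> E\<^sub>U" using assms e A_U by (auto simp: Z_def E\<^sub>U_def)
  have finZ: "finite Z" using Z by (rule finite_subset) simp
  \<comment> \<open>Every edge in Z other than e has an end in A, and the child of a parent edge
    lies outside A. The child is therefore a vertex of e.\<close>
  have "Z \<inter> parent_edges \<subseteq> (\<lambda>u. {u, parent u}) ` (e - A)"
  proof
    fix f assume f: "f \<in> Z \<inter> parent_edges"
    then obtain u where u: "u \<in> U - A" "f = {u, parent u}" by (auto simp: parent_edges_def)
    have "u \<in> e" using f u by (auto simp: Z_def doubleton_eq_iff)
    thus "f \<in> (\<lambda>u. {u, parent u}) ` (e - A)" using u by auto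
  qed
  hence "card (Z \<inter> parent_edges) \<le> card (e - A)"
    using e by (intro surj_card_le) auto
  moreover have "card (Z - parent_edges) \<le> card (E\<^sub>U - parent_edges)"
    using Z by (intro card_mono) auto
  moreover have "card Z = card (Z \<inter> parent_edges) + card (Z - parent_edges)"
    using finZ by (metis card_Int_Diff)
  ultimately have cZ: "card Z + excess \<le> card (e - A) + 2"
    using card_extra_edges by linarith
  define Q where "Q = {w \<in> A - e. \<exists>z\<in>e. adj z w}"
  define f where "f w = {SOME z. z \<in> e \<and> adj z w, w}" for w
  have fQ: "\<exists>z\<in>e. f w = {z, w} \<and> adj z w" if "w \<in> Q" for w
  proof -
    have "\<exists>z. z \<in> e \<and> adj z w" using that by (auto simp: Q_def)
    from someI_ex[OF this] show ?thesis unfolding f_def by blast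
  qed
  have "inj_on f Q"
  proof (rule inj_onI)
    fix w w' assume *: "w \<in> Q" "w' \<in> Q" "f w = f w'"
    have "w \<notin> e" "w' \<notin> e" using * by (auto simp: Q_def)
    thus "w = w'" using fQ[OF *(1)] fQ[OF *(2)] *(3) by (auto simp: doubleton_eq_iff)
  qed
  moreover have "f ` Q \<subseteq> Z - {e}"
  proof
    fix g assume "g \<in> f ` Q"
    then obtain w where w: "w \<in> Q" "g = f w" by auto
    from fQ[OF w(1)] obtain z where z: "z \<in> e" "f w = {z, w}" "adj z w" by auto
    have "w \<in> A" "w \<notin> e" using w by (auto simp: Q_def)
    thus "g \<in> Z - {e}" using z w by (auto simp: Z_def)
  qed
  ultimately have "card Q \<le> card (Z - {e})" using finZ by (metis card_inj_on_le finite_Diff)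
  moreover have "card (Z - {e}) + 1 = card Z"
    using finZ card_Suc_Diff1[of Z e] by (simp add: Z_def)
  moreover have "{w \<in> A. \<not> far e w} = (A \<inter> e) \<union> Q"
    using adj_sym by (auto simp: far_def Q_def)
  hence "card {w \<in> A. \<not> far e w} \<le> card (A \<inter> e) + card Q" by (simp add: card_Un_le)
  moreover have "card (A \<inter> e) + card (e - A) = 2"
    using e card_Int_Diff[of e A] by (simp add: Int_commute)
  ultimately show ?thesis using cZ by linarith
qed

lemma nb_singleton: "u \<in> A \<Longrightarrow> card (nb u) = 1 \<Longrightarrow> \<exists>j\<le>d. nb u = {j}"
  by (metis card_1_singletonE insertI1 nb_le)

lemma nb_two:
  assumes "u \<in> A" "card (nb u) = 2"
  obtains i k where "nb u = {i, k}" "i < k" "k \<le> i + 2" "k \<le> d"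
proof -
  obtain i k where ik: "nb u = {i, k}" "i \<noteq> k" using assms(2) by (metis card_2_iff)
  have "k \<le> i + 2" "i \<le> k + 2" "i \<le> d" "k \<le> d"
    using nb_spread[of u i k] nb_spread[of u k i] assms(1) ik nb_le[of _ u] by (auto simp: A_def U_def)
  thus ?thesis using that[of i k] that[of k i] ik by (cases "i < k") (auto simp: insert_commute)
qed

lemma nb_three:
  assumes "u \<in> A" "card (nb u) = 3"
  obtains i where "nb u = {i, Suc i, Suc (Suc i)}"
proof -
  define i where "i = Min (nb u)"
  have ne: "nb u \<noteq> {}" using assms by (auto simp: A_def)
  have i: "i \<in> nb u" "\<And>k. k \<in> nb u \<Longrightarrow> i \<le> k" using ne by (auto simp: i_def)
  have "nb u \<subseteq> {i, Suc i, Suc (Suc i)}"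
  proof
    fix k assume k: "k \<in> nb u"
    have "k \<le> i + 2" using nb_spread[OF _ i(1) k] assms(1) by (auto simp: A_def U_def)
    with i(2)[OF k] show "k \<in> {i, Suc i, Suc (Suc i)}" by auto
  qed
  moreover have "card {i, Suc i, Suc (Suc i)} = 3" by simp
  ultimately have "nb u = {i, Suc i, Suc (Suc i)}"
    using assms(2) by (intro card_subset_eq) auto
  thus ?thesis by (rule that)
qed

lemma card_nb:
  assumes "u \<in> A"
  shows "1 \<le> card (nb u)" "card (nb u) \<le> excess + 1"
proof -
  show "1 \<le> card (nb u)" using assms by (auto simp: A_def Suc_le_eq card_gt_0_iff)
  have "card (nb u) - 1 \<le> excess"
    unfolding excess_def using assms by (intro member_le_sum) auto
  thus "card (nb u) \<le> excess + 1" by simp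
qed

section \<open>Bounds for the traces and their sum over a family\<close>

lemma F_single_ge:
  assumes "u \<in> A"
  shows "\<alpha> + \<gamma> + of_nat (card (nb u) - 1) * \<beta> \<preceq> F {u} P"
proof -
  have u: "u \<notin> P" using assms A_U U_P by auto
  have "excess \<le> 2" using card_Bad by simp
  then consider "card (nb u) = 1" | "card (nb u) = 2" | "card (nb u) = 3"
    using card_nb[OF assms] by linarith
  thus ?thesis
  proof cases
    case 1
    thus ?thesis using nb_singleton[OF assms 1] F_one_neighbour_ge[OF u] by auto
  next
    case 2
    obtain i k where "nb u = {i, k}" "i < k" "k \<le> i + 2" by (rule nb_two[OF assms 2])
    thus ?thesis using F_nb_pair_ge[OF u, of i k] 2 by simp
  next
    case 3
    obtain i where "nb u = {i, Suc i, Suc (Suc i)}" by (rule nb_three[OF assms 3])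
    thus ?thesis using F_nb_triple_ge[OF u, of i] 3 by simp
  qed
qed

text \<open>This finds the end that acts as a leaf. An edge outside \<open>Bad\<close> has an end
  without path neighbours. An edge in \<open>Bad\<close> leaves an excess of at most 1, so one of
  its ends has a single path neighbour.\<close>

lemma E\<^sub>U_end:
  assumes "e \<in> E\<^sub>U"
  obtains x y i where "e = {x, y}" "x \<in> U" "y \<in> U" "adj x y" "nb x = {} \<and> e \<notin> Bad \<or> nb x = {i} \<and> e \<in> Bad" "i \<le> d"
proof -
  obtain x y where e: "e = {x, y}" "x \<in> U" "y \<in> U" "adj x y" "adj y x" "x \<noteq> y"
    using assms by (rule E\<^sub>U_E)
  show ?thesis
  proof (cases "e \<in> Bad")
    case False
    hence "nb x = {} \<or> nb y = {}" using assms e by (auto simp: Bad_def A_def)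
    thus ?thesis using that[of x y 0] that[of y x 0] e False by (auto simp: insert_commute)
  next
    case True
    hence xy: "x \<in> A" "y \<in> A" using e by (auto simp: Bad_def)
    have "card Bad \<ge> 1" using True by (simp add: Suc_le_eq card_gt_0_iff) blast
    hence ex: "excess \<le> 1" using card_Bad by simp
    have "card (nb x) - 1 + (card (nb y) - 1) = (\<Sum>u\<in>{x, y}. card (nb u) - 1)" using e by simp
    also have "\<dots> \<le> excess" unfolding excess_def using xy by (intro sum_mono2) auto
    finally have "card (nb x) = 1 \<or> card (nb y) = 1"
      using ex card_nb(1)[OF xy(1)] card_nb(1)[OF xy(2)] by linarith
    then consider i where "nb x = {i}" "i \<le> d" | i where "nb y = {i}" "i \<le> d"
      using nb_singleton xy by blast
    thus ?thesis
      using that[of x y] that[of y x] e True by cases (auto simp: insert_commute)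
  qed
qed

lemma F_E\<^sub>U_ge:
  assumes "e \<in> E\<^sub>U"
  shows "(if e \<in> Bad then \<alpha> + \<gamma> else \<alpha> + 3 * \<gamma>) \<preceq> F e P"
proof -
  obtain x y i where "e = {x, y}" "x \<in> U" "y \<in> U" "adj x y"
    "nb x = {} \<and> e \<notin> Bad \<or> nb x = {i} \<and> e \<in> Bad" by (rule E\<^sub>U_end[OF assms])
  thus ?thesis
    using F_edge_attached[of x y i] F_edge_free_end[of x y] U_P by auto
qed

lemma F_far_ge:
  assumes "e \<in> E\<^sub>U" "far e w" "card (nb w) = 1"
  shows "\<gamma> \<preceq> F (insert w e) P"
proof -
  obtain x y i where e: "e = {x, y}" "x \<in> U" "y \<in> U" "adj x y" "i \<le> d"
    "nb x = {} \<and> e \<notin> Bad \<or> nb x = {i} \<and> e \<in> Bad" by (rule E\<^sub>U_end[OF assms(1)])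
  have w: "w \<in> A" "w \<notin> P" using assms(2) A_U U_P by (auto simp: far_def)
  obtain j where "nb w = {j}" using nb_singleton[OF w(1) assms(3)] by auto
  thus ?thesis using F_edge_far[of x y i w j] e w U_P assms(2) by (auto simp: far_def)
qed

lemma F_far_pos:
  assumes "e \<in> E\<^sub>U" "far e w"
  shows "\<xi> * \<xi> \<preceq> F (insert w e) P"
proof -
  obtain x y where e: "e = {x, y}" "x \<in> U" "y \<in> U" "adj x y" using assms(1) by (rule E\<^sub>U_E)
  have w: "w \<in> A" "w \<notin> P" using assms(2) A_U U_P by (auto simp: far_def)
  obtain j where "j \<in> nb w" using w by (auto simp: A_def)
  thus ?thesis using F_edge_far_pos[of x y w j] e w U_P assms(2) by (auto simp: far_def)
qed

text \<open>The parameter c is the number of \<gamma> credited to each trace chosen in addition to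
  the vertices of A and the edges of U: 1 in most cases, 2 for pairs containing a vertex with three
  path neighbours.\<close>

definition bound :: "nat \<Rightarrow> nat set \<Rightarrow> int poly" where
  "bound c Y = (if Y = {} then \<phi> (Suc d)
    else if card Y = 1 then \<alpha> + \<gamma> + of_nat (card (nb (the_elem Y)) - 1) * \<beta>
    else if Y \<in> E\<^sub>U then (if Y \<in> Bad then \<alpha> + \<gamma> else \<alpha> + 3 * \<gamma>)
    else of_nat c * \<gamma>)"

definition family :: "nat set set \<Rightarrow> nat set set" where
  "family M = insert {} ((\<lambda>u. {u}) ` A \<union> (E\<^sub>U \<union> M))"

text \<open>Vertices of A and edges of U bring one \<alpha> each, and \<open>card_E\<^sub>U\<close>
  turns their number into \<open>card U + 2 - excess\<close>.\<close>

lemma sum_bound: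
  assumes "M \<subseteq> Pow U" "\<And>Y. Y \<in> M \<Longrightarrow> 2 \<le> card Y \<and> Y \<notin> E\<^sub>U"
  shows "sum (bound c) (family M) = \<phi> (Suc d) + of_nat (card U + 2 - excess) * \<alpha> + of_nat excess * \<beta> +
    of_int (int (card A) + 3 * int (card E\<^sub>U) - 2 * int (card Bad) + int c * int (card M)) * \<gamma>"
proof -
  have finM: "finite M" using assms(1) by (rule finite_subset) simp
  have E2: "card e = 2" if "e \<in> E\<^sub>U" for e using that by (rule card_E\<^sub>U_elem)
  have d1: "{} \<notin> (\<lambda>u. {u}) ` A \<union> (E\<^sub>U \<union> M)" using assms(2) E2 by force
  have d2: "(\<lambda>u. {u}) ` A \<inter> (E\<^sub>U \<union> M) = {}" using assms(2) E2 by force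
  have d3: "E\<^sub>U \<inter> M = {}" using assms(2) by auto
  have inj: "inj_on (\<lambda>u. {u}) A" by (auto simp: inj_on_def)
  have "sum (bound c) (family M) =
      bound c {} + ((\<Sum>u\<in>A. bound c {u}) + (sum (bound c) E\<^sub>U + sum (bound c) M))"
    unfolding family_def using d1 d2 d3 finM
    by (simp add: sum.union_disjoint sum.reindex[OF inj])
  also have "bound c {} = \<phi> (Suc d)" by (simp add: bound_def)
  also have "(\<Sum>u\<in>A. bound c {u}) = (\<Sum>u\<in>A. \<alpha> + \<gamma> + of_nat (card (nb u) - 1) * \<beta>)"
    by (simp add: bound_def)
  also have "\<dots> = of_nat (card A) * (\<alpha> + \<gamma>) + of_nat excess * \<beta>"
    by (simp only: sum.distrib excess_def of_nat_sum sum_distrib_right sum_constant distrib_left)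
  also have "sum (bound c) E\<^sub>U = (\<Sum>e\<in>E\<^sub>U. \<alpha> + 3 * \<gamma> - (if e \<in> Bad then 2 * \<gamma> else 0))"
    by (rule sum.cong) (use E2 E2[of "{}"] in \<open>auto simp: bound_def\<close>)
  also have "\<dots> = of_nat (card E\<^sub>U) * (\<alpha> + 3 * \<gamma>) - of_nat (card Bad) * (2 * \<gamma>)"
  proof -
    have "(\<Sum>e\<in>E\<^sub>U. if e \<in> Bad then 2 * \<gamma> else 0) = (\<Sum>e\<in>Bad. 2 * \<gamma>)"
      by (subst sum.mono_neutral_cong_right[of E\<^sub>U Bad]) (auto simp: Bad_def)
    thus ?thesis by (simp add: sum_subtractf)
  qed
  also have "sum (bound c) M = (\<Sum>Y\<in>M. of_nat c * \<gamma>)"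
    by (rule sum.cong) (use assms(2) in \<open>force simp: bound_def\<close>)+
  also have "\<dots> = of_nat (card M) * (of_nat c * \<gamma>)" by simp
  finally have "sum (bound c) (family M) = \<phi> (Suc d) + (of_nat (card A) * (\<alpha> + \<gamma>) + of_nat excess * \<beta> +
      (of_nat (card E\<^sub>U) * (\<alpha> + 3 * \<gamma>) - of_nat (card Bad) * (2 * \<gamma>) +
      of_nat (card M) * (of_nat c * \<gamma>)))" by (simp only: add.assoc)
  moreover have "card U + 2 - excess = card A + card E\<^sub>U" using card_E\<^sub>U by simp
  ultimately show ?thesis by (simp add: algebra_simps)
qed

text \<open>The trace Y0 carries a surplus p over its bound, or over 0 if it lies outside the
  family. Traces other than Y0 and the members of the family are discarded.\<close>

lemma F_V_ge_family:
  assumes M: "M \<subseteq> Pow U" "\<And>Y. Y \<in> M \<Longrightarrow> 2 \<le> card Y \<and> Y \<notin> E\<^sub>U \<and> of_nat c * \<gamma> \<preceq> F Y P"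
    and Y0: "Y0 \<subseteq> U" "(if Y0 \<in> family M then bound c Y0 else 0) + p \<preceq> F Y0 P"
  shows "sum (bound c) (family M) + p \<preceq> F {} V"
proof -
  have fam: "family M \<subseteq> Pow U" using M(1) A_U E\<^sub>U_Pow by (auto simp: family_def)
  have ge: "bound c Y \<preceq> F Y P" if "Y \<in> family M" for Y
    using that F_single_ge F_E\<^sub>U_ge[of Y] M(2)[of Y] card_E\<^sub>U_elem[of Y] F_path
    by (auto simp: family_def bound_def)
  define g where "g Y = (if Y \<in> family M then bound c Y else 0) + (if Y = Y0 then p else 0)" for Y
  have "sum g (Pow U) = (\<Sum>Y\<in>Pow U. if Y \<in> family M then bound c Y else 0) + p"
    using Y0(1) by (simp add: g_def sum.distrib)
  also have "(\<Sum>Y\<in>Pow U. if Y \<in> family M then bound c Y else 0) = sum (bound c) (family M)"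
    by (rule sum.mono_neutral_cong_right) (use fam in auto)
  finally have "sum (bound c) (family M) + p = sum g (Pow U)" ..
  also have "\<dots> \<preceq> (\<Sum>Y\<in>Pow U. F ({} \<union> Y) P)"
  proof (rule coeff_le_sum)
    fix Y assume "Y \<in> Pow U"
    hence "finite Y" using finite_subset[OF _ finite_U] by auto
    thus "g Y \<preceq> F ({} \<union> Y) P" using ge[of Y] Y0(2) by (auto simp: g_def)
  qed
  also have "\<dots> = F {} (U \<union> P)"
    by (rule F_partition[symmetric]) (auto simp: U_def finite_V)
  also have "U \<union> P = V" using P_V by (auto simp: U_def)
  finally show ?thesis .
qed

text \<open>The polynomial of the extremal graph, written here in terms of \<open>card U\<close>
  alone; its identification with \<open>extremal_poly\<close> is left to the final proof.\<close>

definition target :: "int poly" where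
  "target = \<phi> (Suc d) + of_nat (card U) * \<alpha> + 2 * \<beta> + of_int (3 * int (card U) - 4) * \<gamma>"

text \<open>An excess below 2 leaves an \<alpha> where the target has a \<beta>, which only helps.
  So the comparison reduces to counting the \<gamma>.\<close>

lemma target_le_sum_bound:
  assumes M: "M \<subseteq> Pow U" "\<And>Y. Y \<in> M \<Longrightarrow> 2 \<le> card Y \<and> Y \<notin> E\<^sub>U"
    and "3 * int (card U) - 4 + int m \<le>
      int (card A) + 3 * int (card E\<^sub>U) - 2 * int (card Bad) + int c * int (card M)"
  shows "target + of_nat m * \<gamma> \<preceq> sum (bound c) (family M)"
proof -
  define G where "G = int (card A) + 3 * int (card E\<^sub>U) - 2 * int (card Bad) + int c * int (card M)"
  have ex: "excess \<le> 2" using card_Bad by simp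
  have sb: "sum (bound c) (family M) = \<phi> (Suc d) + of_nat (card U + 2 - excess) * \<alpha> + of_nat excess * \<beta> +
      of_int G * \<gamma>"
    unfolding G_def by (rule sum_bound) (use M in auto)
  have "sum (bound c) (family M) - (target + of_nat m * \<gamma>) =
      of_nat (2 - excess) * (\<alpha> - \<beta>) + of_int (G - (3 * int (card U) - 4 + int m)) * \<gamma>"
    unfolding sb target_def using ex
    by (simp add: of_nat_diff algebra_simps)
  moreover have "0 \<preceq> of_nat (2 - excess) * (\<alpha> - \<beta>)"
    using \<beta>_le_\<alpha> by (intro coeff_le_mult_nonneg) (auto simp: coeff_le_def of_nat_poly coeff_pCons split: nat.split)
  moreover have "0 \<preceq> of_int (G - (3 * int (card U) - 4 + int m)) * \<gamma>"
  proof (rule coeff_le_mult_nonneg)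
    show "0 \<preceq> of_int (G - (3 * int (card U) - 4 + int m))"
      using assms(3) by (auto simp: coeff_le_def of_int_poly G_def coeff_pCons split: nat.split)
  qed simp
  ultimately show ?thesis
    by (subst coeff_le_diff_iff) (auto intro: coeff_le_add_nonneg)
qed

lemma F_V_gt_family:
  assumes M: "M \<subseteq> Pow U" "\<And>Y. Y \<in> M \<Longrightarrow> 2 \<le> card Y \<and> Y \<notin> E\<^sub>U \<and> of_nat c * \<gamma> \<preceq> F Y P"
    and "3 * int (card U) - 3 \<le>
      int (card A) + 3 * int (card E\<^sub>U) - 2 * int (card Bad) + int c * int (card M)"
  shows "target + \<xi> * \<xi> \<preceq> F {} V"
proof -
  have "target + \<xi> * \<xi> \<preceq> target + of_nat 1 * \<gamma>" using \<xi>\<xi>_le_\<gamma> by (simp add: coeff_le_add)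
  also have "\<dots> \<preceq> sum (bound c) (family M)"
    by (rule target_le_sum_bound) (use M assms(3) in auto)
  also have "\<dots> \<preceq> F {} V"
    using F_V_ge_family[OF M, of "{}" 0] F_path by (simp add: family_def bound_def)
  finally show ?thesis .
qed

text \<open>For counts of \<gamma> that are just sufficient: the strictness comes from the surplus
  of one trace instead of a spare \<gamma>.\<close>

lemma F_V_gt_family':
  assumes M: "M \<subseteq> Pow U" "\<And>Y. Y \<in> M \<Longrightarrow> 2 \<le> card Y \<and> Y \<notin> E\<^sub>U \<and> of_nat c * \<gamma> \<preceq> F Y P"
    and "3 * int (card U) - 4 \<le>
      int (card A) + 3 * int (card E\<^sub>U) - 2 * int (card Bad) + int c * int (card M)"
    and "Y0 \<subseteq> U" "(if Y0 \<in> family M then bound c Y0 else 0) + p \<preceq> F Y0 P"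
  shows "target + p \<preceq> F {} V"
proof -
  have "target + of_nat 0 * \<gamma> \<preceq> sum (bound c) (family M)"
    by (rule target_le_sum_bound) (use M assms(3) in auto)
  hence "target + p \<preceq> sum (bound c) (family M) + p" by (simp add: coeff_le_add)
  also have "\<dots> \<preceq> F {} V" by (rule F_V_ge_family) fact+
  finally show ?thesis .
qed

section \<open>The cases \<open>excess\<close> = 0, 1, 2\<close>

lemma card_far:
  assumes "e \<in> E\<^sub>U"
  shows "card A \<le> card {w \<in> A. far e w} + (3 - excess)"
proof -
  have "card A = card {w \<in> A. far e w} + card {w \<in> A. \<not> far e w}"
    by (subst card_Un_disjoint[symmetric]) (auto intro!: arg_cong[where f = card])
  thus ?thesis using card_not_far[OF assms] by linarith
qed

lemma card_insert_far: "e \<in> E\<^sub>U \<Longrightarrow> far e w \<Longrightarrow> card (insert w e) = 3"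
  by (erule E\<^sub>U_E) (auto simp: far_def)

lemma inj_insert_far: "inj_on (\<lambda>w. insert w e) {w \<in> A. far e w}"
  by (rule inj_onI) (auto simp: far_def)

lemma insert_far_U: "e \<in> E\<^sub>U \<Longrightarrow> far e w \<Longrightarrow> insert w e \<subseteq> U"
  using E\<^sub>U_Pow A_U by (auto simp: far_def)

lemma three_notin_E\<^sub>U: "card Y = 3 \<Longrightarrow> Y \<notin> E\<^sub>U"
  using card_E\<^sub>U_elem by fastforce

text \<open>If the edges differed, w would belong to e' and be adjacent to its other end, which lies
  in e; this contradicts \<open>far e w\<close>.\<close>

lemma insert_far_distinct:
  assumes "e \<in> E\<^sub>U" "e' \<in> E\<^sub>U" "far e w" "far e' w'" "insert w e = insert w' e'"
  shows "e = e'"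
proof (rule ccontr)
  assume ne: "e \<noteq> e'"
  obtain x y where e: "e = {x, y}" "x \<in> U" "y \<in> U" "adj x y" "adj y x" "x \<noteq> y"
    using assms(1) by (rule E\<^sub>U_E)
  obtain x' y' where e': "e' = {x', y'}" "x' \<in> U" "y' \<in> U" "adj x' y'" "adj y' x'" "x' \<noteq> y'"
    using assms(2) by (rule E\<^sub>U_E)
  have "w \<in> e'"
  proof (rule ccontr)
    assume "w \<notin> e'"
    hence "w = w'" using assms(5) by auto
    thus False using ne assms(3-5) insert_ident[of w e e'] by (simp add: far_def)
  qed
  then obtain z where z: "z \<in> e'" "z \<noteq> w" "adj w z" using e' by auto
  hence "z \<in> e" using assms(5) by auto
  thus False using assms(3) z by (auto simp: far_def)
qed

text \<open>Triples over two edges of U: each edge misses at most three vertices of A, so at least 2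
  * card A - 6 triples exist and the count of \<gamma> is at least 3 * card U - 2 * card Bad. Only
  two edges in \<open>Bad\<close> use up the reserve, and then one of them has a surplus by
  \<open>F_edge_attached_both\<close>.\<close>

lemma excess_0:
  assumes "excess = 0"
  shows "target + \<xi> * \<xi> \<preceq> F {} V"
proof -
  have one: "card (nb w) = 1" if "w \<in> A" for w
    using card_nb[OF that] assms by simp
  have "2 \<le> card E\<^sub>U" using card_E\<^sub>U card_A_le assms by simp
  then obtain S where "S \<subseteq> E\<^sub>U" "card S = 2" by (rule obtain_subset_with_card_n)
  then obtain e1 e2 where e: "e1 \<in> E\<^sub>U" "e2 \<in> E\<^sub>U" "e1 \<noteq> e2" by (auto simp: card_2_iff)
  define W where "W e = {w \<in> A. far e w}" for e
  define M where "M = (\<lambda>w. insert w e1) ` W e1 \<union> (\<lambda>w. insert w e2) ` W e2"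
  have M: "M \<subseteq> Pow U" using insert_far_U[OF e(1)] insert_far_U[OF e(2)] by (auto simp: M_def W_def)
  have M': "2 \<le> card Y \<and> Y \<notin> E\<^sub>U \<and> of_nat 1 * \<gamma> \<preceq> F Y P" if "Y \<in> M" for Y
  proof -
    from that obtain e w where ew: "e \<in> E\<^sub>U" "far e w" "w \<in> A" "Y = insert w e"
      using e by (auto simp: M_def W_def)
    thus ?thesis using card_insert_far[of e w] three_notin_E\<^sub>U[of Y] F_far_ge[of e w] one by simp
  qed
  have "card M = card (W e1) + card (W e2)"
  proof -
    have "(\<lambda>w. insert w e1) ` W e1 \<inter> (\<lambda>w. insert w e2) ` W e2 = {}"
      using insert_far_distinct[OF e(1,2)] e(3) by (auto simp: W_def)
    thus ?thesis unfolding M_def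
      by (subst card_Un_disjoint) (auto simp: W_def card_image[OF inj_insert_far])
  qed
  hence cM: "2 * card A \<le> card M + 6"
    using card_far[OF e(1)] card_far[OF e(2)] assms by (simp add: W_def)
  have cE: "card E\<^sub>U + card A = card U + 2" and b: "card Bad \<le> 2"
    using card_E\<^sub>U card_Bad assms by auto
  show ?thesis
  proof (cases "card Bad \<le> 1")
    case True
    show ?thesis
      by (rule F_V_gt_family[of M 1]) (use M M' cM cE True in auto)
  next
    case False
    hence b2: "card Bad = 2" using b by simp
    then obtain e where eB: "e \<in> Bad" by fastforce
    hence eE: "e \<in> E\<^sub>U" by (simp add: Bad_def)
    obtain x y where exy: "e = {x, y}" "x \<in> U" "y \<in> U" "adj x y" using eE by (rule E\<^sub>U_E)
    have "x \<in> A" "y \<in> A" using eB exy by (auto simp: Bad_def)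
    then obtain i j where "nb x = {i}" "nb y = {j}" using one nb_singleton by metis
    hence "\<alpha> + \<gamma> + \<xi> * \<xi> \<preceq> F e P"
      using F_edge_attached_both[of x y i j] exy U_P by simp
    moreover have "bound 1 e = \<alpha> + \<gamma>" "e \<in> family M" "e \<subseteq> U"
      using eE eB card_E\<^sub>U_elem[OF eE] exy by (auto simp: bound_def family_def)
    ultimately show ?thesis
      by (intro F_V_gt_family'[of M 1 e]) (use M M' cM cE b2 in auto)
  qed
qed

lemma pair_notin_E\<^sub>U: "\<not> adj w u \<Longrightarrow> {w, u} \<notin> E\<^sub>U"
  using adj_sym by (auto simp: E\<^sub>U_def doubleton_eq_iff)

lemma inj_pair: "inj_on (\<lambda>w. {w, u}) X"
  by (rule inj_onI) (auto simp: doubleton_eq_iff)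

text \<open>The missing \<gamma> come from pairs with the vertex u0 that has two path neighbours,
  and from triples over one edge e.\<close>

lemma excess_1:
  assumes "excess = 1"
  shows "target + \<xi> * \<xi> \<preceq> F {} V"
proof -
  have "sum (\<lambda>u. card (nb u) - 1) A = 1" using assms by (simp add: excess_def)
  then obtain u0 where u0: "u0 \<in> A" "card (nb u0) - 1 = 1"
    "\<forall>w\<in>A. u0 \<noteq> w \<longrightarrow> card (nb w) - 1 = 0"
    using sum_eq_1_iff[of A "\<lambda>u. card (nb u) - 1"] by auto
  have one: "card (nb w) = 1" if "w \<in> A" "w \<noteq> u0" for w
    using card_nb[OF that(1)] u0(3) that by force
  have u0P: "u0 \<notin> P" using u0 A_U U_P by auto
  have "card (nb u0) = 2" using u0 by simp
  then obtain i k where ik: "nb u0 = {i, k}" "i < k" "k \<le> i + 2" by (rule nb_two[OF u0(1)])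
  have cE: "card E\<^sub>U + card A = card U + 1" and b: "card Bad \<le> 1"
    using card_E\<^sub>U card_Bad assms by auto
  have "card E\<^sub>U > 0" using cE card_A_le by simp
  hence "E\<^sub>U \<noteq> {}" by force
  \<comment> \<open>Taking for e the edge in \<open>Bad\<close>, if there is one, lets losses
    compensate: a pair with u0 can fail only if u0 lies on e, and in that case no far vertex has to
    be omitted for being u0.\<close>
  then obtain e where e: "e \<in> E\<^sub>U" "Bad = {} \<or> Bad = {e}"
  proof (cases "Bad = {}")
    case False
    hence "card Bad = 1" using b by (simp add: card_gt_0_iff le_antisym Suc_le_eq)
    then obtain e where "Bad = {e}" by (rule card_1_singletonE)
    thus ?thesis using that[of e] by (auto simp: Bad_def)
  qed auto
  define M1 where "M1 = (\<lambda>w. {w, u0}) ` {w \<in> A - {u0}. \<not> adj w u0}"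
  define M2 where "M2 = (\<lambda>w. insert w e) ` {w \<in> A. far e w \<and> w \<noteq> u0}"
  have M1: "2 \<le> card Y \<and> Y \<notin> E\<^sub>U \<and> of_nat 1 * \<gamma> \<preceq> F Y P \<and> card Y = 2 \<and> Y \<subseteq> U" if "Y \<in> M1" for Y
  proof -
    from that obtain w where w: "w \<in> A" "w \<noteq> u0" "\<not> adj w u0" "Y = {w, u0}" by (auto simp: M1_def)
    obtain j where "nb w = {j}" using nb_singleton one w by blast
    thus ?thesis
      using F_pair_ge[OF u0P, of w j i k] ik w pair_notin_E\<^sub>U A_U U_P u0 by auto
  qed
  have M2: "2 \<le> card Y \<and> Y \<notin> E\<^sub>U \<and> of_nat 1 * \<gamma> \<preceq> F Y P \<and> card Y = 3 \<and> Y \<subseteq> U" if "Y \<in> M2" for Y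
  proof -
    from that obtain w where w: "w \<in> A" "w \<noteq> u0" "far e w" "Y = insert w e" by (auto simp: M2_def)
    thus ?thesis
      using card_insert_far[of e w] three_notin_E\<^sub>U[of Y] F_far_ge[of e w] one insert_far_U e by simp
  qed
  have fin: "finite M1" "finite M2" by (auto simp: M1_def M2_def)
  have "M1 \<inter> M2 = {}" using M1 M2 by force
  hence cM: "card (M1 \<union> M2) = card M1 + card M2" using fin by (simp add: card_Un_disjoint)
  have cM1: "card M1 = card {w \<in> A - {u0}. \<not> adj w u0}"
    unfolding M1_def by (rule card_image[OF inj_pair])
  have cM2: "card M2 = card {w \<in> A. far e w \<and> w \<noteq> u0}"
    unfolding M2_def by (rule card_image) (auto intro: inj_on_subset[OF inj_insert_far])
  have far2: "card A \<le> card {w \<in> A. far e w} + 2" using card_far[OF e(1)] assms by simp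
  have bad_I: "{w, u0} \<in> Bad" if "w \<in> A" "adj w u0" for w
    using that u0 A_U by (auto simp: Bad_def E\<^sub>U_def)
  have cA: "card (A - {u0}) + 1 = card A"
    using card_Suc_Diff1[OF finite_A u0(1)] by linarith
  have farm: "card {w \<in> A. far e w} \<le> card {w \<in> A. far e w \<and> w \<noteq> u0} + 1"
  proof -
    have "{w \<in> A. far e w} \<subseteq> insert u0 {w \<in> A. far e w \<and> w \<noteq> u0}" by auto
    hence "card {w \<in> A. far e w} \<le> card (insert u0 {w \<in> A. far e w \<and> w \<noteq> u0})" by (intro card_mono) auto
    thus ?thesis by (simp add: card_insert_if split: if_splits)
  qed
  have all: "card M1 + 1 = card A" if "\<And>w. w \<in> A \<Longrightarrow> \<not> adj w u0"
  proof -
    have "{w \<in> A - {u0}. \<not> adj w u0} = A - {u0}" using that by auto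
    thus ?thesis using cM1 cA by simp
  qed
  \<comment> \<open>This is the required count 3 * card U - 3 after \<open>cE\<close> has eliminated
    \<open>card E\<^sub>U\<close>.\<close>
  have key: "2 * card A + 2 * card Bad \<le> card M1 + card M2 + 6"
  proof (cases "Bad = {}")
    case True
    hence "card M1 + 1 = card A" using all bad_I by blast
    thus ?thesis using True far2 farm cM2 by simp
  next
    case False
    hence B: "Bad = {e}" using e by simp
    show ?thesis
    proof (cases "u0 \<in> e")
      case True
      have "{w \<in> A. far e w \<and> w \<noteq> u0} = {w \<in> A. far e w}" using True by (auto simp: far_def)
      moreover have "card (A - {u0}) \<le> card {w \<in> A - {u0}. \<not> adj w u0} + 1"
      proof -
        have "e \<subseteq> A" using B by (auto simp: Bad_def)
        have "A - {u0} \<subseteq> {w \<in> A - {u0}. \<not> adj w u0} \<union> (e - {u0})"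
          using bad_I B by auto
        hence "card (A - {u0}) \<le> card ({w \<in> A - {u0}. \<not> adj w u0} \<union> (e - {u0}))"
          using \<open>e \<subseteq> A\<close> by (intro card_mono) (auto intro: finite_subset)
        also have "\<dots> \<le> card {w \<in> A - {u0}. \<not> adj w u0} + card (e - {u0})" by (rule card_Un_le)
        also have "card (e - {u0}) = 1" using True card_E\<^sub>U_elem[OF e(1)] by simp
        finally show ?thesis .
      qed
      ultimately show ?thesis using B far2 cM1 cM2 cA by simp
    next
      case False
      have "\<not> adj w u0" if "w \<in> A" for w using bad_I[OF that] False B by auto
      hence "card M1 + 1 = card A" by (rule all)
      thus ?thesis using B far2 farm cM2 by simp
    qed
  qed
  show ?thesis
  proof (rule F_V_gt_family[of "M1 \<union> M2" 1])
    show "M1 \<union> M2 \<subseteq> Pow U" using M1 M2 by auto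
    show "2 \<le> card Y \<and> Y \<notin> E\<^sub>U \<and> of_nat 1 * \<gamma> \<preceq> F Y P" if "Y \<in> M1 \<union> M2" for Y
      using that M1 M2 by blast
    show "3 * int (card U) - 3 \<le> int (card A) + 3 * int (card E\<^sub>U) - 2 * int (card Bad) +
        int 1 * int (card (M1 \<union> M2))"
      using key cE cM by simp
  qed
qed

text \<open>Each of the card A - 1 pairs with u0 is worth two \<gamma>, which with \<open>cE\<close>
  gives 3 * card U - 2 of them, more than needed.\<close>

lemma excess_2_triple:
  assumes "excess = 2" "u0 \<in> A" "card (nb u0) = 3" "\<And>w. w \<in> A \<Longrightarrow> w \<noteq> u0 \<Longrightarrow> card (nb w) = 1"
  shows "target + \<xi> * \<xi> \<preceq> F {} V"
proof -
  obtain i where i: "nb u0 = {i, Suc i, Suc (Suc i)}" by (rule nb_three[OF assms(2,3)])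
  have cE: "card E\<^sub>U + card A = card U" and b: "Bad = {}"
    using card_E\<^sub>U card_Bad assms by auto
  have u0: "u0 \<notin> P" "u0 \<in> U" using assms A_U U_P by auto
  define M where "M = (\<lambda>w. {w, u0}) ` (A - {u0})"
  have M: "2 \<le> card Y \<and> Y \<notin> E\<^sub>U \<and> of_nat 2 * \<gamma> \<preceq> F Y P \<and> Y \<subseteq> U" if "Y \<in> M" for Y
  proof -
    from that obtain w where w: "w \<in> A" "w \<noteq> u0" "Y = {w, u0}" by (auto simp: M_def)
    have nadj: "\<not> adj w u0"
    proof
      assume "adj w u0"
      hence "{w, u0} \<in> Bad" using w assms A_U by (auto simp: Bad_def E\<^sub>U_def)
      thus False using b by simp
    qed
    obtain j where "nb w = {j}" using nb_singleton assms(4) w by blast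
    thus ?thesis
      using F_pair_triple[OF u0(1), of w j i] i w nadj pair_notin_E\<^sub>U A_U U_P u0 by auto
  qed
  have "card M = card (A - {u0})" unfolding M_def by (rule card_image[OF inj_pair])
  hence "card M + 1 = card A" using card_Suc_Diff1[OF finite_A assms(2)] by linarith
  hence "3 * int (card U) - 3 \<le> int (card A) + 3 * int (card E\<^sub>U) - 2 * int (card Bad) +
      int 2 * int (card M)" using cE b by simp
  thus ?thesis
    by (intro F_V_gt_family[of M 2]) (use M in auto)
qed

text \<open>
  The last alternative describes \<open>B\<^sub>n\<^sub>,\<^sub>d\<close>: \<open>u1\<close>, \<open>u2\<close> and \<open>v (i + 1)\<close> are the three vertices of
  degree two of \<open>K\<^sub>2\<^sub>,\<^sub>3\<close>, and the other vertices of \<open>U\<close> are pendent at \<open>v j\<close>, next to an end of the path.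
\<close>

lemma excess_2_pairs:
  assumes ex: "excess = 2" and u: "u1 \<in> A" "u2 \<in> A" "u1 \<noteq> u2" "card (nb u1) = 2" "card (nb u2) = 2"
    and one: "\<And>w. w \<in> A \<Longrightarrow> w \<noteq> u1 \<Longrightarrow> w \<noteq> u2 \<Longrightarrow> card (nb w) = 1"
  shows "target + \<xi> * \<xi> \<preceq> F {} V \<or> target + \<xi> * (\<xi> * \<xi>) \<preceq> F {} V \<or>
    (\<exists>i j. E\<^sub>U = {} \<and> nb u1 = {i, i + 2} \<and> nb u2 = {i, i + 2} \<and>
      (\<forall>w\<in>U - {u1, u2}. nb w = {j}) \<and> (i = 1 \<and> j = 1 \<or> i + 3 = d \<and> j = d - 1))"
proof (rule ccontr)
  assume "\<not> ?thesis"
  hence no2: "\<not> target + \<xi> * \<xi> \<preceq> F {} V" and no3: "\<not> target + \<xi> * (\<xi> * \<xi>) \<preceq> F {} V"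
    and nos: "\<And>i j. E\<^sub>U = {} \<Longrightarrow> nb u1 = {i, i + 2} \<Longrightarrow> nb u2 = {i, i + 2} \<Longrightarrow>
      \<forall>w\<in>U - {u1, u2}. nb w = {j} \<Longrightarrow> i = 1 \<and> j = 1 \<or> i + 3 = d \<and> j = d - 1 \<Longrightarrow> False"
    by blast+
  have cE: "card E\<^sub>U + card A = card U" and b: "Bad = {}"
    using card_E\<^sub>U card_Bad ex by auto
  have uU: "u1 \<in> U" "u2 \<in> U" "u1 \<notin> P" "u2 \<notin> P" using u A_U U_P by auto
  have nadj: "\<not> adj w w'" if "w \<in> A" "w' \<in> A" for w w'
  proof
    assume "adj w w'"
    hence "{w, w'} \<in> Bad" using that A_U by (auto simp: Bad_def E\<^sub>U_def)
    thus False using b by simp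
  qed
  have pairE: "{w, w'} \<notin> E\<^sub>U" if "w \<in> A" "w' \<in> A" for w w'
    using pair_notin_E\<^sub>U nadj that by blast
  define S where "S = A - {u1, u2}"
  have S: "w \<in> A" "w \<in> U" "w \<notin> P" "w \<noteq> u1" "w \<noteq> u2" "\<exists>j. nb w = {j}" if "w \<in> S" for w
  proof -
    show w: "w \<in> A" "w \<noteq> u1" "w \<noteq> u2" using that by (auto simp: S_def)
    thus "w \<in> U" "w \<notin> P" using A_U U_P by auto
    show "\<exists>j. nb w = {j}" using nb_singleton[OF w(1) one[OF w]] by blast
  qed
  obtain i k where ik: "nb u1 = {i, k}" "i < k" "k \<le> i + 2" "k \<le> d" by (rule nb_two[OF u(1,4)])
  obtain i' k' where ik': "nb u2 = {i', k'}" "i' < k'" "k' \<le> i' + 2" "k' \<le> d" by (rule nb_two[OF u(2,5)])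
  define M where "M = (\<lambda>w. {w, u1}) ` S \<union> (\<lambda>w. {w, u2}) ` S"
  have M: "2 \<le> card Y \<and> Y \<notin> E\<^sub>U \<and> of_nat 1 * \<gamma> \<preceq> F Y P \<and> Y \<subseteq> U \<and> card Y = 2" if "Y \<in> M" for Y
  proof -
    from that consider w where "w \<in> S" "Y = {w, u1}" | w where "w \<in> S" "Y = {w, u2}"
      by (auto simp: M_def)
    thus ?thesis
    proof cases
      case 1
      obtain j where "nb w = {j}" using S(6)[OF 1(1)] by blast
      thus ?thesis
        using F_pair_ge[OF uU(3), of w j i k] ik 1 nadj pairE uU u S[OF 1(1)] by simp
    next
      case 2
      obtain j where "nb w = {j}" using S(6)[OF 2(1)] by blast
      thus ?thesis
        using F_pair_ge[OF uU(4), of w j i' k'] ik' 2 nadj pairE uU u S[OF 2(1)] by simp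
    qed
  qed
  have MU: "M \<subseteq> Pow U" using M by blast
  have "card M = 2 * card S"
  proof -
    have "(\<lambda>w. {w, u1}) ` S \<inter> (\<lambda>w. {w, u2}) ` S = {}"
      using u(3) S(4,5) by (auto simp: doubleton_eq_iff)
    thus ?thesis unfolding M_def
      by (subst card_Un_disjoint) (auto simp: S_def card_image[OF inj_pair])
  qed
  moreover have "card S + 2 = card A"
  proof -
    have "card (A - {u1, u2}) = card A - card {u1, u2}" using u by (intro card_Diff_subset) auto
    moreover have "card {u1, u2} \<le> card A" using u by (intro card_mono) auto
    ultimately show ?thesis using u(3) by (simp add: S_def)
  qed
  ultimately have cnt: "3 * int (card U) - 4 \<le> int (card A) + 3 * int (card E\<^sub>U) - 2 * int (card Bad) +
      int 1 * int (card M)" using cE b by simp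
  \<comment> \<open>The count \<open>cnt\<close> holds with equality, so there is no reserve, but
    any surplus in a single trace contradicts \<open>no2\<close> or \<open>no3\<close>. Each
    deviation from the extremal shape below is refuted by exhibiting such a trace.\<close>
  have no: "\<not> (if Y \<in> family M then bound 1 Y else 0) + p \<preceq> F Y P"
    if "Y \<subseteq> U" "p = \<xi> * \<xi> \<or> p = \<xi> * (\<xi> * \<xi>)" for Y p
  proof
    assume "(if Y \<in> family M then bound 1 Y else 0) + p \<preceq> F Y P"
    hence "target + p \<preceq> F {} V"
      by (intro F_V_gt_family'[of M 1 Y]) (use M MU cnt that in auto)
    thus False using no2 no3 that by auto
  qed
  have new: "\<not> p \<preceq> F Y P" if "Y \<subseteq> U" "Y \<notin> family M" "p = \<xi> * \<xi> \<or> p = \<xi> * (\<xi> * \<xi>)" for Y p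
    using no[OF that(1,3)] that(2) by simp
  have single: "\<not> \<alpha> + \<gamma> + of_nat (card (nb w) - 1) * \<beta> + p \<preceq> F {w} P"
    if "w \<in> A" "p = \<xi> * \<xi> \<or> p = \<xi> * (\<xi> * \<xi>)" for w p
    using no[of "{w}" p] that A_U by (auto simp: family_def bound_def)
  \<comment> \<open>An edge e inside U would miss at most one vertex of A, which has at least two.
    The resulting triple lies outside the family and has a positive share.\<close>
  have E0: "E\<^sub>U = {}"
  proof (rule ccontr)
    assume "E\<^sub>U \<noteq> {}"
    then obtain e where e: "e \<in> E\<^sub>U" by auto
    have "card A \<le> card {w \<in> A. far e w} + 1" using card_far[OF e] ex by simp
    hence "card {w \<in> A. far e w} > 0" using \<open>card S + 2 = card A\<close> by simp
    then obtain w where w: "far e w" by (auto simp: card_gt_0_iff)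
    have c3: "card (insert w e) = 3" using card_insert_far[OF e w] .
    have "insert w e \<noteq> {x}" for x
    proof
      assume "insert w e = {x}"
      with c3 show False by simp
    qed
    moreover have "insert w e \<notin> M" using M[of "insert w e"] c3 by auto
    ultimately have "insert w e \<notin> family M"
      using three_notin_E\<^sub>U[OF c3] by (auto simp: family_def)
    thus False using new[of "insert w e" "\<xi> * \<xi>"] insert_far_U[OF e w] F_far_pos[OF e w] by auto
  qed
  have AU: "A = U" using cE E0 card_subset_eq[OF finite_U A_U] by simp
  have newp: "{w, w'} \<notin> family M" if "w \<noteq> w'" "w \<notin> {u1, u2} \<and> w' \<notin> {u1, u2} \<or> {w, w'} = {u1, u2}" for w w'
    using that S(4,5) E0 by (auto simp: family_def M_def doubleton_eq_iff)
  \<comment> \<open>The pair of u1 and u2 is outside the family and would contribute if one of them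
    had a path neighbour that the other lacks.\<close>
  have same: "nb u2 = nb u1"
  proof (rule ccontr)
    assume "nb u2 \<noteq> nb u1"
    then obtain x where x: "x \<in> nb u1" "x \<notin> nb u2"
      using u(4,5) card_subset_eq[of "nb u2" "nb u1"] by auto
    have "\<xi> * \<xi> \<preceq> F {u2, u1} P"
      by (rule F_pair_pos[of u1 u2 i' x]) (use uU u ik' x nadj in auto)
    thus False using new[of "{u2, u1}" "\<xi> * \<xi>"] newp[of u2 u1] uU u insert_commute[of u2 u1 "{}"] by auto
  qed
  have ks: "k = i + 2"
  proof (rule ccontr)
    assume "k \<noteq> i + 2"
    hence "k = Suc i" using ik by simp
    hence "\<alpha> + \<gamma> + \<beta> + \<xi> * \<xi> \<preceq> F {u1} P"
      using F_nb_pair_adjacent[OF uU(3), of i] ik by simp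
    thus False using single[OF u(1), of "\<xi> * \<xi>"] u(4) by simp
  qed
  have wj: "j = i \<or> j = i + 2" if "w \<in> S" "nb w = {j}" for w j
  proof (rule ccontr)
    assume "\<not> ?thesis"
    hence "\<gamma> + \<xi> * \<xi> \<preceq> F {w, u1} P"
      using F_pair_other[OF uU(3), of w j i k] S[OF that(1)] nadj u ik ks that(2) by auto
    moreover have "{w, u1} \<in> family M" "bound 1 {w, u1} = \<gamma>"
      using that S(4)[OF that(1)] E0 by (auto simp: family_def M_def bound_def)
    ultimately show False using no[of "{w, u1}" "\<xi> * \<xi>"] S(2)[OF that(1)] uU by auto
  qed
  \<comment> \<open>Any other attachment has a surplus, \<xi> * \<xi> at the ends of the path and
    \<xi> * (\<xi> * \<xi>) in its interior.\<close>
  have wends: "j = 1 \<or> j = d - 1" if "w \<in> S" "nb w = {j}" for w j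
  proof -
    have "j \<le> d" using that(2) nb_le by blast
    have s: "\<not> \<alpha> + \<gamma> + p \<preceq> F {w} P" if "p = \<xi> * \<xi> \<or> p = \<xi> * (\<xi> * \<xi>)" for p
      using single[OF S(1)[OF \<open>w \<in> S\<close>] that] \<open>nb w = {j}\<close> by simp
    have "\<not> (j = 0 \<or> j = d)" using s F_one_neighbour_end[OF S(3)[OF that(1)] that(2)] by blast
    moreover have "\<not> (2 \<le> j \<and> j + 2 \<le> d)"
      using s F_one_neighbour_inner[OF S(3)[OF that(1)] that(2)] by blast
    ultimately show ?thesis using \<open>j \<le> d\<close> by auto
  qed
  have "d = 3 \<or> i = 1 \<or> i + 3 = d"
  proof (rule ccontr)
    assume c: "\<not> ?thesis"
    have s: "\<not> \<alpha> + \<gamma> + \<beta> + p \<preceq> F {u1} P" if "p = \<xi> * \<xi> \<or> p = \<xi> * (\<xi> * \<xi>)" for p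
      using single[OF u(1) that] u(4) by simp
    have nb: "nb u1 = {i, i + 2}" using ik ks by simp
    have "4 \<le> d" using c d3 by auto
    hence "\<not> (i = 0 \<or> i + 2 = d)" using s F_nb_pair_apart_end[OF uU(3) nb] by blast
    moreover have "\<not> (2 \<le> i \<and> i + 4 \<le> d)" using s F_nb_pair_apart_inner[OF uU(3) nb] by blast
    ultimately show False using c ik ks by auto
  qed
  \<comment> \<open>For d = 3 the condition i + 2 \<le> d leaves only i = 0 and i = 1, which satisfy
    one alternative each.\<close>
  hence i13: "i = 1 \<or> i + 3 = d" using ik ks by auto
  have US: "U - {u1, u2} = S" using AU by (simp add: S_def)
  have "\<exists>j. (\<forall>w\<in>S. nb w = {j}) \<and> (i = 1 \<and> j = 1 \<or> i + 3 = d \<and> j = d - 1)"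
  proof (cases "S = {}")
    case True
    thus ?thesis using i13 by auto
  next
    case False
    then obtain w j where w: "w \<in> S" "nb w = {j}" using S(6) by blast
    have "nb w' = {j}" if w': "w' \<in> S" for w'
    proof (rule ccontr)
      assume ne: "nb w' \<noteq> {j}"
      obtain j' where j': "nb w' = {j'}" using S(6)[OF w'] by blast
      have "w \<noteq> w'" "j \<noteq> j'" using ne w j' by auto
      hence "\<xi> * \<xi> \<preceq> F {w, w'} P"
        using F_pair_pos[of w' w j j'] S(3)[OF w(1)] S(3)[OF w'] nadj[OF S(1)[OF w(1)] S(1)[OF w']] w j'
        by auto
      thus False
        using new[of "{w, w'}" "\<xi> * \<xi>"] newp[of w w'] S(2,4,5)[OF w(1)] S(2,4,5)[OF w'] \<open>w \<noteq> w'\<close> by auto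
    qed
    \<comment> \<open>Here j lies both in {i, i + 2} and in {1, d - 1}. For d = 4 and i = 1 either
      value of j is possible and decides which alternative holds.\<close>
    moreover have "i = 1 \<and> j = 1 \<or> i + 3 = d \<and> j = d - 1"
      using wj[OF w] wends[OF w] ik ks d3 by auto
    ultimately show ?thesis by blast
  qed
  then obtain j where j: "\<forall>w\<in>U - {u1, u2}. nb w = {j}" "i = 1 \<and> j = 1 \<or> i + 3 = d \<and> j = d - 1"
    unfolding US by blast
  have "nb u1 = {i, i + 2}" "nb u2 = {i, i + 2}" using ik ks same by auto
  from nos[OF E0 this j] show False .
qed

theorem F_V_gt_or_extremal:
  "target + \<xi> * \<xi> \<preceq> F {} V \<or> target + \<xi> * (\<xi> * \<xi>) \<preceq> F {} V \<or>
    (\<exists>u1 u2 i j. u1 \<in> U \<and> u2 \<in> U \<and> u1 \<noteq> u2 \<and> E\<^sub>U = {} \<and> nb u1 = {i, i + 2} \<and> nb u2 = {i, i + 2} \<and>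
      (\<forall>w\<in>U - {u1, u2}. nb w = {j}) \<and> (i = 1 \<and> j = 1 \<or> i + 3 = d \<and> j = d - 1))"
proof -
  have one: "card (nb w) = 1" if "w \<in> A" "card (nb w) - 1 = 0" for w
    using card_nb(1)[OF that(1)] that(2) by simp
  have "excess \<le> 2" using card_Bad by simp
  then consider "excess = 0" | "excess = 1" | "excess = 2" by linarith
  thus ?thesis
  proof cases
    case 3
    hence "sum (\<lambda>u. card (nb u) - 1) A = 2" by (simp add: excess_def)
    with finite_A show ?thesis
    proof (cases rule: nat_sum_eq_2_cases)
      case (1 u0)
      thus ?thesis using excess_2_triple[OF 3, of u0] one by auto
    next
      case (2 u1 u2)
      have c: "card (nb u1) = 2" "card (nb u2) = 2" using 2 by simp_all
      have "card (nb w) = 1" if "w \<in> A" "w \<noteq> u1" "w \<noteq> u2" for w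
        using one 2(6) that by blast
      from excess_2_pairs[OF 3 2(1-3) c this] show ?thesis using A_U 2(1-3) by blast
    qed
  qed (use excess_0 excess_1 in blast)+
qed

end

section \<open>The graph \<open>B\<^sub>n\<^sub>,\<^sub>d\<close>\<close>

definition skew_sign :: "nat pair_pre_digraph \<Rightarrow> nat \<Rightarrow> nat \<Rightarrow> int" where
  "skew_sign H i j = (if (i, j) \<in> parcs H then 1 else if (j, i) \<in> parcs H then -1 else 0)"

lemma parcs_orientation:
  assumes "orientation G H"
  shows "(i, j) \<in> parcs G \<longleftrightarrow> (i, j) \<in> parcs H \<or> (j, i) \<in> parcs H"
proof -
  have "parcs G = parcs (mk_symmetric (with_proj H))" using assms by (simp add: orientation_def)
  thus ?thesis
    by (auto simp: parcs_mk_symmetric intro: bexI[of _ "(i, j)"] bexI[of _ "(j, i)"])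
qed

lemma orientation_asym: "orientation G H \<Longrightarrow> (i, j) \<in> parcs H \<Longrightarrow> (j, i) \<notin> parcs H"
  by (auto simp: orientation_def dest: asymD)

lemma skew_sign_matrix_orientation:
  assumes "orientation G H"
  shows "skew_sign_matrix (skew_sign H)"
proof
  show "skew_sign H i j = - skew_sign H j i" for i j
    using orientation_asym[OF assms, of i j] orientation_asym[OF assms, of i i]
    by (auto simp: skew_sign_def)
  show "skew_sign H i j \<in> {-1, 0, 1}" for i j by (simp add: skew_sign_def)
qed

lemma adj_skew_sign:
  assumes "orientation G H"
  shows "skew_sign_matrix.adj (skew_sign H) i j \<longleftrightarrow> (i, j) \<in> parcs G"
  using parcs_orientation[OF assms]
  by (auto simp: skew_sign_matrix.adj_def[OF skew_sign_matrix_orientation[OF assms]] skew_sign_def)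

lemma skew_coeff_eq_coeff_minor_poly:
  assumes "2 * i \<le> n"
  shows "skew_coeff n H (2 * i) = coeff (minor_poly (skew_sign H) {} {..<n}) (2 * i)"
proof -
  have "skew_adjacency n H = mat n n (\<lambda>(i, j). skew_sign H i j)"
    by (simp add: skew_adjacency_def skew_sign_def)
  hence "skew_coeff n H (2 * i) = (\<Sum>Z | Z \<subseteq> {..<n} \<and> card Z = 2 * i. principal_minor (skew_sign H) Z)"
    using coeff_char_poly_principal_minors[OF assms, of "skew_sign H"] by (simp add: skew_coeff_def)
  also have "\<dots> = (\<Sum>Z\<in>Pow {..<n}. if card Z = 2 * i then principal_minor (skew_sign H) Z else 0)"
    by (rule sum.mono_neutral_cong_left) auto
  also have "\<dots> = coeff (minor_poly (skew_sign H) {} {..<n}) (2 * i)"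
    by (simp add: minor_poly_def coeff_sum)
  finally show ?thesis .
qed

text \<open>Used with N = n - d - 1, the number of vertices off a path with d edges, and shaped so
  as to agree with \<open>target\<close>.\<close>

definition extremal_poly :: "nat \<Rightarrow> nat \<Rightarrow> int poly" where
  "extremal_poly d N = \<phi> (Suc d) + of_nat N * (\<xi> * \<phi> (d - 2)) + 2 * (\<xi> * \<phi> (d - 3)) +
    of_int (3 * int N - 4) * (\<xi> * (\<xi> * \<phi> (d - 3)))"

lemma in_symcl_iff: "(i, j) \<in> symcl r \<longleftrightarrow> (i, j) \<in> r \<or> (j, i) \<in> r"
  unfolding symcl_def by auto

lemma parcs_B:
  "(i, j) \<in> parcs (B n d) \<longleftrightarrow>
    (let E = {0, 1} \<times> {2, 3, 4} \<union> {(B_path_vertex k, B_path_vertex (Suc k)) | k. k < d - 3} \<union> {1} \<times> {d + 2..<n}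
     in (i, j) \<in> E \<or> (j, i) \<in> E)"
proof -
  have "parcs (B n d) = symcl ({0, 1} \<times> {2, 3, 4} \<union>
      {(B_path_vertex k, B_path_vertex (Suc k)) | k. k < d - 3} \<union> {1} \<times> {d + 2..<n})"
    by (simp add: B_def)
  thus ?thesis unfolding Let_def by (simp only: in_symcl_iff)
qed

text \<open>That the 4-cycle 0, a, 1, b is evenly oriented means that the rows of a and b agree up
  to a common sign in the columns 0 and 1, where all their nonzero entries are.\<close>

lemma B_even_orientation_twins:
  assumes dn: "3 \<le> d" "d + 3 \<le> n" and H: "B_even_orientation n d H"
    and ab: "a \<in> {2, 3, 4}" "b \<in> {2, 3, 4}" "a \<noteq> b"
  shows "\<exists>c. \<forall>j. skew_sign H a j = c * skew_sign H b j"
proof -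
  have o: "orientation (B n d) H" using H by (simp add: B_even_orientation_def)
  note asym = orientation_asym[OF o]
  note sym = parcs_orientation[OF o]
  have arcs: "(0, t) \<in> parcs (B n d)" "(t, 0) \<in> parcs (B n d)" "(1, t) \<in> parcs (B n d)" "(t, 1) \<in> parcs (B n d)"
    if "t \<in> {2, 3, 4}" for t
    using that by (auto simp: parcs_B Let_def)
  define p where "p = [(0, a), (a, 1), (1, b), (b, 0)]"
  have "is_cycle (B n d) p"
    unfolding is_cycle_def pre_digraph.cycle_def pre_digraph.awalk_def cas_with_proj_eq
      awalk_verts_with_proj_eq
    using arcs ab dn by (auto simp: p_def B_def intro!: exI[of _ 0])
  moreover have "length p = 4" by (simp add: p_def)
  ultimately have "even (length (filter (\<lambda>e. e \<in> parcs H) p))"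
    using H unfolding B_even_orientation_def evenly_oriented_def by blast
  hence ev: "even ((if (0, a) \<in> parcs H then 1 else 0) + (if (a, 1) \<in> parcs H then 1 else 0) +
      (if (1, b) \<in> parcs H then 1 else 0) + (if (b, 0) \<in> parcs H then 1 else (0::nat)))"
    by (simp add: p_def split: if_splits)
  have or: "((t, z) \<in> parcs H) \<noteq> ((z, t) \<in> parcs H)" if "t \<in> {2, 3, 4}" "z = 0 \<or> z = 1" for t z
    using that arcs[OF that(1)] asym sym by metis
  \<comment> \<open>Both entries are 1 or -1, so their product is also their quotient.\<close>
  define c where "c = skew_sign H a 0 * skew_sign H b 0"
  have c0: "skew_sign H a 0 = c * skew_sign H b 0" and c1: "skew_sign H a 1 = c * skew_sign H b 1"
    using or[OF ab(1), of 0] or[OF ab(1), of 1] or[OF ab(2), of 0] or[OF ab(2), of 1] ev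
    by (auto simp: c_def skew_sign_def split: if_splits)
  have other: "skew_sign H t j = 0" if "t \<in> {2, 3, 4}" "j \<noteq> 0" "j \<noteq> 1" for t j
  proof -
    have "(t, j) \<notin> parcs (B n d)"
      using that dn by (auto simp: parcs_B Let_def B_path_vertex_def split: if_splits)
    thus ?thesis using sym by (auto simp: skew_sign_def)
  qed
  have "skew_sign H a j = c * skew_sign H b j" for j
    using c0 c1 other[OF ab(1), of j] other[OF ab(2), of j] by (cases "j = 0"; cases "j = 1") auto
  thus ?thesis by blast
qed

text \<open>A contributing vertex set contains at most one of the twins 2, 3, 4. Without a twin the
  graph falls apart into a path on d - 2 vertices and a star centred at 1; one twin joins them by an
  edge to each. All these pieces are trees, so leaf deletion evaluates them.\<close>

lemma minor_poly_B:
  assumes dn: "3 \<le> d" "d + 3 \<le> n" and H: "B_even_orientation n d H"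
  shows "minor_poly (skew_sign H) {} {..<n} = extremal_poly d (n - d - 1)"
proof -
  have o: "orientation (B n d) H" using H by (simp add: B_even_orientation_def)
  interpret skew_sign_matrix "skew_sign H" by (rule skew_sign_matrix_orientation[OF o])
  have adj: "adj i j \<longleftrightarrow> (i, j) \<in> parcs (B n d)" for i j by (rule adj_skew_sign[OF o])
  define e where "e = d - 3"
  define w where "w = n - d - 2"
  have d: "d = Suc (Suc (Suc e))" using dn by (simp add: e_def)
  have n: "n = d + 2 + w" using dn by (simp add: w_def)
  define L where "L = {d + 2..<n}"
  define Q where "Q = B_path_vertex ` {..<Suc e}"
  define T where "T = {2, 3, 4 :: nat}"
  have Qeq: "Q = insert 0 {5..<d + 2}"
  proof -
    have de: "Suc e + 4 = d + 2" by (simp add: d)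
    have "(\<lambda>k. k + 4) ` {1..<Suc e} = {1 + 4..<Suc e + 4}" by (rule image_add_atLeastLessThan')
    hence "{5..<d + 2} = (\<lambda>k. k + 4) ` {1..<Suc e}" unfolding de by simp
    moreover have "{..<Suc e} = insert 0 {1..<Suc e}" by auto
    moreover have "B_path_vertex ` {1..<Suc e} = (\<lambda>k. k + 4) ` {1..<Suc e}"
      by (rule image_cong) (auto simp: B_path_vertex_def)
    moreover have "B_path_vertex 0 = 0" by (simp add: B_path_vertex_def)
    ultimately show ?thesis unfolding Q_def by (simp only: image_insert)
  qed
  have V: "{..<n} = T \<union> (insert 1 Q \<union> L)"
    using dn unfolding Qeq T_def L_def by auto
  have finL: "finite L" "finite Q" "finite T" by (auto simp: L_def Q_def T_def)
  have cardL: "card L = w" by (simp add: L_def n)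
  have pathQ: "path_on B_path_vertex (Suc e)"
    unfolding path_on_def adj by (auto simp: parcs_B Let_def B_path_vertex_def d split: if_splits)
  have adj1: "adj 1 x \<longleftrightarrow> x \<in> T \<union> L" "adj x 1 \<longleftrightarrow> x \<in> T \<union> L" for x
    unfolding adj by (auto simp: parcs_B Let_def B_path_vertex_def T_def L_def split: if_splits)
  have adjL: "adj x y \<longleftrightarrow> y = 1" if "x \<in> L" for x y
    using that unfolding adj by (auto simp: parcs_B Let_def B_path_vertex_def L_def d split: if_splits)
  have adjT: "adj a x \<longleftrightarrow> x = 0 \<or> x = 1" if "a \<in> T" for a x
    using that unfolding adj by (auto simp: parcs_B Let_def B_path_vertex_def T_def d split: if_splits)
  have FQ: "F {} Q = \<phi> (Suc e)"
    using F_isolated_path[of "{}" "{}" B_path_vertex "Suc e"] pathQ by (simp add: Q_def)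
  have Q1: "1 \<notin> Q" by (auto simp: Qeq)
  have LQ: "L \<inter> insert 1 Q = {}" by (auto simp: Qeq L_def)
  have L1: "1 \<notin> L" by (auto simp: L_def)
  have "F {} (insert 1 Q) = F {} Q"
    by (rule F_isolated) (use finL Q1 in \<open>auto simp: Qeq adj1 T_def L_def simp del: One_nat_def\<close>)
  with FQ have F1Q: "F {} (insert 1 Q) = \<phi> (Suc e)" by simp
  have "F {} (insert 1 Q \<union> L) = F {} (insert 1 Q) + of_nat (card L) * (\<xi> * F {} Q)"
    by (rule F_star(1)) (use finL Q1 LQ L1 in \<open>auto simp: adjL simp del: One_nat_def\<close>)
  hence W: "F {} (insert 1 Q \<union> L) = \<phi> (Suc e) + of_nat w * (\<xi> * \<phi> (Suc e))"
    by (simp only: F1Q FQ cardL)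
  have Wa: "F {a} (insert 1 Q \<union> L) = \<xi> * \<phi> e + \<xi> * \<phi> (Suc e) + of_nat w * (\<xi> * (\<xi> * \<phi> e))"
    if a: "a \<in> T" for a
  proof -
    have aQ: "a \<notin> insert 1 Q \<union> L" using a by (auto simp: T_def Qeq L_def d)
    have "F {a} ({} \<union> B_path_vertex ` {..<Suc e}) = \<phi> (Suc e) * F {a} {} + \<xi> * \<psi> (Suc e) * F ({a} - {a}) {}"
    proof (rule F_attached_path)
      show "B_path_vertex i \<notin> {a} \<union> {}" for i using a by (auto simp: T_def B_path_vertex_def)
      show "adj (B_path_vertex i) x \<longleftrightarrow> i = 0 \<and> x = a" if "x \<in> {a} \<union> {}" for i x
        using that adj_sym[of "B_path_vertex i" x] adjT[OF a] by (auto simp: B_path_vertex_def)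
    qed (use pathQ in auto)
    moreover have "F {a} {} = 0" by (rule F_zero[of _ _ a]) auto
    ultimately have aQ': "F {a} Q = \<xi> * \<phi> e" by (simp add: Q_def)
    have "F {a} (insert 1 Q) = F {a} Q + \<xi> * F ({a} - {a}) Q"
      by (rule F_leaf_outer) (use aQ finL a Q1 in \<open>auto simp: adj1 T_def Qeq L_def simp del: One_nat_def\<close>)
    hence a1Q: "F {a} (insert 1 Q) = \<xi> * \<phi> e + \<xi> * \<phi> (Suc e)" using aQ' FQ by simp
    have "F {a} (insert 1 Q \<union> L) = F {a} (insert 1 Q) + of_nat (card L) * (\<xi> * F {a} Q)"
      by (rule F_star(1)) (use aQ finL Q1 LQ L1 in \<open>auto simp: adjL simp del: One_nat_def\<close>)
    thus ?thesis by (simp only: a1Q aQ' cardL)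
  qed
  have "F {} {..<n} = F {} (insert 1 Q \<union> L) + (\<Sum>a\<in>T. F {a} (insert 1 Q \<union> L))"
    unfolding V
  proof (rule F_twins)
    show "T \<inter> (insert 1 Q \<union> L) = {}" by (auto simp: T_def Qeq L_def d)
    show "\<exists>c. \<forall>j\<in>T \<union> (insert 1 Q \<union> L). skew_sign H a j = c * skew_sign H b j"
      if "a \<in> T" "b \<in> T" "a \<noteq> b" for a b
      using B_even_orientation_twins[OF dn H, of a b] that unfolding T_def by blast
  qed (use finL in auto)
  also have "\<dots> = \<phi> (Suc e) + of_nat w * (\<xi> * \<phi> (Suc e)) +
      3 * (\<xi> * \<phi> e + \<xi> * \<phi> (Suc e) + of_nat w * (\<xi> * (\<xi> * \<phi> e)))"
    using Wa W by (simp add: T_def)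
  also have "\<dots> = extremal_poly d (w + 1)"
    unfolding extremal_poly_def d by (simp add: algebra_simps)
  also have "w + 1 = n - d - 1" using dn by (simp add: w_def)
  finally show ?thesis .
qed

section \<open>Recognising the extremal graph up to isomorphism\<close>

lemma digraph_iso_pair_digraphI:
  assumes "pair_wf_digraph G" "inj_on h (pverts G)" "h ` pverts G = pverts G'"
    "map_prod h h ` parcs G = parcs G'"
  shows "digraph_iso (with_proj G) (with_proj G')"
proof -
  interpret pair_wf_digraph G by fact
  define hom where "hom = \<lparr>iso_verts = h, iso_arcs = map_prod h h, iso_head = snd, iso_tail = fst\<rparr>"
  have "inj_on (map_prod h h) (parcs G)"
  proof (rule inj_onI)
    fix e e' assume "e \<in> parcs G" "e' \<in> parcs G" "map_prod h h e = map_prod h h e'"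
    hence "fst e = fst e'" "snd e = snd e'"
      using inj_onD[OF assms(2), of "fst e" "fst e'"] inj_onD[OF assms(2), of "snd e" "snd e'"]
        arc_fst_in_verts arc_snd_in_verts by (auto simp: map_prod_def case_prod_beta)
    thus "e = e'" by (rule prod_eqI)
  qed
  hence "pre_digraph.digraph_isomorphism (with_proj G) hom"
    using assms(2) wf_digraph_axioms
    by (auto simp: pre_digraph.digraph_isomorphism_def hom_def)
  moreover have "with_proj G' = app_iso hom (with_proj G)"
    using assms(3,4) by (simp add: app_iso_def hom_def with_proj_def)
  ultimately show ?thesis unfolding digraph_iso_def by blast
qed

lemma pair_wf_digraph_B:
  assumes "3 \<le> d" "d + 3 \<le> n"
  shows "pair_wf_digraph (B n d)"
proof
  have "i < n \<and> j < n" if "(i, j) \<in> parcs (B n d)" for i j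
    using that assms by (auto simp: parcs_B Let_def B_path_vertex_def split: if_splits)
  thus "fst e \<in> pverts (B n d)" "snd e \<in> pverts (B n d)" if "e \<in> parcs (B n d)" for e
    using that by (cases e; force simp: B_def)+
qed

context induced_path
begin

text \<open>Under the isomorphism y = 1 becomes \<open>v 1\<close> and x = 0 becomes
  \<open>v 3\<close>, with twins \<open>v 2\<close>, u1, u2. The end \<open>v 0\<close> of the path
  is just another pendent vertex at \<open>v 1\<close>, which is why it is put into R.\<close>

lemma iso_B:
  fixes G :: "nat pair_pre_digraph"
  assumes dn: "3 \<le> d" "d + 3 \<le> n" and G: "pverts G = {..<n}" "\<And>x y. (x, y) \<in> parcs G \<Longrightarrow> x < n \<and> y < n"
    and adj: "\<And>x y. adj x y \<longleftrightarrow> (x, y) \<in> parcs G"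
    and P: "P \<subseteq> {..<n}" and u: "u1 \<in> {..<n} - P" "u2 \<in> {..<n} - P" "u1 \<noteq> u2"
    and indep: "\<And>w w'. w \<in> {..<n} - P \<Longrightarrow> w' \<in> {..<n} - P \<Longrightarrow> \<not> adj w w'"
    and nbs: "nb u1 = {1, 3}" "nb u2 = {1, 3}" "\<And>w. w \<in> {..<n} - P - {u1, u2} \<Longrightarrow> nb w = {1}"
  shows "digraph_iso (with_proj (B n d)) (with_proj G)"
proof -
  define R where "R = insert (v 0) ({..<n} - P - {u1, u2})"
  have cP: "card P = d + 1"
    unfolding P_def by (subst card_image) (auto simp: inj_on_def v_eq_iff)
  have "card ({..<n} - P - {u1, u2}) = card ({..<n} - P) - card {u1, u2}"
    using u by (intro card_Diff_subset) auto
  also have "card ({..<n} - P) = n - (d + 1)"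
    using P cP by (subst card_Diff_subset) auto
  finally have "card R = n - (d + 2)"
    unfolding R_def using dn u(3) by (subst card_insert_disjoint) auto
  hence "card {d + 2..<n} = card R" by simp
  moreover have "finite R" by (simp add: R_def)
  ultimately obtain g where g: "bij_betw g {d + 2..<n} R"
    using finite_same_card_bij[of "{d + 2..<n}" R] by auto
  \<comment> \<open>The path of \<open>B\<close> is numbered 0, 5, ..., d + 1 and corresponds to
    \<open>v 3\<close>, \<open>v 4\<close>, ..., \<open>v d\<close>, whence the shift j - 1. The
    pendent vertices are matched with R by an arbitrary bijection g.\<close>
  define h where "h j = (if j = 0 then v 3 else if j = 1 then v 1 else if j = 2 then v 2 else if j = 3 then u1
    else if j = 4 then u2 else if j < d + 2 then v (j - 1) else g j)" for j
  have h: "h 0 = v 3" "h 1 = v 1" "h 2 = v 2" "h 3 = u1" "h 4 = u2"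
    by (simp_all add: h_def)
  have hP: "h (B_path_vertex k) = v (k + 3)" if "k \<le> d - 3" for k
    using that dn by (auto simp: h_def B_path_vertex_def add.commute)
  have hR: "h ` {d + 2..<n} = R"
  proof -
    have "h ` {d + 2..<n} = g ` {d + 2..<n}" using dn by (intro image_cong) (auto simp: h_def)
    thus ?thesis using g by (simp add: bij_betw_def)
  qed
  have "h ` {..<n} = {..<n}"
  proof
    have vn: "v i < n" if "i \<le> d" for i using P v_in_P[OF that] by auto
    have "h j < n" if "j < n" for j
    proof (cases "j < d + 2")
      case True
      thus ?thesis using vn u dn by (auto simp: h_def)
    next
      case False
      hence "h j \<in> R" using hR that by auto
      thus ?thesis using vn[of 0] by (auto simp: R_def)
    qed
    thus "h ` {..<n} \<subseteq> {..<n}" by auto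
    show "{..<n} \<subseteq> h ` {..<n}"
    proof
      fix x assume x: "x \<in> {..<n}"
      have sub: "R \<subseteq> h ` {..<n}" unfolding hR[symmetric] by auto
      have "x \<in> R \<or> (\<exists>i. x = v i \<and> 1 \<le> i \<and> i \<le> d)" if "x \<noteq> u1" "x \<noteq> u2"
      proof (cases "x \<in> P")
        case True
        then obtain i where "x = v i" "i \<le> d" by (auto simp: P_def)
        thus ?thesis by (cases "i = 0") (auto simp: R_def)
      qed (use that x in \<open>auto simp: R_def\<close>)
      then consider "x \<in> R" | "x = u1" | "x = u2" | i where "x = v i" "1 \<le> i" "i \<le> d"
        by blast
      thus "x \<in> h ` {..<n}"
      proof cases
        case 1
        thus ?thesis using sub by blast
      next
        case 2
        thus ?thesis using h dn by (intro image_eqI[of _ _ 3]) auto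
      next
        case 3
        thus ?thesis using h dn by (intro image_eqI[of _ _ 4]) auto
      next
        case (4 i)
        consider "i = 1" | "i = 2" | "i = 3" | "4 \<le> i" using 4 by linarith
        thus ?thesis
        proof cases
          case 1
          thus ?thesis using h 4 dn by (intro image_eqI[of _ _ 1]) auto
        next
          case 2
          thus ?thesis using h 4 dn by (intro image_eqI[of _ _ 2]) auto
        next
          case 3
          thus ?thesis using h 4 dn by (intro image_eqI[of _ _ 0]) auto
        next
          case 4
          thus ?thesis using \<open>x = v i\<close> \<open>i \<le> d\<close> dn by (intro image_eqI[of _ _ "i + 1"]) (auto simp: h_def)
        qed
      qed
    qed
  qed
  moreover from this have "inj_on h {..<n}" by (intro eq_card_imp_inj_on) auto
  moreover have "map_prod h h ` parcs (B n d) = parcs G"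
  proof -
    define E\<^sub>B where "E\<^sub>B = {0, 1} \<times> {2, 3, 4} \<union> {(B_path_vertex k, B_path_vertex (Suc k)) | k. k < d - 3} \<union> {1} \<times> {d + 2..<n}"
    define D where "D = {v 3, v 1} \<times> {v 2, u1, u2} \<union> {(v (k + 3), v (k + 4)) | k. k < d - 3} \<union> {v 1} \<times> R"
    have "map_prod h h ` {(B_path_vertex k, B_path_vertex (Suc k)) | k. k < d - 3} =
        {(v (k + 3), v (k + 4)) | k. k < d - 3}"
    proof -
      have "map_prod h h (B_path_vertex k, B_path_vertex (Suc k)) = (v (k + 3), v (k + 4))" if "k < d - 3" for k
        using hP[of k] hP[of "Suc k"] that by (simp add: numeral_eq_Suc)
      hence "(\<lambda>k. map_prod h h (B_path_vertex k, B_path_vertex (Suc k))) ` {..<d - 3} =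
          (\<lambda>k. (v (k + 3), v (k + 4))) ` {..<d - 3}" by (intro image_cong) auto
      moreover have "{(B_path_vertex k, B_path_vertex (Suc k)) | k. k < d - 3} =
          (\<lambda>k. (B_path_vertex k, B_path_vertex (Suc k))) ` {..<d - 3}" by auto
      moreover have "{(v (k + 3), v (k + 4)) | k. k < d - 3} = (\<lambda>k. (v (k + 3), v (k + 4))) ` {..<d - 3}" by auto
      ultimately show ?thesis by (simp only: image_image)
    qed
    moreover have "map_prod h h ` (X \<times> Y) = (h ` X) \<times> (h ` Y)" for X Y by force
    moreover have "h ` {0, 1} = {v 3, v 1}" "h ` {2, 3, 4} = {v 2, u1, u2}" "h ` {1} = {v 1}"
      by (simp_all only: image_insert image_empty h)
    ultimately have hE: "map_prod h h ` E\<^sub>B = D"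
      unfolding E\<^sub>B_def D_def image_Un by (simp only: hR)
    have symD: "(x, y) \<in> map_prod h h ` parcs (B n d) \<longleftrightarrow> (x, y) \<in> D \<or> (y, x) \<in> D" for x y
    proof -
      have pB: "(a, b) \<in> parcs (B n d) \<longleftrightarrow> (a, b) \<in> E\<^sub>B \<or> (b, a) \<in> E\<^sub>B" for a b
        unfolding E\<^sub>B_def parcs_B Let_def ..
      have im: "(x, y) \<in> map_prod h h ` X \<longleftrightarrow> (\<exists>a b. (a, b) \<in> X \<and> x = h a \<and> y = h b)" for X x y
        by auto
      show ?thesis unfolding hE[symmetric] im pB by blast
    qed
    have DG: "adj x y" if "(x, y) \<in> D" for x y
    proof -
      have a: "adj (v i) w" if "i \<in> nb w" for i w
        using that adj_v_nb nb_le by blast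
      have "adj (v 3) (v 2)" "adj (v 1) (v 2)" "adj (v 1) (v 0)"
        using dn by (auto simp: v_adj_iff)
      moreover have "adj (v 3) u1" "adj (v 1) u1" "adj (v 3) u2" "adj (v 1) u2" using nbs a by auto
      moreover have "adj (v (k + 3)) (v (k + 4))" if "k < d - 3" for k
        using that by (subst v_adj_iff) auto
      moreover have "adj (v 1) w" if "w \<in> {..<n} - P - {u1, u2}" for w
        using nbs(3)[OF that] a by auto
      ultimately show ?thesis using that unfolding D_def R_def by auto
    qed
    have GD: "(x, y) \<in> D \<or> (y, x) \<in> D" if xy: "adj x y" for x y
    proof -
      have V: "x < n" "y < n" using G(2) xy adj by auto
      have pp: "(v i, v (Suc i)) \<in> D \<or> (v (Suc i), v i) \<in> D" if "Suc i \<le> d" for i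
      proof -
        consider "i = 0" | "i = 1" | "i = 2" | "3 \<le> i" by linarith
        thus ?thesis
        proof cases
          case 4
          hence "(v i, v (Suc i)) = (v (i - 3 + 3), v (i - 3 + 4))" "i - 3 < d - 3" using that by auto
          thus ?thesis unfolding D_def by blast
        qed (auto simp: D_def R_def numeral_eq_Suc)
      qed
      have up: "(v i, w) \<in> D" if "w \<in> {..<n} - P" "i \<in> nb w" for i w
        using that nbs by (cases "w = u1"; cases "w = u2") (auto simp: D_def R_def)
      consider "x \<in> P" "y \<in> P" | "x \<in> P" "y \<in> {..<n} - P" | "x \<in> {..<n} - P" "y \<in> P"
        using indep[of x y] xy V by blast
      thus ?thesis
      proof cases
        case 1
        then obtain i j where ij: "i \<le> d" "j \<le> d" "x = v i" "y = v j" by (auto simp: P_def)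
        thus ?thesis using xy pp[of i] pp[of j] by (auto simp: v_adj_iff)
      next
        case 2
        then obtain i where "i \<le> d" "x = v i" by (auto simp: P_def)
        thus ?thesis using up[OF 2(2), of i] xy by (simp add: adj_v_nb)
      next
        case 3
        then obtain i where "i \<le> d" "y = v i" by (auto simp: P_def)
        thus ?thesis using up[OF 3(1), of i] xy by (simp add: nb_def)
      qed
    qed
    have "(x, y) \<in> map_prod h h ` parcs (B n d) \<longleftrightarrow> (x, y) \<in> parcs G" for x y
      unfolding symD adj[symmetric] using DG GD adj_sym by blast
    thus ?thesis by auto
  qed
  ultimately show ?thesis
    using pair_wf_digraph_B[OF dn] G(1)
    by (intro digraph_iso_pair_digraphI[of _ h]) (auto simp: B_def)
qed

end

section \<open>Shortest paths\<close>

text \<open>Distances are treated below as least exponents of relation powers; this connects them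
  with the walks in the definition of \<open>diameter\<close>.\<close>

lemma relpow_awalk:
  assumes "pair_wf_digraph G" "a \<in> pverts G"
  shows "(a, b) \<in> parcs G ^^ k \<longleftrightarrow> (\<exists>p. pre_digraph.awalk (with_proj G) a p b \<and> length p = k)"
proof -
  interpret pair_wf_digraph G by fact
  show ?thesis
    using assms(2)
  proof (induction k arbitrary: a)
    case 0
    thus ?case by (auto simp: awalk_Nil_iff)
  next
    case (Suc k)
    have "(a, b) \<in> parcs G ^^ Suc k \<longleftrightarrow> (\<exists>c. (a, c) \<in> parcs G \<and> (c, b) \<in> parcs G ^^ k)"
      by (metis relpow_Suc_D2 relpow_Suc_I2)
    also have "\<dots> \<longleftrightarrow> (\<exists>c. (a, c) \<in> parcs G \<and> (\<exists>p. awalk c p b \<and> length p = k))"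
      using Suc.IH in_arcsD2 by blast
    also have "\<dots> \<longleftrightarrow> (\<exists>p. awalk a p b \<and> length p = Suc k)"
      by (auto simp: length_Suc_conv awalk_Cons_iff) (metis fst_conv snd_conv awalk_Cons_iff)+
    finally show ?case .
  qed
qed

lemma finite_SUP_attained:
  fixes f :: "'a \<Rightarrow> 'b::complete_linorder"
  assumes "finite X" "X \<noteq> {}"
  obtains x where "x \<in> X" "(SUP x\<in>X. f x) = f x"
  using Max_in[of "f ` X"] Max_Sup[of "f ` X"] assms by auto

text \<open>The supremum ranges over a finite set and is attained. With unit costs the cost of a
  walk is its length, so the infimum is a least exponent, which exists by connectedness.\<close>

lemma diameter_attained:
  assumes G: "pair_wf_digraph G" "finite (pverts G)" "pverts G \<noteq> {}" and d: "diameter G = ereal (real d)"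
    and con: "\<And>a b. a \<in> pverts G \<Longrightarrow> b \<in> pverts G \<Longrightarrow> (a, b) \<in> (parcs G)\<^sup>*"
  obtains a b where "a \<in> pverts G" "b \<in> pverts G" "(a, b) \<in> parcs G ^^ d"
    "\<And>k. (a, b) \<in> parcs G ^^ k \<Longrightarrow> d \<le> k"
proof -
  interpret pair_wf_digraph G by fact
  obtain a where a: "a \<in> pverts G"
    "(SUP a\<in>pverts G. SUP b\<in>pverts G. \<mu> (\<lambda>_. 1) a b) = (SUP b\<in>pverts G. \<mu> (\<lambda>_. 1) a b)"
    by (rule finite_SUP_attained[OF G(2,3)])
  obtain b where b: "b \<in> pverts G" "(SUP b\<in>pverts G. \<mu> (\<lambda>_. 1) a b) = \<mu> (\<lambda>_. 1) a b"
    by (rule finite_SUP_attained[OF G(2,3)])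
  define m where "m = (LEAST k. (a, b) \<in> parcs G ^^ k)"
  have ex: "\<exists>k. (a, b) \<in> parcs G ^^ k" using con[OF a(1) b(1)] rtrancl_imp_relpow by blast
  have m: "(a, b) \<in> parcs G ^^ m" "\<And>k. (a, b) \<in> parcs G ^^ k \<Longrightarrow> m \<le> k"
    unfolding m_def using LeastI_ex[OF ex] Least_le by auto
  have cost: "awalk_cost (\<lambda>_. 1) p = real (length p)" for p :: "('a \<times> 'a) list"
    by (induction p) auto
  have "\<mu> (\<lambda>_. 1) a b = ereal (real m)"
    unfolding \<mu>_def
  proof (rule INF_eqI)
    fix p assume "p \<in> {p. awalk a p b}"
    hence "(a, b) \<in> parcs G ^^ length p" using relpow_awalk[OF G(1) a(1)] by blast
    thus "ereal (real m) \<le> ereal (awalk_cost (\<lambda>_. 1) p)" using m(2) by (simp add: cost)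
  next
    fix z assume z: "\<And>p. p \<in> {p. awalk a p b} \<Longrightarrow> z \<le> ereal (awalk_cost (\<lambda>_. 1) p)"
    obtain p where "awalk a p b" "length p = m" using m(1) relpow_awalk[OF G(1) a(1)] by blast
    thus "z \<le> ereal (real m)" using z[of p] by (simp add: cost)
  qed
  hence "m = d" using a(2) b(2) d by (simp add: diameter_def)
  thus ?thesis using that a b m by blast
qed

text \<open>A walk of k steps from \<open>v i\<close> to \<open>v j\<close> with j > i + k would
  shorten the way from a to b. The values k = 0, 1, 2 give injectivity, the absence of chords, and
  the bound on the spread of the neighbours of u.\<close>

lemma geodesic_path:
  assumes E: "sym E" "irrefl E" and ab: "(a, b) \<in> E ^^ d" "\<And>k. (a, b) \<in> E ^^ k \<Longrightarrow> d \<le> k"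
  obtains v where "v 0 = a" "\<And>i. i < d \<Longrightarrow> (v i, v (Suc i)) \<in> E"
    "\<And>i j. i \<le> d \<Longrightarrow> j \<le> d \<Longrightarrow> v i = v j \<longleftrightarrow> i = j"
    "\<And>i j. i \<le> d \<Longrightarrow> j \<le> d \<Longrightarrow> (v i, v j) \<in> E \<longleftrightarrow> i = Suc j \<or> j = Suc i"
    "\<And>u i k. i \<le> d \<Longrightarrow> k \<le> d \<Longrightarrow> (u, v i) \<in> E \<Longrightarrow> (u, v k) \<in> E \<Longrightarrow> k \<le> i + 2"
proof -
  obtain v where v: "v 0 = a" "v d = b" "\<And>i. i < d \<Longrightarrow> (v i, v (Suc i)) \<in> E"
    using ab(1) relpow_fun_conv[of a b d E] by blast
  have seg: "(v i, v (i + m)) \<in> E ^^ m" if "i + m \<le> d" for i m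
    using that
  proof (induction m)
    case (Suc m)
    thus ?case using v(3)[of "i + m"] by (auto intro: relpow_Suc_I)
  qed simp
  have far: "j \<le> i + k" if "i \<le> d" "j \<le> d" "(v i, v j) \<in> E ^^ k" for i j k
  proof -
    have "(a, v i) \<in> E ^^ i" "(v j, b) \<in> E ^^ (d - j)"
      using seg[of 0 i] seg[of j "d - j"] that v(1,2) by auto
    hence "(a, b) \<in> E ^^ (i + k + (d - j))"
      using that(3) by (auto simp: relpow_add)
    hence "d \<le> i + k + (d - j)" by (rule ab(2))
    thus ?thesis using that by simp
  qed
  have eq: "v i = v j \<longleftrightarrow> i = j" if "i \<le> d" "j \<le> d" for i j
    using far[OF that, of 0] far[OF that(2,1), of 0] by auto
  have E1: "j \<le> i + 1" if "i \<le> d" "j \<le> d" "(v i, v j) \<in> E" for i j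
    using far[OF that(1,2), of 1] that(3) by simp
  have adj: "(v i, v j) \<in> E \<longleftrightarrow> i = Suc j \<or> j = Suc i" if "i \<le> d" "j \<le> d" for i j
  proof
    assume e: "(v i, v j) \<in> E"
    hence "(v j, v i) \<in> E" using E(1) by (rule symD[rotated])
    moreover have "i \<noteq> j" using e E(2) by (auto simp: irrefl_def)
    ultimately show "i = Suc j \<or> j = Suc i" using E1[OF that e] E1[OF that(2,1)] by auto
  next
    assume "i = Suc j \<or> j = Suc i"
    thus "(v i, v j) \<in> E" using v(3)[of i] v(3)[of j] that symD[OF E(1)] by auto
  qed
  have "k \<le> i + 2" if "i \<le> d" "k \<le> d" "(u, v i) \<in> E" "(u, v k) \<in> E" for u i k
  proof -
    have "(v i, u) \<in> E" using that(3) E(1) by (rule symD[rotated])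
    hence "(v i, v k) \<in> E ^^ 2" using that(4) by (auto simp: numeral_2_eq_2)
    thus ?thesis by (rule far[OF that(1,2)])
  qed
  thus ?thesis using that[of v] v(1,3) eq adj by blast
qed

lemma connected_rtrancl:
  assumes G: "pair_graph G" "Digraph_Component.connected (with_proj G)" and ab: "a \<in> pverts G" "b \<in> pverts G"
  shows "(a, b) \<in> (parcs G)\<^sup>*"
proof -
  interpret pair_graph G by fact
  have "parcs (mk_symmetric (with_proj G)) = parcs G"
    using adj_mk_symmetric_eq[OF pair_sym_arcs] by simp
  moreover have "a \<rightarrow>\<^sup>*\<^bsub>with_proj (mk_symmetric (with_proj G))\<^esub> b"
    using G(2) ab by (auto simp: Digraph_Component.connected_def strongly_connected_def)
  ultimately have "(a, b) \<in> rtrancl_on (pverts G) (parcs G)"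
    by (simp add: reachable_def)
  thus ?thesis by induction auto
qed

context induced_path
begin

text \<open>Edges are sorted by the number of their ends on P; as P is induced, those with two ends
  there are exactly its d edges.\<close>

lemma card_all_edges:
  assumes "finite V" "P \<subseteq> V"
  shows "card {{x, y} | x y. x \<in> V \<and> y \<in> V \<and> adj x y} =
    d + (\<Sum>u\<in>V - P. card (nb u)) + card {{x, y} | x y. x \<in> V - P \<and> y \<in> V - P \<and> adj x y}"
proof -
  define E\<^sub>P where "E\<^sub>P = (\<lambda>i. {v i, v (Suc i)}) ` {..<d}"
  define X where "X u = (\<lambda>i. {u, v i}) ` nb u" for u
  define E\<^sub>I where "E\<^sub>I = {{x, y} | x y. x \<in> V - P \<and> y \<in> V - P \<and> adj x y}"
  have "E\<^sub>I \<subseteq> Pow V" by (auto simp: E\<^sub>I_def)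
  hence finI: "finite E\<^sub>I" using assms(1) by (meson finite_Pow_iff finite_subset)
  have finX: "finite (X u)" for u by (auto simp: X_def nb_def)
  have nbP: "v i \<in> P" if "i \<in> nb u" for i u using that by (auto simp: nb_def)
  have eq: "{{x, y} | x y. x \<in> V \<and> y \<in> V \<and> adj x y} = E\<^sub>P \<union> ((\<Union>u\<in>V - P. X u) \<union> E\<^sub>I)" (is "?E = ?R")
  proof
    show "?E \<subseteq> ?R"
    proof (rule subsetI, rule ccontr)
      fix e assume "e \<in> ?E" and notin: "e \<notin> ?R"
      then obtain x y where e: "e = {x, y}" "x \<in> V" "y \<in> V" "adj x y" by blast
      with notin have xy: "x \<in> V" "y \<in> V" "adj x y" "{x, y} \<notin> E\<^sub>I" "{x, y} \<notin> (\<Union>u\<in>V - P. X u)"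
        by blast+
      have up: "{w, z} \<in> (\<Union>u\<in>V - P. X u)" if "w \<in> V - P" "z \<in> P" "adj w z" for w z
        using that by (auto simp: X_def P_def nb_def)
      have "x \<in> P" "y \<in> P"
        using xy up[of x y] up[of y x] adj_sym[of x y] by (auto simp: E\<^sub>I_def insert_commute)
      then obtain i j where "i \<le> d" "j \<le> d" "x = v i" "y = v j" by (auto simp: P_def)
      hence "{x, y} \<in> E\<^sub>P" using xy(3) by (auto simp: v_adj_iff E\<^sub>P_def insert_commute)
      thus False using notin e(1) by blast
    qed
    have "v i \<in> V" if "i \<le> d" for i using that assms(2) v_in_P by blast
    thus "?R \<subseteq> ?E"
      using assms(2) by (fastforce simp: E\<^sub>P_def X_def E\<^sub>I_def nb_def v_adj_iff)
  qed
  have "card E\<^sub>P = d"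
    unfolding E\<^sub>P_def by (subst card_image) (auto simp: inj_on_def doubleton_eq_iff v_eq_iff)
  moreover have "card (X u) = card (nb u)" if "u \<in> V - P" for u
    unfolding X_def
  proof (rule card_image, rule inj_onI)
    fix i j assume *: "i \<in> nb u" "j \<in> nb u" "{u, v i} = {u, v j}"
    hence "v i = v j" by (auto simp: doubleton_eq_iff)
    thus "i = j" using * nb_le v_eq_iff by blast
  qed
  moreover have "card (\<Union>u\<in>V - P. X u) = (\<Sum>u\<in>V - P. card (X u))"
  proof (rule card_UN_disjoint)
    show "\<forall>i\<in>V - P. \<forall>j\<in>V - P. i \<noteq> j \<longrightarrow> X i \<inter> X j = {}"
      using nbP by (fastforce simp: X_def doubleton_eq_iff)
  qed (use assms finX in auto)
  moreover have "card (E\<^sub>P \<union> ((\<Union>u\<in>V - P. X u) \<union> E\<^sub>I)) =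
      card E\<^sub>P + (card (\<Union>u\<in>V - P. X u) + card E\<^sub>I)"
  proof -
    have P1: "e \<subseteq> P" if "e \<in> E\<^sub>P" for e using that by (auto simp: E\<^sub>P_def)
    have P2: "\<not> e \<subseteq> P \<and> e \<inter> P \<noteq> {}" if "e \<in> X u" "u \<in> V - P" for e u
      using that nbP by (auto simp: X_def)
    have P3: "e \<inter> P = {} \<and> e \<noteq> {}" if "e \<in> E\<^sub>I" for e using that by (auto simp: E\<^sub>I_def)
    have "(\<Union>u\<in>V - P. X u) \<inter> E\<^sub>I = {}" using P2 P3 by blast
    moreover have "E\<^sub>P \<inter> ((\<Union>u\<in>V - P. X u) \<union> E\<^sub>I) = {}" using P1 P2 P3 by blast
    moreover have "finite E\<^sub>P" by (simp add: E\<^sub>P_def)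
    ultimately show ?thesis using finI finX assms(1) by (simp add: card_Un_disjoint)
  qed
  ultimately show ?thesis unfolding eq by (simp add: E\<^sub>I_def)
qed

end

section \<open>The comparison\<close>

text \<open>The surplus terms have degrees 4 and 6, that is index 2 or 3, and
  \<open>6 \<le> n\<close> keeps both indices in range.\<close>

lemma skew_succ_of_minor_poly:
  assumes n: "6 \<le> n" and H': "minor_poly (skew_sign H') {} {..<n} = T"
    and H: "T + \<xi> * \<xi> \<preceq> minor_poly (skew_sign H) {} {..<n} \<or>
      T + \<xi> * (\<xi> * \<xi>) \<preceq> minor_poly (skew_sign H) {} {..<n}"
  shows "skew_succ n H H'"
proof -
  have "\<xi> * \<xi> = monom 1 (2 * 2)" "\<xi> * (\<xi> * \<xi>) = monom 1 (2 * 3)" by (simp_all add: mult_monom)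
  then obtain j where j: "j = 2 \<or> j = 3" "T + monom 1 (2 * j) \<preceq> minor_poly (skew_sign H) {} {..<n}"
    using H by (metis (no_types))
  have "coeff (T + monom 1 (2 * j)) (2 * i) \<le> coeff (minor_poly (skew_sign H) {} {..<n}) (2 * i)" for i
    using j(2) by (simp only: coeff_le_def)
  hence "skew_coeff n H' (2 * i) + coeff (monom 1 (2 * j)) (2 * i) \<le> skew_coeff n H (2 * i)" if "i \<le> n div 2" for i
    using that skew_coeff_eq_coeff_minor_poly[of i n] by (simp only: H' coeff_add)
  moreover have "j \<le> n div 2" using j(1) n by auto
  ultimately show ?thesis
    unfolding skew_succ_def skew_succeq_def by (fastforce simp: split: if_splits)
qed

theorem theorem3p5:
  fixes n d t :: nat
    and G H H' :: "nat pair_pre_digraph"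
    and C\<^sub>a C\<^sub>b :: "(nat \<times> nat) list"
  assumes "3 \<le> d" and "d + 3 \<le> n"
    and "G \<in> bicyclic_class_diam n d"
    and "\<not> digraph_iso (with_proj G) (with_proj (B n d))"
    and "is_cycle G C\<^sub>a" and "is_cycle G C\<^sub>b" and "cycle_edges C\<^sub>a \<noteq> cycle_edges C\<^sub>b"
    and "t = card (cycle_verts C\<^sub>a \<inter> cycle_verts C\<^sub>b)" and "t \<ge> 1"
    and "orientation G H"
    and "B_even_orientation n d H'"
  shows "skew_succ n H H'"
proof -
  have G: "pair_graph G" "pverts G = {..<n}" "Digraph_Component.connected (with_proj G)"
    "card (edges G) = n + 1" "diameter G = ereal (real d)"
    using assms(3) by (auto simp: bicyclic_class_diam_def bicyclic_class_def bicyclic_def)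
  interpret G: pair_graph G by (rule G(1))
  have sym: "sym (parcs G)" using G.pair_sym_arcs by (simp add: symmetric_def)
  have irrefl: "irrefl (parcs G)" using G.pair_no_loops by (force simp: irrefl_def)
  have verts: "x < n \<and> y < n" if "(x, y) \<in> parcs G" for x y
    using that G.in_arcsD1 G.in_arcsD2 G(2) by auto
  have ne: "finite (pverts G)" "pverts G \<noteq> {}"
    unfolding G(2) using assms(2) by (simp_all add: lessThan_empty_iff)
  obtain a b where ab: "a \<in> pverts G" "b \<in> pverts G" "(a, b) \<in> parcs G ^^ d"
    "\<And>k. (a, b) \<in> parcs G ^^ k \<Longrightarrow> d \<le> k"
  proof (rule diameter_attained[OF G.pair_wf_digraph_axioms ne G(5)])
    show "(a, b) \<in> (parcs G)\<^sup>*" if "a \<in> pverts G" "b \<in> pverts G" for a b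
      by (rule connected_rtrancl[OF G(1,3) that])
  qed (rule that)
  obtain v where v: "v 0 = a" "\<And>i. i < d \<Longrightarrow> (v i, v (Suc i)) \<in> parcs G"
    "\<And>i j. i \<le> d \<Longrightarrow> j \<le> d \<Longrightarrow> v i = v j \<longleftrightarrow> i = j"
    "\<And>i j. i \<le> d \<Longrightarrow> j \<le> d \<Longrightarrow> (v i, v j) \<in> parcs G \<longleftrightarrow> i = Suc j \<or> j = Suc i"
    "\<And>u i k. i \<le> d \<Longrightarrow> k \<le> d \<Longrightarrow> (u, v i) \<in> parcs G \<Longrightarrow> (u, v k) \<in> parcs G \<Longrightarrow> k \<le> i + 2"
    by (rule geodesic_path[OF sym irrefl ab(3,4)]) (assumption, rule that)
  have v_less: "v i < n" if "i \<le> d" for i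
  proof (cases i)
    case 0
    thus ?thesis using v(1) ab(1) G(2) by simp
  next
    case (Suc i')
    thus ?thesis using v(2)[of i'] verts that by auto
  qed
  interpret skew_sign_matrix "skew_sign H" by (rule skew_sign_matrix_orientation[OF assms(10)])
  have adj: "adj x y \<longleftrightarrow> (x, y) \<in> parcs G" for x y by (rule adj_skew_sign[OF assms(10)])
  have "path_on v (Suc d)" unfolding path_on_def using v(3,4) by (simp add: adj)
  then interpret induced_path "skew_sign H" v d by unfold_locales
  have PV: "P \<subseteq> {..<n}" using v_less by (auto simp: P_def)
  have cardP: "card P = d + 1"
    unfolding P_def by (subst card_image) (auto simp: inj_on_def v(3))
  have cardU: "card ({..<n} - P) = n - d - 1"
    using PV cardP by (subst card_Diff_subset) auto
  \<comment> \<open>The distance to P. The first step of a shortest walk to P supplies the parent of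
    a vertex without path neighbours.\<close>
  define \<rho> where "\<rho> x = (LEAST k. \<exists>p\<in>P. (x, p) \<in> parcs G ^^ k)" for x
  interpret bicyclic_with_path "skew_sign H" v d "{..<n}" \<rho>
  proof unfold_locales
    show "k \<le> i + 2" if "i \<in> nb u" "k \<in> nb u" for u i k
      using that v(5)[of i k u] by (auto simp: nb_def adj)
    show "\<exists>w\<in>{..<n} - P. adj u w \<and> \<rho> w < \<rho> u" if u: "u \<in> {..<n} - P" "nb u = {}" for u
    proof -
      have "(u, a) \<in> (parcs G)\<^sup>*" using connected_rtrancl[OF G(1,3), of u a] u ab(1) G(2) by auto
      moreover have "a \<in> P" using v(1) by (auto simp: P_def)
      ultimately have "\<exists>k. \<exists>p\<in>P. (u, p) \<in> parcs G ^^ k" using rtrancl_imp_relpow by blast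
      from LeastI_ex[OF this] obtain p where p: "p \<in> P" "(u, p) \<in> parcs G ^^ \<rho> u"
        unfolding \<rho>_def by blast
      have "\<rho> u \<noteq> 0"
      proof
        assume "\<rho> u = 0"
        with p(2) have "(u, p) \<in> parcs G ^^ 0" by metis
        hence "u = p" by simp
        thus False using p(1) u(1) by simp
      qed
      then obtain k where k: "\<rho> u = Suc k" by (cases "\<rho> u") auto
      then obtain w where w: "(u, w) \<in> parcs G" "(w, p) \<in> parcs G ^^ k"
        using p(2) by (metis relpow_Suc_D2)
      have "\<rho> w \<le> k" unfolding \<rho>_def using w(2) p(1) by (intro Least_le) blast
      moreover have "w \<notin> P" using u(2) w(1) by (auto simp: P_def nb_def adj)
      ultimately show ?thesis using w(1) verts[OF w(1)] k adj by auto
    qed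
    have "edges G = {{x, y} | x y. x \<in> {..<n} \<and> y \<in> {..<n} \<and> adj x y}"
      unfolding edges_def using verts by (auto simp: adj image_iff)
    hence "n + 1 = d + (\<Sum>u\<in>{..<n} - P. card (nb u)) +
        card {{x, y} | x y. x \<in> {..<n} - P \<and> y \<in> {..<n} - P \<and> adj x y}"
      using card_all_edges[OF finite_lessThan PV] G(4) by simp
    thus "card {{x, y} | x y. x \<in> {..<n} - P \<and> y \<in> {..<n} - P \<and> adj x y} +
        (\<Sum>u\<in>{..<n} - P. card (nb u)) = card ({..<n} - P) + 2"
      using cardU assms(1,2) by linarith
  qed (use PV assms(1) in auto)
  have target: "target = extremal_poly d (n - d - 1)"
    by (simp only: target_def extremal_poly_def \<alpha>_def \<beta>_def \<gamma>_def U_def cardU)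
  from F_V_gt_or_extremal consider
      "target + \<xi> * \<xi> \<preceq> F {} {..<n} \<or> target + \<xi> * (\<xi> * \<xi>) \<preceq> F {} {..<n}"
    | u1 u2 i j where "u1 \<in> U" "u2 \<in> U" "u1 \<noteq> u2" "E\<^sub>U = {}" "nb u1 = {i, i + 2}" "nb u2 = {i, i + 2}"
      "\<forall>w\<in>U - {u1, u2}. nb w = {j}" "i = 1 \<and> j = 1 \<or> i + 3 = d \<and> j = d - 1"
    by blast
  thus ?thesis
  proof cases
    case 1
    show ?thesis
      by (rule skew_succ_of_minor_poly[OF _ minor_poly_B[OF assms(1,2,11)]])
         (use 1 target assms(1,2) in auto)
  next
    case (2 u1 u2 i j)
    have indep: "\<not> adj w w'" if "w \<in> {..<n} - P" "w' \<in> {..<n} - P" for w w'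
      using E\<^sub>U_I[of w w'] that \<open>E\<^sub>U = {}\<close> by (auto simp: U_def)
    have iso: "digraph_iso (with_proj (B n d)) (with_proj G)"
    proof (cases "i = 1 \<and> j = 1")
      case True
      show ?thesis
        by (rule iso_B[OF assms(1,2) G(2) verts adj PV _ _ 2(3) indep])
           (use 2 True in \<open>auto simp: U_def numeral_eq_Suc\<close>)
    next
      case False
      hence ij: "i + 3 = d" "j = d - 1" using 2(8) by auto
      \<comment> \<open>Reversing the path turns the position i + 3 = d, j = d - 1 into the one
        treated by \<open>iso_B\<close>: the neighbours d - 3 and d - 1 become 3 and 1.\<close>
      interpret rev: induced_path "skew_sign H" "\<lambda>k. v (d - k)" d
      proof
        show "path_on (\<lambda>k. v (d - k)) (Suc d)" using path_on_down[of 0 "Suc d"] by simp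
      qed
      have "(\<lambda>k. v (d - k)) ` {..d} = v ` {..d}"
        using image_down[of 0 "Suc d"] by (simp add: atLeast0LessThan lessThan_Suc_atMost)
      hence revP: "rev.P = P" by (simp add: rev.P_def P_def)
      have revnb: "rev.nb w = (\<lambda>k. d - k) ` nb w" for w
      proof
        show "rev.nb w \<subseteq> (\<lambda>k. d - k) ` nb w"
        proof
          fix k assume "k \<in> rev.nb w"
          hence "k \<le> d" "d - k \<in> nb w" by (auto simp: rev.nb_def nb_def)
          thus "k \<in> (\<lambda>k. d - k) ` nb w" by (intro image_eqI[of _ _ "d - k"]) auto
        qed
        show "(\<lambda>k. d - k) ` nb w \<subseteq> rev.nb w" by (auto simp: rev.nb_def nb_def)
      qed
      show ?thesis
        by (rule rev.iso_B[OF assms(1,2) G(2) verts adj _ _ _ 2(3)])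
           (use 2 ij indep PV assms(1) in \<open>auto simp: revP revnb U_def\<close>)
    qed
    interpret B: pair_wf_digraph "B n d" by (rule pair_wf_digraph_B[OF assms(1,2)])
    have "digraph_iso (with_proj G) (with_proj (B n d))"
      by (rule digraph_iso_swap[OF B.wf_digraph_axioms iso])
    with assms(4) show ?thesis by contradiction
  qed
qed

end
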